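(* Let $k$ be a positive integer, let $G$ be a graph (multiple edges and loops allowed) and let $T \subseteq V(G)$. If every edge-cut in $G$ separating $T$ has size at least $6k+6$, then $G$ contains $k$ pairwise edge-disjoint $T$-connectors.
   Context: An edge-cut of $G$ is a set of edges of the form $\delta(X)$ (all edges with exactly one end in $X$) for some $\emptyset \neq X \subsetneq V(G)$. An edge-cut $C$ separates $T$ if at least two components of $G \setminus C$ contain vertices of $T$. For two edges $e=uv$ and $e'=uv'$ sharing the end $u$, splitting $e$ and $e'$ from $u$ means deleting $e$ and $e'$ and adding a new edge $vv'$. A $T$-connector is a subgraph of $G$ which can be turned, by repeatedly splitting pairs of edges, into a connected graph with vertex set $T$ (vertices outside $T$ that become isolated being discarded). *)

theory Defs
  imports Main
begin

text \<open>
  Undirected multigraphs with labelled edges. The ends of an edge form an unordered pair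
  \<open>{u, v}\<close>; a loop at \<open>u\<close> has the singleton \<open>{u} = {u, u}\<close>. The value of \<open>ends\<close> outside
  \<open>edges\<close> is irrelevant.
\<close>

record ('v, 'e) multigraph =
  vertices :: "'v set"
  edges :: "'e set"
  ends :: "'e \<Rightarrow> 'v set"

definition wf_multigraph :: "('v, 'e) multigraph \<Rightarrow> bool" where
  "wf_multigraph G \<longleftrightarrow>
     (\<forall>e \<in> edges G. \<exists>u \<in> vertices G. \<exists>v \<in> vertices G. ends G e = {u, v})"

definition finite_multigraph :: "('v, 'e) multigraph \<Rightarrow> bool" where
  "finite_multigraph G \<longleftrightarrow> wf_multigraph G \<and> finite (vertices G) \<and> finite (edges G)"

definition subgraph :: "('v, 'e) multigraph \<Rightarrow> ('v, 'e) multigraph \<Rightarrow> bool" where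
  "subgraph H G \<longleftrightarrow>
     wf_multigraph H \<and> vertices H \<subseteq> vertices G \<and> edges H \<subseteq> edges G \<and>
     (\<forall>e \<in> edges H. ends H e = ends G e)"

definition adjacent :: "('v, 'e) multigraph \<Rightarrow> 'v \<Rightarrow> 'v \<Rightarrow> bool" where
  "adjacent G u v \<longleftrightarrow> (\<exists>e \<in> edges G. ends G e = {u, v})"

text \<open>The graph without vertices counts as connected; this matters only for \<open>T = {}\<close>.\<close>

definition connected_graph :: "('v, 'e) multigraph \<Rightarrow> bool" where
  "connected_graph G \<longleftrightarrow> (\<forall>u \<in> vertices G. \<forall>v \<in> vertices G. (adjacent G)\<^sup>*\<^sup>* u v)"

text \<open>Components are represented by their vertex sets.\<close>

definition components :: "('v, 'e) multigraph \<Rightarrow> 'v set set" where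
  "components G = {{v \<in> vertices G. (adjacent G)\<^sup>*\<^sup>* u v} | u. u \<in> vertices G}"

definition delete_edges :: "('v, 'e) multigraph \<Rightarrow> 'e set \<Rightarrow> ('v, 'e) multigraph" where
  "delete_edges G C = G\<lparr>edges := edges G - C\<rparr>"

definition boundary :: "('v, 'e) multigraph \<Rightarrow> 'v set \<Rightarrow> 'e set" where
  "boundary G X = {e \<in> edges G. \<exists>u v. ends G e = {u, v} \<and> u \<in> X \<and> v \<notin> X}"

definition edge_cut :: "('v, 'e) multigraph \<Rightarrow> 'e set \<Rightarrow> bool" where
  "edge_cut G C \<longleftrightarrow> (\<exists>X. X \<noteq> {} \<and> X \<subset> vertices G \<and> C = boundary G X)"

definition separates :: "('v, 'e) multigraph \<Rightarrow> 'e set \<Rightarrow> 'v set \<Rightarrow> bool" where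
  "separates G C T \<longleftrightarrow>
     (\<exists>K \<in> components (delete_edges G C). \<exists>L \<in> components (delete_edges G C).
        K \<noteq> L \<and> K \<inter> T \<noteq> {} \<and> L \<inter> T \<noteq> {})"

text \<open>
  The label \<open>f\<close> of the new edge is arbitrary, apart from not naming a remaining edge. It may
  be one of the labels just freed, so a label is available even if \<open>'e\<close> is finite.
\<close>

definition split_step :: "('v, 'e) multigraph \<Rightarrow> ('v, 'e) multigraph \<Rightarrow> bool" where
  "split_step G H \<longleftrightarrow>
     (\<exists>u v v' e e' f.
        e \<in> edges G \<and> e' \<in> edges G \<and> e \<noteq> e' \<and>
        ends G e = {u, v} \<and> ends G e' = {u, v'} \<and>
        f \<notin> edges G - {e, e'} \<and>
        H = \<lparr>vertices = vertices G,
             edges = insert f (edges G - {e, e'}),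
             ends = (ends G)(f := {v, v'})\<rparr>)"

definition isolated :: "('v, 'e) multigraph \<Rightarrow> 'v \<Rightarrow> bool" where
  "isolated G v \<longleftrightarrow> (\<forall>e \<in> edges G. v \<notin> ends G e)"

definition discard_isolated :: "'v set \<Rightarrow> ('v, 'e) multigraph \<Rightarrow> ('v, 'e) multigraph" where
  "discard_isolated T G = G\<lparr>vertices := {v \<in> vertices G. v \<in> T \<or> \<not> isolated G v}\<rparr>"

definition T_connector :: "('v, 'e) multigraph \<Rightarrow> 'v set \<Rightarrow> ('v, 'e) multigraph \<Rightarrow> bool" where
  "T_connector G T H \<longleftrightarrow>
     subgraph H G \<and>
     (\<exists>H'. split_step\<^sup>*\<^sup>* H H' \<and>
           vertices (discard_isolated T H') = T \<and>
           connected_graph (discard_isolated T H'))"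

end

theory Submission
  imports Defs
begin

text \<open>
  Every edge is given a colour in \<open>0..k\<close> (\<open>0\<close> meaning unused) and the coloured half-edges at each
  nonterminal are paired within their colour, so that each colour class decomposes into trails that
  may be split off. The stronger statement proved by induction fixes a terminal \<open>v\<close> of degree exactly
  \<open>6k + 6\<close> whose edges are coloured in advance: if enough edges of some set of good edges at \<open>v\<close> are
  left unused, the colouring extends so that each colour connects \<open>T - {v}\<close> without passing through
  \<open>v\<close> and reaches every precoloured edge, while prescribed numbers of good edges at the other tight
  terminals stay unused. This interface is what makes the statement survive cutting the graph along a
  tight set \<open>X\<close>: the side \<open>X\<close>, solved with the other side contracted to \<open>v\<close>, determines the good edges
  demanded at the contracted vertex of the other side.

  If all tight sets are trivial, every edge off the tight terminals can be deleted, and a Mader-type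
  uncrossing argument detaches a pair of edges at each nonterminal of degree at least four. The graphs
  that remain are hypergraphs on \<open>T\<close> whose edges have two or three vertices. There the triples are
  trimmed to pairs without spoiling a partition-connectivity bound with slack, and matroid union of
  \<open>k\<close> graphic matroids together with one uniform matroid per demand yields the trees.
\<close>

section \<open>Matroid union\<close>

locale rank_family =
  fixes J :: "'j set" and r :: "'j \<Rightarrow> 'a set \<Rightarrow> nat" and \<rho> :: "'j \<Rightarrow> nat"
  assumes finite_J: "finite J"
    and rank_submodular: "\<And>j A B. j \<in> J \<Longrightarrow> r j (A \<union> B) + r j (A \<inter> B) \<le> r j A + r j B"
    and rank_mono: "\<And>j A B. j \<in> J \<Longrightarrow> A \<subseteq> B \<Longrightarrow> r j A \<le> r j B"
    and rank_le: "\<And>j A. j \<in> J \<Longrightarrow> r j A \<le> \<rho> j"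
begin

lemma rank_Un_eq:
  assumes j: "j \<in> J" and "finite P" and "\<And>e. e \<in> P \<Longrightarrow> r j (insert e A) = r j A"
  shows "r j (A \<union> P) = r j A"
  using assms(2,3)
proof (induction P rule: finite_induct)
  case (insert x P)
  have "r j ((A \<union> P) \<union> insert x A) + r j ((A \<union> P) \<inter> insert x A) \<le> r j (A \<union> P) + r j (insert x A)"
    by (rule rank_submodular[OF j])
  moreover have "r j A \<le> r j ((A \<union> P) \<inter> insert x A)" by (rule rank_mono[OF j]) auto
  moreover have "(A \<union> P) \<union> insert x A = A \<union> insert x P" by auto
  moreover have "r j A \<le> r j (A \<union> insert x P)" by (rule rank_mono[OF j]) auto
  ultimately show ?case using insert by auto
qed simp

definition extendable :: "'a set \<Rightarrow> ('j \<Rightarrow> 'a set) \<Rightarrow> bool" where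
  "extendable P F \<longleftrightarrow> (\<forall>A\<subseteq>P. sum \<rho> J \<le> card (P - A) + (\<Sum>j\<in>J. r j (A \<union> F j)))"

definition tight :: "'a set \<Rightarrow> ('j \<Rightarrow> 'a set) \<Rightarrow> 'a set \<Rightarrow> bool" where
  "tight P F A \<longleftrightarrow> A \<subseteq> P \<and> card (P - A) + (\<Sum>j\<in>J. r j (A \<union> F j)) = sum \<rho> J"

lemma tight_Un:
  assumes "finite P" "extendable P F" and A: "tight P F A" and B: "tight P F B"
  shows "tight P F (A \<union> B)"
proof -
  let ?R = "\<lambda>X. \<Sum>j\<in>J. r j (X \<union> F j)"
  have "?R (A \<union> B) + ?R (A \<inter> B) \<le> ?R A + ?R B"
    unfolding sum.distrib[symmetric]
  proof (rule sum_mono)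
    fix j assume "j \<in> J"
    have "(A \<union> F j) \<union> (B \<union> F j) = (A \<union> B) \<union> F j" "(A \<union> F j) \<inter> (B \<union> F j) = (A \<inter> B) \<union> F j" by auto
    then show "r j ((A \<union> B) \<union> F j) + r j ((A \<inter> B) \<union> F j) \<le> r j (A \<union> F j) + r j (B \<union> F j)"
      using rank_submodular[OF \<open>j \<in> J\<close>, of "A \<union> F j" "B \<union> F j"] by simp
  qed
  moreover have "card (P - A) + card (P - B) = card (P - (A \<union> B)) + card (P - (A \<inter> B))"
    using card_Un_Int[of "P - A" "P - B"] assms(1) by (simp add: Diff_Un Diff_Int Int_commute)
  moreover have "A \<union> B \<subseteq> P" "A \<inter> B \<subseteq> P" using A B unfolding tight_def by auto
  then have "sum \<rho> J \<le> card (P - (A \<union> B)) + ?R (A \<union> B)" "sum \<rho> J \<le> card (P - (A \<inter> B)) + ?R (A \<inter> B)"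
    using assms(2) unfolding extendable_def by blast+
  ultimately show ?thesis using A B unfolding tight_def by auto
qed

lemma tight_spanning_eq:
  assumes "finite P" "tight P F A" "\<And>j. j \<in> J \<Longrightarrow> r j (A \<union> F j) = \<rho> j"
  shows "A = P"
proof -
  have "(\<Sum>j\<in>J. r j (A \<union> F j)) = sum \<rho> J" by (rule sum.cong) (simp_all add: assms(3))
  then have "card (P - A) = 0" using assms(2) unfolding tight_def by simp
  then show ?thesis using assms(1,2) unfolding tight_def by auto
qed

lemma extendable_spanning:
  assumes "extendable P F" and j: "j \<in> J"
  shows "r j (P \<union> F j) = \<rho> j"
proof (rule ccontr)
  assume "r j (P \<union> F j) \<noteq> \<rho> j"
  then have "r j (P \<union> F j) < \<rho> j" using rank_le[OF j] le_neq_implies_less by blast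
  then have "(\<Sum>j\<in>J. r j (P \<union> F j)) < sum \<rho> J"
    using j rank_le finite_J by (intro sum_strict_mono_ex1) auto
  then show False using assms(1) unfolding extendable_def by fastforce
qed

text \<open>Take \<open>A\<close> maximal among the nonspanning tight sets.\<close>

lemma obtain_nonspanning_dominating_tight:
  assumes "finite P" "extendable P F" and j0: "j\<^sub>0 \<in> J" "r j\<^sub>0 (F j\<^sub>0) \<noteq> \<rho> j\<^sub>0"
  obtains A j where "A \<subseteq> P" "j \<in> J" "r j (A \<union> F j) < \<rho> j"
    "\<And>B. tight P F B \<Longrightarrow> B \<subseteq> A \<or> A \<union> B = P"
proof -
  define \<T> where "\<T> = {B. tight P F B \<and> (\<exists>j\<in>J. r j (B \<union> F j) < \<rho> j)}"
  have eq_P: "B = P" if "tight P F B" "B \<notin> \<T>" for B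
  proof (rule tight_spanning_eq[OF assms(1) that(1)])
    show "r j (B \<union> F j) = \<rho> j" if "j \<in> J" for j
      using \<open>tight P F B\<close> \<open>B \<notin> \<T>\<close> that rank_le[OF that, of "B \<union> F j"] le_neq_implies_less
      unfolding \<T>_def by blast
  qed
  show thesis
  proof (cases "\<T> = {}")
    case True
    have "r j\<^sub>0 ({} \<union> F j\<^sub>0) < \<rho> j\<^sub>0" using j0 rank_le[OF j0(1), of "F j\<^sub>0"] by simp
    moreover have "B \<subseteq> {} \<or> {} \<union> B = P" if "tight P F B" for B using eq_P[OF that] True by simp
    ultimately show thesis using that[of "{}" j\<^sub>0] j0(1) by blast
  next
    case False
    have "finite \<T>"
      by (rule finite_subset[of _ "Pow P"]) (use assms(1) in \<open>auto simp: \<T>_def tight_def\<close>)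
    then obtain A where A: "A \<in> \<T>" and maximal: "\<And>B. B \<in> \<T> \<Longrightarrow> A \<subseteq> B \<Longrightarrow> A = B"
      using finite_has_maximal[OF _ False] by metis
    then have tA: "tight P F A" unfolding \<T>_def by blast
    have "B \<subseteq> A \<or> A \<union> B = P" if "tight P F B" for B
      using tight_Un[OF assms(1,2) tA that] eq_P[of "A \<union> B"] maximal[of "A \<union> B"] by blast
    then show thesis using that A tA unfolding \<T>_def tight_def by blast
  qed
qed

lemma extendable_insert:
  assumes "finite P" and ext: "extendable P F" and j: "j \<in> J" and e: "e \<in> P" "e \<notin> A \<union> F j"
    and gain: "r j (insert e (A \<union> F j)) \<noteq> r j (A \<union> F j)"
    and dominating: "\<And>B. tight P F B \<Longrightarrow> B \<subseteq> A \<or> A \<union> B = P"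
  shows "extendable (P - {e}) (F(j := insert e (F j)))"
  unfolding extendable_def
proof (intro allI impI)
  fix B assume B: "B \<subseteq> P - {e}"
  let ?rest = "\<Sum>i\<in>J - {j}. r i (B \<union> F i)"
  have card_P: "card (P - B) = Suc (card (P - {e} - B))"
    using card_Suc_Diff1[of "P - B" e] assms(1) e(1) B
    by (metis Diff_iff Diff_insert Diff_insert2 finite_Diff insertI1 subset_Diff_insert)
  have new: "(\<Sum>i\<in>J. r i (B \<union> (F(j := insert e (F j))) i)) = ?rest + r j (insert e (B \<union> F j))"
    using finite_J j by (subst sum.remove[of _ j]) auto
  have old: "(\<Sum>i\<in>J. r i (B \<union> F i)) = ?rest + r j (B \<union> F j)"
    using finite_J j by (subst sum.remove[of _ j]) auto
  have incr: "r j X \<le> r j (insert e X)" for X by (rule rank_mono[OF j]) auto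
  show "sum \<rho> J \<le> card (P - {e} - B) + (\<Sum>i\<in>J. r i (B \<union> (F(j := insert e (F j))) i))"
  proof (cases "tight P F B")
    case False
    have "B \<subseteq> P" using B by blast
    then have "sum \<rho> J < card (P - B) + (\<Sum>i\<in>J. r i (B \<union> F i))"
      using ext False unfolding extendable_def tight_def by (metis order_le_less)
    then show ?thesis using card_P new old incr[of "B \<union> F j"] by linarith
  next
    case True
    have "A \<union> B \<noteq> P" using e B by auto
    then have BA: "B \<subseteq> A" using dominating[OF True] by blast
    have "r j ((A \<union> F j) \<union> insert e (B \<union> F j)) + r j ((A \<union> F j) \<inter> insert e (B \<union> F j))
       \<le> r j (A \<union> F j) + r j (insert e (B \<union> F j))" by (rule rank_submodular[OF j])
    moreover have "(A \<union> F j) \<union> insert e (B \<union> F j) = insert e (A \<union> F j)"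
      "(A \<union> F j) \<inter> insert e (B \<union> F j) = B \<union> F j" using BA e by auto
    ultimately have "r j (B \<union> F j) < r j (insert e (B \<union> F j))" using gain incr[of "A \<union> F j"] by simp
    then show ?thesis using True card_P new old unfolding tight_def by linarith
  qed
qed

lemma extendable_step:
  assumes "finite P" and ext: "extendable P F" and "\<exists>j\<in>J. r j (F j) \<noteq> \<rho> j"
  obtains j e where "j \<in> J" "e \<in> P" "e \<notin> F j" "extendable (P - {e}) (F(j := insert e (F j)))"
proof -
  obtain A j where A: "A \<subseteq> P" "r j (A \<union> F j) < \<rho> j" and j: "j \<in> J"
    and dominating: "\<And>B. tight P F B \<Longrightarrow> B \<subseteq> A \<or> A \<union> B = P"
    using obtain_nonspanning_dominating_tight[OF assms(1,2)] assms(3) by metis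
  have "P \<union> F j \<subseteq> (A \<union> F j) \<union> P" by blast
  then have "r j ((A \<union> F j) \<union> P) = \<rho> j"
    using extendable_spanning[OF ext j] rank_mono[OF j] rank_le[OF j] by (metis le_antisym)
  then obtain e where e: "e \<in> P" "r j (insert e (A \<union> F j)) \<noteq> r j (A \<union> F j)"
    using rank_Un_eq[OF j assms(1), of "A \<union> F j"] A(2) by force
  then have "e \<notin> A \<union> F j" by (metis insert_absorb)
  then show thesis using extendable_insert[OF assms(1) ext j e(1) _ e(2) dominating] that j e(1) by blast
qed

theorem disjoint_bases:
  assumes "finite P" "extendable P F"
  shows "\<exists>F'. (\<forall>j\<in>J. F j \<subseteq> F' j \<and> F' j \<subseteq> F j \<union> P \<and> r j (F' j) = \<rho> j) \<and>
    pairwise (\<lambda>i j. disjnt (F' i - F i) (F' j - F j)) J"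
  using assms
proof (induction "card P" arbitrary: P F rule: less_induct)
  case less
  show ?case
  proof (cases "\<exists>j\<in>J. r j (F j) \<noteq> \<rho> j")
    case False
    then show ?thesis by (intro exI[of _ F]) (auto simp: pairwise_def)
  next
    case True
    obtain j e where j: "j \<in> J" and e: "e \<in> P" "e \<notin> F j"
      and ext: "extendable (P - {e}) (F(j := insert e (F j)))" (is "extendable _ ?F")
      by (rule extendable_step[OF less.prems True])
    have "card (P - {e}) < card P" using e(1) less.prems(1) by (rule card_Diff1_less[rotated])
    then obtain F' where F': "\<forall>i\<in>J. ?F i \<subseteq> F' i \<and> F' i \<subseteq> ?F i \<union> (P - {e}) \<and> r i (F' i) = \<rho> i"
      and disjoint: "pairwise (\<lambda>i l. disjnt (F' i - ?F i) (F' l - ?F l)) J"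
      using less.hyps[OF _ _ ext] less.prems(1) by blast
    have basis: "F i \<subseteq> F' i \<and> F' i \<subseteq> F i \<union> P \<and> r i (F' i) = \<rho> i" if "i \<in> J" for i
      using bspec[OF F' that] e(1) by (auto split: if_splits)
    define D where "D i = F' i - F i" for i
    define D' where "D' i = F' i - ?F i" for i
    have D: "D i \<subseteq> insert e (D' i)" for i unfolding D_def D'_def by auto
    have "e \<notin> D i" if "i \<in> J" "i \<noteq> j" for i
      using bspec[OF F' that(1)] that(2) unfolding D_def by auto
    then have "disjnt (D i) (D l)" if "i \<in> J" "l \<in> J" "i \<noteq> l" for i l
      using pairwiseD[OF disjoint that] D[of i] D[of l] that
      unfolding disjnt_def D'_def[symmetric] by blast
    then show ?thesis using basis unfolding D_def pairwise_def by blast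
  qed
qed

end

section \<open>Classes of a generated equivalence\<close>

lemma equivclp_image:
  assumes "equivclp R x y" and "\<And>x y. R x y \<Longrightarrow> equivclp S (f x) (f y)"
  shows "equivclp S (f x) (f y)"
  using assms(1)
proof (induction rule: equivclp_induct)
  case (step y z)
  then show ?case using assms(2) by (blast intro: equivclp_trans equivclp_sym)
qed simp

lemma equivclp_le:
  assumes "equivclp R x y" and "\<And>x y. R x y \<Longrightarrow> equivclp S x y"
  shows "equivclp S x y"
  using equivclp_image[of R x y S "\<lambda>z. z"] assms by blast

lemma equivclp_mono:
  assumes "equivclp R x y" and "\<And>x y. R x y \<Longrightarrow> S x y"
  shows "equivclp S x y"
  using equivclp_le[OF assms(1)] assms(2) by blast

lemma equivclp_mono_on_class:
  assumes "equivclp R x y" and "\<And>a b. R a b \<Longrightarrow> equivclp R x a \<Longrightarrow> S a b"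
  shows "equivclp S x y"
  using assms(1)
proof (induction rule: equivclp_induct)
  case (step y z)
  then have "equivclp R x z" by (blast intro: equivclp_into_equivclp)
  then have "S y z \<or> S z y" using step.hyps assms(2) by blast
  with step.IH show ?case by (rule equivclp_into_equivclp)
qed simp

lemma equivclp_invariant:
  assumes "equivclp R x y" and "\<And>x y. R x y \<Longrightarrow> f x = f y"
  shows "f x = f y"
  using assms(1) by (induction rule: equivclp_induct) (auto dest: assms(2))

lemma equivclp_Collect_eq_iff: "{z. equivclp R x z} = {z. equivclp R y z} \<longleftrightarrow> equivclp R x y"
  by (blast intro: equivclp_sym equivclp_trans equivclp_refl)

definition classes :: "'a set \<Rightarrow> ('a \<Rightarrow> 'a \<Rightarrow> bool) \<Rightarrow> 'a set set" where
  "classes V R = (\<lambda>x. {y. equivclp R x y}) ` V"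

lemma finite_classes [simp]: "finite V \<Longrightarrow> finite (classes V R)"
  unfolding classes_def by simp

lemma classes_eqI: "(\<And>x y. equivclp R x y \<longleftrightarrow> equivclp S x y) \<Longrightarrow> classes V R = classes V S"
  unfolding classes_def by (intro image_cong refl Collect_cong)

lemma in_classes_nonempty: "C \<in> classes V R \<Longrightarrow> C \<noteq> {}"
  unfolding classes_def using equivclp_refl by fastforce

lemma in_classes_eq:
  assumes "C \<in> classes V R" "x \<in> C"
  shows "C = {y. equivclp R x y}"
proof -
  obtain z where "C = {y. equivclp R z y}" using assms(1) unfolding classes_def by blast
  then show ?thesis using assms(2) equivclp_Collect_eq_iff[of R z x] by simp
qed

lemma card_classes_le: "finite V \<Longrightarrow> card (classes V R) \<le> card V"
  unfolding classes_def by (rule card_image_le)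

lemma card_classes_pos: "finite V \<Longrightarrow> V \<noteq> {} \<Longrightarrow> 1 \<le> card (classes V R)"
  unfolding classes_def by (simp add: Suc_leI card_gt_0_iff)

lemma equivclp_if_card_classes_le_1:
  assumes "finite V" "card (classes V R) \<le> 1" "x \<in> V" "y \<in> V"
  shows "equivclp R x y"
proof -
  have "{z. equivclp R x z} \<in> classes V R" "{z. equivclp R y z} \<in> classes V R"
    using assms(3,4) unfolding classes_def by blast+
  then have "{z. equivclp R x z} = {z. equivclp R y z}"
    using assms(1,2) card_le_Suc0_iff_eq[of "classes V R"] by simp
  then show ?thesis unfolding equivclp_Collect_eq_iff .
qed

lemma card_image_le_card_classes:
  assumes "finite V" "\<And>x y. R x y \<Longrightarrow> f x = f y"
  shows "card (f ` V) \<le> card (classes V R)"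
proof -
  have "f y = f x" if "equivclp R x y" for x y
    using equivclp_invariant[OF that, of f] assms(2) by simp
  then have "f ` {y. equivclp R x y} = {f x}" for x using equivclp_refl[of R x] by blast
  then have "f ` V = (\<lambda>C. the_elem (f ` C)) ` classes V R"
    unfolding classes_def by (simp add: image_image)
  then show ?thesis using assms(1) by (simp add: card_image_le)
qed

lemma card_classes_antimono:
  assumes "finite V" "\<And>x y. R x y \<Longrightarrow> equivclp S x y"
  shows "card (classes V S) \<le> card (classes V R)"
  unfolding classes_def[of V S]
  using assms by (intro card_image_le_card_classes) (simp_all add: equivclp_Collect_eq_iff)

lemma equivclp_add_pair:
  "equivclp (\<lambda>x y. R x y \<or> x = a \<and> y = b) x y \<longleftrightarrow>
    equivclp R x y \<or> (equivclp R a x \<or> equivclp R b x) \<and> (equivclp R a y \<or> equivclp R b y)"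
  (is "equivclp ?S x y \<longleftrightarrow> _")
proof
  assume "equivclp ?S x y"
  then show "equivclp R x y \<or> (equivclp R a x \<or> equivclp R b x) \<and> (equivclp R a y \<or> equivclp R b y)"
  proof (induction rule: equivclp_induct)
    case (step y z)
    have "equivclp R y z \<or> y = a \<and> z = b \<or> y = b \<and> z = a" using step.hyps(2) by blast
    then show ?case
    proof (elim disjE conjE)
      assume "equivclp R y z"
      then show ?thesis using step.IH by (blast intro: equivclp_trans)
    next
      assume "y = a" "z = b"
      then show ?thesis using step.IH by (blast intro: equivclp_sym equivclp_refl)
    next
      assume "y = b" "z = a"
      then show ?thesis using step.IH by (blast intro: equivclp_sym equivclp_refl)
    qed
  qed simp
next
  have R_le: "equivclp R u w \<Longrightarrow> equivclp ?S u w" for u w by (erule equivclp_mono) blast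
  have ab: "equivclp ?S a b" by blast
  assume "equivclp R x y \<or> (equivclp R a x \<or> equivclp R b x) \<and> (equivclp R a y \<or> equivclp R b y)"
  then have "equivclp ?S x y \<or> equivclp ?S a x \<and> equivclp ?S a y"
    using R_le ab by (meson equivclp_trans)
  then show "equivclp ?S x y" by (meson equivclp_sym equivclp_trans)
qed

lemma card_classes_add_pair:
  assumes V: "finite V" "a \<in> V" "b \<in> V"
  shows "card (classes V R) =
    card (classes V (\<lambda>x y. R x y \<or> x = a \<and> y = b)) + (if equivclp R a b then 0 else 1)"
    (is "_ = card (classes V ?S) + _")
proof (cases "equivclp R a b")
  case True
  have "equivclp R x y \<longleftrightarrow> equivclp ?S x y" for x y
    unfolding equivclp_add_pair using True by (meson equivclp_sym equivclp_trans)
  then have "classes V R = classes V ?S" by (rule classes_eqI)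
  then show ?thesis using True by simp
next
  case False
  let ?c = "\<lambda>x. {y. equivclp R x y}"
  define merge where "merge C = (if C = ?c a then ?c a \<union> ?c b else C)" for C
  have ab: "b \<notin> ?c a" "?c a \<noteq> ?c b" using False equivclp_Collect_eq_iff[of R a b] by auto
  have "{y. equivclp ?S x y} = (if ?c x = ?c b then ?c a \<union> ?c b else merge (?c x))" for x
  proof -
    have "{y. equivclp ?S x y} = (if equivclp R a x \<or> equivclp R b x then ?c a \<union> ?c b else ?c x)"
      unfolding equivclp_add_pair using equivclp_trans[of R] by auto
    moreover have "equivclp R a x \<longleftrightarrow> ?c x = ?c a" "equivclp R b x \<longleftrightarrow> ?c x = ?c b"
      unfolding equivclp_Collect_eq_iff using equivclp_sym[of R] by blast+
    ultimately show ?thesis unfolding merge_def by auto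
  qed
  moreover have "merge (?c a) = ?c a \<union> ?c b" unfolding merge_def by simp
  ultimately have "classes V ?S = merge ` (classes V R - {?c b})"
    using V(2) ab(2) unfolding classes_def by (auto simp: image_iff)
  moreover have "inj_on merge (classes V R - {?c b})"
  proof (rule inj_onI)
    fix C D assume CD: "C \<in> classes V R - {?c b}" "D \<in> classes V R - {?c b}" "merge C = merge D"
    have "C \<noteq> ?c a \<union> ?c b" if "C \<in> classes V R" for C
      using in_classes_eq[OF that, of a] in_classes_eq[OF that, of b] ab(2) equivclp_refl[of R] by blast
    then show "C = D" using CD unfolding merge_def by (auto split: if_splits)
  qed
  ultimately have "card (classes V ?S) = card (classes V R - {?c b})" by (simp add: card_image)
  moreover have "?c b \<in> classes V R" using V(3) unfolding classes_def by blast
  ultimately show ?thesis using False V(1) by (simp add: card_Suc_Diff1 del: card_Diff_insert)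
qed

lemma card_classes_diminishing_returns:
  assumes V: "finite V" and D: "finite D" "D \<subseteq> V \<times> V" and le: "\<And>x y. R x y \<Longrightarrow> S x y"
  shows "card (classes V S) + card (classes V (\<lambda>x y. R x y \<or> (x, y) \<in> D)) \<le>
    card (classes V R) + card (classes V (\<lambda>x y. S x y \<or> (x, y) \<in> D))"
  using D
proof (induction D rule: finite_induct)
  case (insert p D)
  obtain a b where p: "p = (a, b)" by (cases p)
  have ab: "a \<in> V" "b \<in> V" using insert.prems p by auto
  have add: "(\<lambda>x y. Q x y \<or> (x, y) \<in> insert p D) = (\<lambda>x y. (Q x y \<or> (x, y) \<in> D) \<or> x = a \<and> y = b)" for Q
    unfolding p by auto
  have "equivclp (\<lambda>x y. R x y \<or> (x, y) \<in> D) a b \<Longrightarrow> equivclp (\<lambda>x y. S x y \<or> (x, y) \<in> D) a b"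
    by (erule equivclp_mono) (use le in blast)
  then show ?case
    unfolding add
    using insert card_classes_add_pair[OF V ab, of "\<lambda>x y. R x y \<or> (x, y) \<in> D"]
      card_classes_add_pair[OF V ab, of "\<lambda>x y. S x y \<or> (x, y) \<in> D"]
    by (auto split: if_splits)
qed simp

lemma card_classes_submodular:
  assumes V: "finite V" and S: "\<And>x y. S x y \<Longrightarrow> x \<in> V \<and> y \<in> V"
  shows "card (classes V R) + card (classes V S) \<le> card (classes V (sup R S)) + card (classes V (inf R S))"
proof -
  let ?D = "{(x, y). S x y}"
  have "?D \<subseteq> V \<times> V" using S by blast
  then have "finite ?D" using finite_subset V by blast
  from card_classes_diminishing_returns[OF V this \<open>?D \<subseteq> V \<times> V\<close>, of "inf R S" R]
  have "card (classes V R) + card (classes V (\<lambda>x y. inf R S x y \<or> (x, y) \<in> ?D)) \<le>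
      card (classes V (inf R S)) + card (classes V (\<lambda>x y. R x y \<or> (x, y) \<in> ?D))"
    by simp
  moreover have "(\<lambda>x y. inf R S x y \<or> (x, y) \<in> ?D) = S" "(\<lambda>x y. R x y \<or> (x, y) \<in> ?D) = sup R S"
    by auto
  ultimately show ?thesis by simp
qed

section \<open>Components of hypergraphs\<close>

definition hyperadj :: "('i \<Rightarrow> 'v set) \<Rightarrow> 'i set \<Rightarrow> 'v \<Rightarrow> 'v \<Rightarrow> bool" where
  "hyperadj N A x y \<longleftrightarrow> (\<exists>i\<in>A. x \<in> N i \<and> y \<in> N i)"

abbreviation comp_count :: "'v set \<Rightarrow> ('i \<Rightarrow> 'v set) \<Rightarrow> 'i set \<Rightarrow> nat" where
  "comp_count V N A \<equiv> card (classes V (hyperadj N A))"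

lemma hyperadj_mono: "A \<subseteq> B \<Longrightarrow> hyperadj N A x y \<Longrightarrow> hyperadj N B x y"
  unfolding hyperadj_def by blast

lemma hyperadj_Un: "hyperadj N (A \<union> B) = sup (hyperadj N A) (hyperadj N B)"
  unfolding hyperadj_def by (auto simp: fun_eq_iff)

lemma classes_hyperadj_subset:
  assumes "C \<in> classes V (hyperadj N A)" "\<And>i. i \<in> A \<Longrightarrow> N i \<subseteq> V"
  shows "C \<subseteq> V"
proof
  fix y assume "y \<in> C"
  obtain x where x: "x \<in> V" "C = {y. equivclp (hyperadj N A) x y}"
    using assms(1) unfolding classes_def by blast
  then have "equivclp (hyperadj N A) x y" using \<open>y \<in> C\<close> by simp
  then have "(x \<in> V) = (y \<in> V)"
    by (rule equivclp_invariant) (use assms(2) in \<open>auto simp: hyperadj_def\<close>)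
  then show "y \<in> V" using x(1) by simp
qed

lemma comp_count_antimono:
  assumes "finite V" "A \<subseteq> B"
  shows "comp_count V N B \<le> comp_count V N A"
  by (intro card_classes_antimono[OF assms(1)] r_into_equivclp hyperadj_mono[OF assms(2)])

lemma comp_count_submodular:
  assumes "finite V" "\<And>i. i \<in> B \<Longrightarrow> N i \<subseteq> V"
  shows "comp_count V N A + comp_count V N B \<le> comp_count V N (A \<union> B) + comp_count V N (A \<inter> B)"
proof -
  have "card (classes V (inf (hyperadj N A) (hyperadj N B))) \<le> comp_count V N (A \<inter> B)"
    using assms(1) by (rule card_classes_antimono) (rule r_into_equivclp, auto simp: hyperadj_def)
  moreover have "card (classes V (hyperadj N A)) + card (classes V (hyperadj N B)) \<le>
      card (classes V (sup (hyperadj N A) (hyperadj N B))) +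
      card (classes V (inf (hyperadj N A) (hyperadj N B)))"
    by (rule card_classes_submodular[OF assms(1)]) (use assms(2) in \<open>auto simp: hyperadj_def\<close>)
  ultimately show ?thesis unfolding hyperadj_Un by linarith
qed

lemma comp_count_Un_within:
  assumes V: "finite V" and S: "S \<subseteq> V" "S \<noteq> {}" and J: "\<And>i. i \<in> J \<Longrightarrow> N i \<subseteq> S"
  shows "comp_count V N A + 1 \<le> comp_count V N (A \<union> J) + card S"
proof -
  obtain s where s: "s \<in> S" using S by blast
  define contract where "contract x = (if x \<in> S then s else x)" for x
  have "contract ` V = insert s (V - S)" using s S unfolding contract_def by auto
  then have "card (contract ` V) = Suc (card V - card S)"
    using V s S finite_subset[OF S(1)] by (simp add: card_Diff_subset)
  moreover have "card (contract ` V) \<le> comp_count V N J"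
    using V by (rule card_image_le_card_classes) (use J in \<open>auto simp: hyperadj_def contract_def\<close>)
  moreover have "comp_count V N A + comp_count V N J \<le> comp_count V N (A \<union> J) + comp_count V N (A \<inter> J)"
    by (rule comp_count_submodular[OF V]) (use J S(1) in blast)
  ultimately show ?thesis
    using card_classes_le[OF V, of "hyperadj N (A \<inter> J)"] card_mono[OF V S(1)] by linarith
qed

section \<open>Trimming triples to pairs\<close>

definition convex_increasing :: "(nat \<Rightarrow> nat) \<Rightarrow> bool" where
  "convex_increasing g \<longleftrightarrow> (\<forall>a p q b. a \<le> p \<longrightarrow> a \<le> q \<longrightarrow> p + q \<le> a + b \<longrightarrow> g p + g q \<le> g a + g b)"

lemma convex_increasing_mono: "convex_increasing g \<Longrightarrow> mono g"
  unfolding convex_increasing_def by (intro monoI) (metis add_le_cancel_left le_refl)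

definition partition_connected :: "(nat \<Rightarrow> nat) \<Rightarrow> 'v set \<Rightarrow> 'i set \<Rightarrow> ('i \<Rightarrow> 'v set) \<Rightarrow> bool" where
  "partition_connected g V I N \<longleftrightarrow> (\<forall>A\<subseteq>I. g (comp_count V N A) \<le> card (I - A))"

lemma equivclp_hyperadj_split_triple:
  assumes "N i = {x, y, z}" "i \<in> A" "i \<in> B"
  shows "equivclp (sup (hyperadj (N(i := {y, z})) A) (hyperadj (N(i := {x, z})) B)) u w \<longleftrightarrow>
    equivclp (hyperadj N (A \<union> B)) u w" (is "equivclp ?R u w \<longleftrightarrow> _")
proof
  assume "equivclp ?R u w"
  then show "equivclp (hyperadj N (A \<union> B)) u w"
    by (rule equivclp_mono) (use assms in \<open>auto simp: hyperadj_def split: if_splits\<close>)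
next
  have "?R y z" "?R x z" using assms(2,3) unfolding hyperadj_def by force+
  then have edges: "equivclp ?R a b" if "a \<in> {x, y, z}" "b \<in> {x, y, z}" for a b
    using that equivclp_sym[of ?R] equivclp_trans[of ?R]
    by (metis equivclp_refl insertE r_into_equivclp singletonD)
  assume "equivclp (hyperadj N (A \<union> B)) u w"
  then show "equivclp ?R u w"
  proof (rule equivclp_le)
    fix a b assume "hyperadj N (A \<union> B) a b"
    then obtain j where j: "j \<in> A \<union> B" "a \<in> N j" "b \<in> N j" unfolding hyperadj_def by blast
    show "equivclp ?R a b"
    proof (cases "j = i")
      case True
      then show ?thesis using edges j assms(1) by simp
    next
      case False
      then have "?R a b" using j unfolding hyperadj_def by auto
      then show ?thesis by blast
    qed
  qed
qed

text \<open>Two different vertices of a triple cannot both be indispensable: if dropping \<open>x\<close> and dropping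
  \<open>y\<close> both violate the bound, submodularity and convexity give a violation before the drop.\<close>

lemma partition_connected_drop_vertex:
  assumes V: "finite V" and I: "finite I" and N: "\<And>i. i \<in> I \<Longrightarrow> N i \<subseteq> V" and g: "convex_increasing g"
    and conn: "partition_connected g V I N" and i: "i \<in> I" "N i = {x, y, z}"
  shows "partition_connected g V I (N(i := {y, z})) \<or> partition_connected g V I (N(i := {x, z}))"
proof (rule ccontr)
  let ?Nx = "N(i := {y, z})" and ?Ny = "N(i := {x, z})"
  assume "\<not> ?thesis"
  then obtain A B where A: "A \<subseteq> I" "card (I - A) < g (comp_count V ?Nx A)"
    and B: "B \<subseteq> I" "card (I - B) < g (comp_count V ?Ny B)"
    unfolding partition_connected_def not_le[symmetric] by blast
  have unchanged: "hyperadj (N(i := M)) C = hyperadj N C" if "i \<notin> C" for C M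
    using that unfolding hyperadj_def by (auto simp: fun_eq_iff)
  have iAB: "i \<in> A" "i \<in> B"
    using A B conn unchanged unfolding partition_connected_def by (metis not_le)+
  let ?R = "hyperadj ?Nx A" and ?S = "hyperadj ?Ny B" and ?C = "A \<inter> B - {i}"
  have "x \<in> V" "y \<in> V" "z \<in> V" using N[OF i(1)] i(2) by auto
  then have S: "u \<in> V \<and> w \<in> V" if "?S u w" for u w
    using that N B(1) unfolding hyperadj_def by (auto split: if_splits)
  have union: "card (classes V (sup ?R ?S)) = comp_count V N (A \<union> B)"
    using classes_eqI[OF equivclp_hyperadj_split_triple[of N i x y z A B, OF i(2) iAB]] by metis
  have inter: "card (classes V (inf ?R ?S)) \<le> comp_count V N ?C"
    using V by (rule card_classes_antimono) (rule r_into_equivclp, auto simp: hyperadj_def)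
  have "card (classes V (sup ?R ?S)) \<le> card (classes V ?R)"
      "card (classes V (sup ?R ?S)) \<le> card (classes V ?S)"
    using V by (auto intro!: card_classes_antimono)
  then have "g (card (classes V ?R)) + g (card (classes V ?S)) \<le>
      g (comp_count V N (A \<union> B)) + g (comp_count V N ?C)"
    using g card_classes_submodular[OF V, of ?S ?R] S union inter unfolding convex_increasing_def by fastforce
  also have "\<dots> \<le> card (I - (A \<union> B)) + card (I - ?C)"
  proof -
    have "A \<union> B \<subseteq> I" "?C \<subseteq> I" using A(1) B(1) by auto
    then show ?thesis using conn unfolding partition_connected_def by (meson add_mono)
  qed
  finally have "card (I - A) + card (I - B) + 2 \<le> card (I - (A \<union> B)) + card (I - ?C)"
    using A(2) B(2) by linarith
  moreover have "I - (A \<union> B) = (I - A) \<inter> (I - B)" "I - ?C = insert i ((I - A) \<union> (I - B))" using i(1) by auto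
  then have "card (I - (A \<union> B)) + card (I - ?C) = Suc (card (I - A) + card (I - B))"
    using card_Un_Int[of "I - A" "I - B"] I iAB by simp
  ultimately show False by linarith
qed

lemma partition_connected_trim:
  assumes V: "finite V" and I: "finite I" and g: "convex_increasing g"
    and "\<And>i. i \<in> I \<Longrightarrow> N i \<subseteq> V \<and> card (N i) \<in> {2, 3}" and "partition_connected g V I N"
  obtains N' where "\<And>i. i \<in> I \<Longrightarrow> N' i \<subseteq> N i \<and> card (N' i) = 2" "partition_connected g V I N'"
  using assms(4,5)
proof (induction "card {i\<in>I. card (N i) = 3}" arbitrary: N thesis rule: less_induct)
  case less
  show ?case
  proof (cases "{i\<in>I. card (N i) = 3} = {}")
    case True
    then show ?thesis using less.prems(1)[of N] less.prems(2,3) by fastforce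
  next
    case False
    then obtain i where i: "i \<in> I" "card (N i) = 3" by blast
    then obtain x y z where xyz: "N i = {x, y, z}" "x \<noteq> y" "x \<noteq> z" "y \<noteq> z"
      by (auto simp: card_3_iff)
    have "partition_connected g V I (N(i := {y, z})) \<or> partition_connected g V I (N(i := {x, z}))"
      by (rule partition_connected_drop_vertex[OF V I _ g less.prems(3) i(1) xyz(1)])
        (use less.prems(2) in blast)
    moreover have "{y, z} \<subseteq> N i" "card {y, z} = 2" "{x, z} \<subseteq> N i" "card {x, z} = 2" using xyz by auto
    ultimately obtain M where M: "M \<subseteq> N i" "card M = 2" "partition_connected g V I (N(i := M))" by metis
    have "{j\<in>I. card ((N(i := M)) j) = 3} \<subset> {j\<in>I. card (N j) = 3}"
      using i M(2) by (auto split: if_splits)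
    then have fewer: "card {j\<in>I. card ((N(i := M)) j) = 3} < card {j\<in>I. card (N j) = 3}"
      using I by (intro psubset_card_mono) auto
    have sub: "(N(i := M)) j \<subseteq> N j" for j using M(1) by simp
    show ?thesis
    proof (rule less.hyps[OF fewer _ _ M(3)])
      show "(N(i := M)) j \<subseteq> V \<and> card ((N(i := M)) j) \<in> {2, 3}" if "j \<in> I" for j
        using less.prems(2)[OF that] sub[of j] M(2) by auto
      fix N' assume "\<And>j. j \<in> I \<Longrightarrow> N' j \<subseteq> (N(i := M)) j \<and> card (N' j) = 2" "partition_connected g V I N'"
      then show ?thesis using sub by (intro less.prems(1)[of N']) (meson subset_trans)+
    qed
  qed
qed

lemma sum_card_incident_pairs_le:
  assumes "finite S" "finite I" and pair: "\<And>i. i \<in> I \<Longrightarrow> card (N i) = 2"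
  shows "(\<Sum>t\<in>S. card {i \<in> I. t \<in> N i}) \<le> card I + card {i \<in> I. N i \<subseteq> S}"
proof -
  have "(\<Sum>t\<in>S. card {i \<in> I. t \<in> N i}) = (\<Sum>i\<in>I. card {t \<in> S. t \<in> N i})"
    by (rule sum_multicount_gen) (use assms(1,2) in simp_all)
  also have "\<dots> \<le> (\<Sum>i\<in>I. 1 + (if N i \<subseteq> S then 1 else 0))"
  proof (rule sum_mono)
    fix i assume "i \<in> I"
    note N = pair[OF this]
    then have "finite (N i)" by (metis card.infinite zero_neq_numeral)
    show "card {t \<in> S. t \<in> N i} \<le> 1 + (if N i \<subseteq> S then 1 else 0)"
    proof (cases "N i \<subseteq> S")
      case True
      then have "{t \<in> S. t \<in> N i} = N i" by blast
      then show ?thesis using N True by simp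
    next
      case False
      then have "{t \<in> S. t \<in> N i} \<subset> N i" by blast
      then have "card {t \<in> S. t \<in> N i} < card (N i)" by (rule psubset_card_mono[OF \<open>finite (N i)\<close>])
      then show ?thesis using N by simp
    qed
  qed
  also have "\<dots> = card I + card {i \<in> I. N i \<subseteq> S}"
    using assms(2) unfolding sum.distrib by (simp add: sum.If_cases Int_def)
  finally show ?thesis .
qed

lemma partition_connected_incidence_bound:
  assumes V: "finite V" and I: "finite I" and N: "\<And>i. i \<in> I \<Longrightarrow> N i \<subseteq> V \<and> card (N i) = 2"
    and conn: "partition_connected g V I N" and g: "mono g"
    and S: "S \<subseteq> V" "S \<noteq> {}" and A: "A \<subseteq> I" and G: "\<And>t. t \<in> S \<Longrightarrow> G t \<subseteq> {i \<in> I. t \<in> N i}"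
  shows "(\<Sum>t\<in>S. card (G t - A)) + g (max 1 (comp_count V N A + 1 - card S)) \<le> 2 * card (I - A)"
proof -
  define J where "J = {i \<in> I - A. N i \<subseteq> S}"
  have J: "J \<subseteq> I - A" "finite J" unfolding J_def using I by auto
  have "(\<Sum>t\<in>S. card (G t - A)) \<le> (\<Sum>t\<in>S. card {i \<in> I - A. t \<in> N i})"
    using G I by (intro sum_mono card_mono) auto
  also have "\<dots> \<le> card (I - A) + card J"
    unfolding J_def using V S I N by (intro sum_card_incident_pairs_le) (auto intro: finite_subset)
  finally have degrees: "(\<Sum>t\<in>S. card (G t - A)) \<le> card (I - A) + card J" .
  have "comp_count V N A + 1 \<le> comp_count V N (A \<union> J) + card S"
    by (rule comp_count_Un_within[OF V S]) (simp add: J_def)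
  moreover have "1 \<le> comp_count V N (A \<union> J)" using V S by (intro card_classes_pos) auto
  ultimately have "g (max 1 (comp_count V N A + 1 - card S)) \<le> g (comp_count V N (A \<union> J))"
    by (intro monoD[OF g]) auto
  also have "A \<union> J \<subseteq> I" using J A by blast
  then have "g (comp_count V N (A \<union> J)) \<le> card (I - (A \<union> J))"
    using conn unfolding partition_connected_def by blast
  also have "\<dots> = card (I - A) - card J"
    using J I card_Diff_subset[of J "I - A"] by (simp add: set_diff_eq)
  finally show ?thesis using degrees card_mono[of "I - A" J] J I by auto
qed

section \<open>Balanced orientations\<close>

definition net_outdegree :: "('i \<Rightarrow> 'v \<times> 'v) \<Rightarrow> 'i set \<Rightarrow> 'v \<Rightarrow> int" where
  "net_outdegree p I t = (\<Sum>i\<in>I. of_bool (fst (p i) = t) - of_bool (snd (p i) = t))"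

definition orients :: "'i set \<Rightarrow> ('i \<Rightarrow> 'v \<times> 'v) \<Rightarrow> ('i \<Rightarrow> 'v \<times> 'v) \<Rightarrow> bool" where
  "orients I p q \<longleftrightarrow> (\<forall>i\<in>I. q i = p i \<or> q i = prod.swap (p i))"

lemma net_outdegree_remove:
  "finite I \<Longrightarrow> i \<in> I \<Longrightarrow>
    net_outdegree p I t = of_bool (fst (p i) = t) - of_bool (snd (p i) = t) + net_outdegree p (I - {i}) t"
  unfolding net_outdegree_def by (rule sum.remove)

lemma net_outdegree_cong: "(\<And>i. i \<in> I \<Longrightarrow> p i = q i) \<Longrightarrow> net_outdegree p I t = net_outdegree q I t"
  unfolding net_outdegree_def by simp

lemma net_outdegree_eq:
  "finite I \<Longrightarrow> net_outdegree p I t = int (card {i \<in> I. fst (p i) = t}) - int (card {i \<in> I. snd (p i) = t})"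
  unfolding net_outdegree_def sum_subtractf by (simp add: of_bool_def sum.If_cases Int_def)

text \<open>An edge \<open>xy\<close> that replaces two edges \<open>tx\<close> and \<open>ty\<close> passes its orientation on to the path \<open>xty\<close>.\<close>

lemma orients_merge:
  assumes I: "finite I" and ij: "i \<in> I" "j \<in> I" "i \<noteq> j"
    and pi: "p i = (t, x) \<or> p i = (x, t)" and pj: "p j = (t, y) \<or> p j = (y, t)"
    and q: "orients (I - {j}) (p(i := (x, y))) q"
  obtains q' where "orients I p q'" "\<And>s. net_outdegree q' I s = net_outdegree q (I - {j}) s"
proof -
  define q' where "q' = q(i := if q i = (x, y) then (x, t) else (t, x),
    j := if q i = (x, y) then (t, y) else (y, t))"
  have qi: "q i = (x, y) \<or> q i = (y, x)" using q ij unfolding orients_def by force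
  have "orients I p q'" unfolding orients_def
  proof
    fix l assume l: "l \<in> I"
    show "q' l = p l \<or> q' l = prod.swap (p l)"
    proof (cases "l = i \<or> l = j")
      case True
      then show ?thesis using pi pj unfolding q'_def by auto
    next
      case False
      then have "q' l = q l" "l \<in> I - {j}" using l unfolding q'_def by auto
      then show ?thesis using bspec[OF q[unfolded orients_def], of l] False by simp
    qed
  qed
  moreover have "net_outdegree q' I s = net_outdegree q (I - {j}) s" for s
  proof -
    have "net_outdegree q' (I - {j} - {i}) s = net_outdegree q (I - {j} - {i}) s"
      by (rule net_outdegree_cong) (simp add: q'_def)
    moreover have "q' i = (x, t) \<and> q' j = (t, y) \<and> q i = (x, y) \<or>
        q' i = (t, x) \<and> q' j = (y, t) \<and> q i = (y, x)"
      using qi ij(3) unfolding q'_def by auto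
    ultimately show ?thesis
      using net_outdegree_remove[OF I ij(2), of q' s] net_outdegree_remove[of "I - {j}" i q' s]
        net_outdegree_remove[of "I - {j}" i q s] I ij by (elim disjE conjE) simp_all
  qed
  ultimately show thesis by (rule that)
qed

lemma net_outdegree_le_1_if_matching:
  assumes I: "finite I" and matching: "\<And>i j. i \<in> I \<Longrightarrow> j \<in> I \<Longrightarrow> i \<noteq> j \<Longrightarrow>
    {fst (p i), snd (p i)} \<inter> {fst (p j), snd (p j)} = {}"
  shows "net_outdegree p I t \<le> 1"
proof (cases "\<exists>i\<in>I. t \<in> {fst (p i), snd (p i)}")
  case True
  then obtain i where i: "i \<in> I" "t \<in> {fst (p i), snd (p i)}" by blast
  have "net_outdegree p (I - {i}) t = 0" unfolding net_outdegree_def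
  proof (rule sum.neutral, rule ballI)
    fix j assume "j \<in> I - {i}"
    then have "t \<notin> {fst (p j), snd (p j)}" using matching[of i j] i by blast
    then show "of_bool (fst (p j) = t) - of_bool (snd (p j) = t) = (0 :: int)" by auto
  qed
  then show ?thesis using net_outdegree_remove[OF I i(1), of p t] by simp
next
  case False
  then have "net_outdegree p I t = 0" unfolding net_outdegree_def by (intro sum.neutral) auto
  then show ?thesis by simp
qed

lemma obtain_balanced_orientation:
  assumes "finite I"
  obtains q where "orients I p q" "\<And>t. net_outdegree q I t \<le> 1"
  using assms
proof (induction "card I" arbitrary: I p thesis rule: less_induct)
  case less
  show ?case
  proof (cases "\<exists>i\<in>I. \<exists>j\<in>I. i \<noteq> j \<and> {fst (p i), snd (p i)} \<inter> {fst (p j), snd (p j)} \<noteq> {}")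
    case True
    then obtain i j t where ij: "i \<in> I" "j \<in> I" "i \<noteq> j"
      and t: "t \<in> {fst (p i), snd (p i)}" "t \<in> {fst (p j), snd (p j)}" by blast
    then obtain x y where pi: "p i = (t, x) \<or> p i = (x, t)" and pj: "p j = (t, y) \<or> p j = (y, t)"
      by (metis insertE prod.collapse singletonD)
    have "card (I - {j}) < card I" using ij less.prems(2) by (intro psubset_card_mono) auto
    then obtain q where q: "orients (I - {j}) (p(i := (x, y))) q" "\<And>t. net_outdegree q (I - {j}) t \<le> 1"
      using less.hyps less.prems(2) by (metis finite_Diff)
    obtain q' where "orients I p q'" "\<And>s. net_outdegree q' I s = net_outdegree q (I - {j}) s"
      using orients_merge[OF less.prems(2) ij pi pj q(1)] by blast
    then show ?thesis using q(2) less.prems(1) by simp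
  next
    case False
    then have "net_outdegree p I t \<le> 1" for t
      by (intro net_outdegree_le_1_if_matching less.prems(2)) blast
    then show ?thesis using less.prems(1)[of p] unfolding orients_def by blast
  qed
qed

lemma balanced_choice_exists:
  assumes I: "finite I" and pair: "\<And>i. i \<in> I \<Longrightarrow> card (N i) = 2"
  shows "\<exists>r. (\<forall>i\<in>I. r i \<in> N i) \<and>
    (\<forall>t. card {i \<in> I. i \<in> good t \<and> r i = t} \<le> card {i \<in> I. i \<in> good t \<and> t \<in> N i \<and> r i \<noteq> t} + 1)"
proof -
  have "\<exists>p. fst p \<noteq> snd p \<and> N i = {fst p, snd p}" if "i \<in> I" for i
    using pair[OF that] by (auto simp: card_2_iff)
  then obtain p where p: "\<And>i. i \<in> I \<Longrightarrow> fst (p i) \<noteq> snd (p i) \<and> N i = {fst (p i), snd (p i)}" by metis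
  define A where "A = {i \<in> I. \<forall>t\<in>N i. i \<in> good t}"
  have A: "finite A" "A \<subseteq> I" using I unfolding A_def by auto
  obtain q where q: "orients A p q" and balanced: "\<And>t. net_outdegree q A t \<le> 1"
    using obtain_balanced_orientation[OF A(1), of p] by blast
  have qN: "fst (q i) \<noteq> snd (q i) \<and> N i = {fst (q i), snd (q i)}" if "i \<in> A" for i
    using bspec[OF q[unfolded orients_def] that] p[of i] A(2) that by (auto simp: doubleton_eq_iff)
  define r where "r i = (if i \<in> A then fst (q i) else SOME t. t \<in> N i \<and> i \<notin> good t)" for i
  have bad: "r i \<in> N i \<and> i \<notin> good (r i)" if "i \<in> I - A" for i
  proof -
    have "\<exists>t. t \<in> N i \<and> i \<notin> good t" using that unfolding A_def by blast
    from someI_ex[OF this] show ?thesis using that unfolding r_def by simp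
  qed
  show ?thesis
  proof (intro exI[of _ r] conjI ballI allI)
    show "r i \<in> N i" if "i \<in> I" for i
      using bad[of i] qN[of i] that unfolding r_def by (cases "i \<in> A") auto
    fix t
    have "i \<in> A \<and> fst (q i) = t" if "i \<in> I" "i \<in> good t" "r i = t" for i
      using bad[of i] that unfolding r_def by (cases "i \<in> A") auto
    then have "card {i \<in> I. i \<in> good t \<and> r i = t} \<le> card {i \<in> A. fst (q i) = t}"
      using A(1) by (intro card_mono) auto
    also have "\<dots> \<le> card {i \<in> A. snd (q i) = t} + 1"
      using balanced[of t] net_outdegree_eq[OF A(1), of q t] by simp
    also have "t \<in> N i \<and> r i \<noteq> t \<and> i \<in> good t" if "i \<in> A" "snd (q i) = t" for i
      using qN[OF that(1)] that unfolding r_def A_def by auto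
    then have "card {i \<in> A. snd (q i) = t} \<le> card {i \<in> I. i \<in> good t \<and> t \<in> N i \<and> r i \<noteq> t}"
      using I A(2) by (intro card_mono) auto
    finally show "card {i \<in> I. i \<in> good t \<and> r i = t} \<le> card {i \<in> I. i \<in> good t \<and> t \<in> N i \<and> r i \<noteq> t} + 1"
      by simp
  qed
qed

section \<open>Packing spanning trees with reserved edges\<close>

definition packing_rank ::
    "'v set \<Rightarrow> 'i set \<Rightarrow> ('i \<Rightarrow> 'v set) \<Rightarrow> ('v \<Rightarrow> 'i set) \<Rightarrow> ('v \<Rightarrow> nat) \<Rightarrow> nat + 'v \<Rightarrow> 'i set \<Rightarrow> nat" where
  "packing_rank V I N G D j A =
    (case j of Inl _ \<Rightarrow> card V - comp_count V N (A \<inter> I) | Inr t \<Rightarrow> min (D t) (card (A \<inter> G t)))"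

definition packing_target :: "'v set \<Rightarrow> ('v \<Rightarrow> nat) \<Rightarrow> nat + 'v \<Rightarrow> nat" where
  "packing_target V D j = (case j of Inl _ \<Rightarrow> card V - 1 | Inr t \<Rightarrow> D t)"

lemma min_card_Int_submodular:
  assumes "finite G"
  shows "min d (card ((A \<union> B) \<inter> G)) + min d (card ((A \<inter> B) \<inter> G)) \<le>
    min d (card (A \<inter> G)) + min d (card (B \<inter> G))"
proof -
  have "(A \<union> B) \<inter> G = (A \<inter> G) \<union> (B \<inter> G)" "(A \<inter> B) \<inter> G = (A \<inter> G) \<inter> (B \<inter> G)" by auto
  then have "card (A \<inter> G) + card (B \<inter> G) = card ((A \<union> B) \<inter> G) + card ((A \<inter> B) \<inter> G)"
    using card_Un_Int[of "A \<inter> G" "B \<inter> G"] assms by simp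
  moreover have "card ((A \<inter> B) \<inter> G) \<le> card (A \<inter> G)" "card ((A \<inter> B) \<inter> G) \<le> card (B \<inter> G)"
    using assms by (auto intro!: card_mono)
  ultimately show ?thesis by (simp add: min_def)
qed

lemma rank_family_packing:
  assumes V: "finite V" "V \<noteq> {}" and N: "\<And>i. i \<in> I \<Longrightarrow> N i \<subseteq> V" and G: "\<And>t. t \<in> V \<Longrightarrow> finite (G t)"
  shows "rank_family ({..<k} <+> V) (packing_rank V I N G D) (packing_target V D)"
proof
  show "finite ({..<k} <+> V)" using V(1) by simp
next
  fix j A B assume j: "j \<in> {..<k} <+> V"
  show "packing_rank V I N G D j (A \<union> B) + packing_rank V I N G D j (A \<inter> B) \<le>
      packing_rank V I N G D j A + packing_rank V I N G D j B"
  proof (cases j)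
    case (Inl i)
    have "comp_count V N (A \<inter> I) + comp_count V N (B \<inter> I) \<le>
        comp_count V N ((A \<inter> I) \<union> (B \<inter> I)) + comp_count V N ((A \<inter> I) \<inter> (B \<inter> I))"
      using V(1) N by (intro comp_count_submodular) auto
    moreover have "(A \<inter> I) \<union> (B \<inter> I) = (A \<union> B) \<inter> I" "(A \<inter> I) \<inter> (B \<inter> I) = (A \<inter> B) \<inter> I" by auto
    moreover have count_le: "comp_count V N C \<le> card V" for C using card_classes_le[OF V(1)] .
    ultimately show ?thesis
      using count_le[of "A \<inter> I"] count_le[of "B \<inter> I"] count_le[of "(A \<union> B) \<inter> I"] count_le[of "(A \<inter> B) \<inter> I"]
      unfolding Inl packing_rank_def by simp
  next
    case (Inr t)
    then have "finite (G t)" using j G by auto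
    then show ?thesis using Inr min_card_Int_submodular unfolding packing_rank_def by simp
  qed
next
  fix j and A B :: "'b set" assume j: "j \<in> {..<k} <+> V" and AB: "A \<subseteq> B"
  show "packing_rank V I N G D j A \<le> packing_rank V I N G D j B"
  proof (cases j)
    case (Inl i)
    have "comp_count V N (B \<inter> I) \<le> comp_count V N (A \<inter> I)" using V(1) AB by (intro comp_count_antimono) auto
    then show ?thesis unfolding Inl packing_rank_def by simp
  next
    case (Inr t)
    have "card (A \<inter> G t) \<le> card (B \<inter> G t)" using AB j G Inr by (intro card_mono) auto
    then show ?thesis unfolding Inr packing_rank_def by simp
  qed
next
  fix j and A :: "'b set"
  show "packing_rank V I N G D j A \<le> packing_target V D j"
    using card_classes_pos[OF V, of "hyperadj N (A \<inter> I)"]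
    unfolding packing_rank_def packing_target_def by (auto split: sum.split)
qed


lemma sum_packing_target_le:
  assumes V: "finite V" "V \<noteq> {}" and A: "A \<subseteq> I"
    and bound: "\<And>S. S \<subseteq> V \<Longrightarrow> (\<And>t. t \<in> S \<Longrightarrow> 0 < D t) \<Longrightarrow>
      k * (comp_count V N A - 1) + sum D S \<le> card (I - A) + (\<Sum>t\<in>S. card (A \<inter> G t))"
  shows "sum (packing_target V D) ({..<k} <+> V) \<le>
    card (I - A) + (\<Sum>j\<in>{..<k} <+> V. packing_rank V I N G D j A)"
proof -
  define S where "S = {t \<in> V. card (A \<inter> G t) < D t}"
  have S: "S \<subseteq> V" "\<And>t. t \<in> S \<Longrightarrow> 0 < D t" unfolding S_def by auto
  let ?m = "\<lambda>t. min (D t) (card (A \<inter> G t))"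
  have "sum ?m S = (\<Sum>t\<in>S. card (A \<inter> G t))" unfolding S_def by (intro sum.cong) auto
  moreover have "sum ?m (V - S) = sum D (V - S)" unfolding S_def by (intro sum.cong) auto
  ultimately have "sum D V + (\<Sum>t\<in>S. card (A \<inter> G t)) = sum ?m V + sum D S"
    using sum.subset_diff[OF S(1) V(1), of D] sum.subset_diff[OF S(1) V(1), of ?m] by simp
  moreover have "k * (card V - 1) = k * (card V - comp_count V N A) + k * (comp_count V N A - 1)"
    using card_classes_le[OF V(1), of "hyperadj N A"] card_classes_pos[OF V, of "hyperadj N A"]
    by (simp add: add_mult_distrib2[symmetric])
  moreover have "A \<inter> I = A" using A by blast
  ultimately show ?thesis
    using bound[OF S] unfolding sum.Plus[OF finite_lessThan V(1)]
    by (simp add: packing_rank_def packing_target_def)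
qed

lemma obtain_colouring_of_disjoint_sets:
  assumes "\<And>i j. i < k \<Longrightarrow> j < k \<Longrightarrow> i \<noteq> j \<Longrightarrow> F i \<inter> F j = {}"
  obtains c :: "'a \<Rightarrow> nat" where "\<And>e. c e \<le> k" "\<And>e j. j < k \<Longrightarrow> c e = Suc j \<longleftrightarrow> e \<in> F j"
proof -
  define c where "c e = (if \<exists>i<k. e \<in> F i then Suc (SOME i. i < k \<and> e \<in> F i) else 0)" for e
  have c: "\<exists>i<k. e \<in> F i \<and> c e = Suc i" if ex: "\<exists>i<k. e \<in> F i" for e
    using someI_ex[OF ex] ex unfolding c_def by auto
  show thesis
  proof
    show "c e \<le> k" for e using c[of e] unfolding c_def by (cases "\<exists>i<k. e \<in> F i") auto
    show "c e = Suc j \<longleftrightarrow> e \<in> F j" if jk: "j < k" for e j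
    proof
      assume "c e = Suc j"
      then show "e \<in> F j" using c[of e] by (cases "\<exists>i<k. e \<in> F i") (auto simp: c_def)
    next
      assume "e \<in> F j"
      then obtain i where "i < k" "e \<in> F i" "c e = Suc i" using c[of e] jk by blast
      then show "c e = Suc j" using assms[of i j] jk \<open>e \<in> F j\<close> by blast
    qed
  qed
qed

lemma equivclp_if_packing_rank_eq_target:
  assumes V: "finite V" "s \<in> V" "t \<in> V"
    and full: "packing_rank V I N G D (Inl i) F = packing_target V D (Inl i)"
  shows "equivclp (hyperadj N (F \<inter> I)) s t"
proof (rule equivclp_if_card_classes_le_1[OF V(1) _ V(2,3)])
  have "card V - comp_count V N (F \<inter> I) = card V - 1"
    using full unfolding packing_rank_def packing_target_def by simp
  then show "comp_count V N (F \<inter> I) \<le> 1"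
    using card_classes_le[OF V(1), of "hyperadj N (F \<inter> I)"] card_gt_0_iff[of V] V by (cases "card V") auto
qed

theorem reserved_tree_packing:
  assumes V: "finite V" "V \<noteq> {}" and I: "finite I" and N: "\<And>i. i \<in> I \<Longrightarrow> N i \<subseteq> V"
    and G: "\<And>t. t \<in> V \<Longrightarrow> G t \<subseteq> I"
    and bound: "\<And>A S. A \<subseteq> I \<Longrightarrow> S \<subseteq> V \<Longrightarrow> (\<And>t. t \<in> S \<Longrightarrow> 0 < D t) \<Longrightarrow>
      k * (comp_count V N A - 1) + sum D S \<le> card (I - A) + (\<Sum>t\<in>S. card (A \<inter> G t))"
  obtains c :: "'i \<Rightarrow> nat" where "\<And>i. c i \<le> k"
    "\<And>j s t. j \<in> {1..k} \<Longrightarrow> s \<in> V \<Longrightarrow> t \<in> V \<Longrightarrow> equivclp (hyperadj N {i \<in> I. c i = j}) s t"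
    "\<And>t. t \<in> V \<Longrightarrow> D t \<le> card {i \<in> G t. c i = 0}"
proof -
  have finG: "finite (G t)" if "t \<in> V" for t using G[OF that] I finite_subset by blast
  let ?J = "{..<k} <+> V" and ?r = "packing_rank V I N G D" and ?\<rho> = "packing_target V D"
  interpret rank_family ?J ?r ?\<rho> by (rule rank_family_packing[OF V N finG])
  have "extendable I (\<lambda>_. {})" unfolding extendable_def
    using sum_packing_target_le[OF V _ bound] by simp
  from disjoint_bases[OF I this] obtain F where bases: "\<forall>j\<in>?J. F j \<subseteq> I \<and> ?r j (F j) = ?\<rho> j"
    and "pairwise (\<lambda>i j. disjnt (F i) (F j)) ?J" by auto
  then have disjoint: "F i \<inter> F j = {}" if "i \<in> ?J" "j \<in> ?J" "i \<noteq> j" for i j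
    using that unfolding pairwise_def disjnt_def by blast
  have F: "?r j (F j) = ?\<rho> j" if "j \<in> ?J" for j using bases that by blast
  have "F (Inl i) \<inter> F (Inl j) = {}" if "i < k" "j < k" "i \<noteq> j" for i j
    using that by (intro disjoint) auto
  then obtain c :: "'i \<Rightarrow> nat" where c: "\<And>e. c e \<le> k" "\<And>e j. j < k \<Longrightarrow> c e = Suc j \<longleftrightarrow> e \<in> F (Inl j)"
    using obtain_colouring_of_disjoint_sets[of k "\<lambda>j. F (Inl j)"] by blast
  show thesis
  proof (rule that[OF c(1)])
    fix j s t assume "j \<in> {1..k}" and st: "s \<in> V" "t \<in> V"
    then obtain i where j: "j = Suc i" "i < k" by (cases j) auto
    have "{e \<in> I. c e = j} = F (Inl i) \<inter> I" using c(2)[OF j(2)] j(1) by blast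
    moreover have "equivclp (hyperadj N (F (Inl i) \<inter> I)) s t"
      using F[OF InlI[of i "{..<k}" V]] j(2) by (intro equivclp_if_packing_rank_eq_target[OF V(1) st]) simp
    ultimately show "equivclp (hyperadj N {e \<in> I. c e = j}) s t" by simp
  next
    fix t assume t: "t \<in> V"
    have "D t \<le> card (F (Inr t) \<inter> G t)"
      using F[OF InrI[OF t]]
      unfolding packing_rank_def packing_target_def by (simp add: min_def split: if_splits)
    also have "c e = 0" if e: "e \<in> F (Inr t)" for e
    proof (rule ccontr)
      assume "c e \<noteq> 0"
      then obtain i where "c e = Suc i" "i < k" using c(1)[of e] by (cases "c e") auto
      then show False using c(2)[of i e] disjoint[of "Inl i" "Inr t"] e t by auto
    qed
    then have "card (F (Inr t) \<inter> G t) \<le> card {i \<in> G t. c i = 0}" using finG[OF t] by (intro card_mono) auto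
    finally show "D t \<le> card {i \<in> G t. c i = 0}" .
  qed
qed

section \<open>Rooted hypergraphs with edges of size two and three\<close>

definition admissible :: "nat \<Rightarrow> 'a set \<Rightarrow> 'a set \<Rightarrow> nat \<Rightarrow> bool" where
  "admissible k B G n \<longleftrightarrow> n = 0 \<or> card B = 6 * k + 6 \<and> 2 * n + card (B - G) \<le> 2 * k"

text \<open>The pair \<open>(G, n)\<close> is chosen before the colouring \<open>\<phi>\<close> of \<open>B\<close>, so that it can be passed on as a
  demand at a contracted vertex.\<close>

definition extends_precolourings :: "nat \<Rightarrow> 'a set \<Rightarrow> (('a \<Rightarrow> nat) \<Rightarrow> bool) \<Rightarrow> bool" where
  "extends_precolourings k B Ext \<longleftrightarrow> (\<exists>G n. admissible k B G n \<and>
     (\<forall>\<phi>. (\<forall>e. \<phi> e \<le> k) \<and> n \<le> card {e \<in> B \<inter> G. \<phi> e = 0} \<longrightarrow> Ext \<phi>))"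

lemma extends_precolouringsI:
  assumes "admissible k B G n"
    and "\<And>\<phi>. (\<And>e. \<phi> e \<le> k) \<Longrightarrow> n \<le> card {e \<in> B \<inter> G. \<phi> e = 0} \<Longrightarrow> Ext \<phi>"
  shows "extends_precolourings k B Ext"
  using assms unfolding extends_precolourings_def by blast

definition splits :: "'v set \<Rightarrow> 'v set \<Rightarrow> bool" where
  "splits X e \<longleftrightarrow> e \<inter> X \<noteq> {} \<and> e - X \<noteq> {}"

locale rooted_hypergraph =
  fixes L :: "'l set" and verts :: "'l \<Rightarrow> 'v set" and T :: "'v set" and v :: 'v and k :: nat
  assumes finite_L: "finite L" and finite_T: "finite T" and root: "v \<in> T"
    and verts_subset: "\<And>l. l \<in> L \<Longrightarrow> verts l \<subseteq> T"
    and card_verts: "\<And>l. l \<in> L \<Longrightarrow> card (verts l) \<in> {2, 3}"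
    and cut_bound: "\<And>X. X \<subseteq> T \<Longrightarrow> X \<noteq> {} \<Longrightarrow> X \<noteq> T \<Longrightarrow> 6 * k + 6 \<le> card {l \<in> L. splits X (verts l)}"
    and root_degree: "card {l \<in> L. v \<in> verts l} = 6 * k + 6"
begin

abbreviation V :: "'v set" where "V \<equiv> T - {v}"

definition incident :: "'v \<Rightarrow> 'l set" where "incident t = {l \<in> L. t \<in> verts l}"
definition nbs :: "'l \<Rightarrow> 'v set" where "nbs l = verts l - {v}"
definition inner_edges :: "'l set" where "inner_edges = L - incident v"
definition root_triples :: "'l set" where "root_triples = {l \<in> incident v. card (nbs l) = 2}"
definition root_pairs :: "'l set" where "root_pairs = {l \<in> incident v. card (nbs l) = 1}"

lemma finite_parts [simp]:
  "finite L" "finite T" "finite (incident t)" "finite inner_edges" "finite root_triples" "finite root_pairs"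
  using finite_L finite_T
  unfolding incident_def inner_edges_def root_triples_def root_pairs_def by auto

lemma nbs_subset: "l \<in> L \<Longrightarrow> nbs l \<subseteq> V"
  using verts_subset unfolding nbs_def by blast

lemma finite_nbs: "l \<in> L \<Longrightarrow> finite (nbs l)"
  using nbs_subset finite_subset[of "nbs l" V] by simp

lemma nbs_inner: "l \<in> inner_edges \<Longrightarrow> nbs l = verts l"
  unfolding inner_edges_def incident_def nbs_def by blast

lemma card_nbs_inner: "l \<in> inner_edges \<Longrightarrow> card (nbs l) \<in> {2, 3}"
  using card_verts[of l] nbs_inner[of l] unfolding inner_edges_def by simp

lemma card_nbs_root: "l \<in> incident v \<Longrightarrow> card (nbs l) \<in> {1, 2}"
  using card_verts[of l] unfolding incident_def nbs_def by (auto simp: card_Diff_singleton_if)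

lemma incident_root_eq: "incident v = root_triples \<union> root_pairs" "root_triples \<inter> root_pairs = {}"
  using card_nbs_root unfolding root_triples_def root_pairs_def by auto

lemma L_eq: "L = inner_edges \<union> incident v" "inner_edges \<inter> incident v = {}"
  unfolding inner_edges_def incident_def by auto

lemma card_incident_root: "card (incident v) = 6 * k + 6"
  using root_degree unfolding incident_def .

lemma card_root_triples_pairs: "card root_triples + card root_pairs = 6 * k + 6"
  using card_incident_root incident_root_eq card_Un_disjoint[of root_triples root_pairs] by simp

definition split_classes :: "'l set \<Rightarrow> 'l \<Rightarrow> 'v set set" where
  "split_classes A l = {C \<in> classes V (hyperadj nbs A). splits C (verts l)}"

lemma split_classes_subset:
  assumes "A \<subseteq> L"
  shows "split_classes A l \<subseteq> (\<lambda>x. {y. equivclp (hyperadj nbs A) x y}) ` nbs l"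
proof
  fix C assume "C \<in> split_classes A l"
  then obtain x where C: "C \<in> classes V (hyperadj nbs A)" and x: "x \<in> verts l" "x \<in> C"
    unfolding split_classes_def splits_def by blast
  have "C \<subseteq> V" by (rule classes_hyperadj_subset[OF C]) (use assms nbs_subset in blast)
  then have "x \<in> nbs l" using x unfolding nbs_def by blast
  then show "C \<in> (\<lambda>x. {y. equivclp (hyperadj nbs A) x y}) ` nbs l" using in_classes_eq[OF C x(2)] by blast
qed

lemma card_split_classes_inner:
  assumes A: "A \<subseteq> L" and l: "l \<in> inner_edges"
  shows "card (split_classes A l) \<le> (if l \<in> A then 0 else 3)"
proof -
  have lL: "l \<in> L" using l unfolding inner_edges_def by simp
  have "split_classes A l = {}" if lA: "l \<in> A"
  proof (rule ccontr)
    assume "split_classes A l \<noteq> {}"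
    then obtain C x y where C: "C \<in> classes V (hyperadj nbs A)"
      and x: "x \<in> nbs l" "x \<in> C" and y: "y \<in> nbs l" "y \<notin> C"
      unfolding split_classes_def splits_def nbs_inner[OF l] by blast
    have "equivclp (hyperadj nbs A) x y" using lA x(1) y(1) unfolding hyperadj_def by blast
    then show False using in_classes_eq[OF C x(2)] y(2) by blast
  qed
  moreover have "card (split_classes A l) \<le> card (nbs l)"
    by (rule surj_card_le[OF finite_nbs[OF lL] split_classes_subset[OF A]])
  ultimately show ?thesis using card_nbs_inner[OF l] by auto
qed

lemma card_split_classes_root:
  assumes A: "A \<subseteq> L" and l: "l \<in> incident v"
  shows "card (split_classes A l) \<le> 1 + (if l \<in> root_triples - A then 1 else 0)"
proof -
  have lL: "l \<in> L" using l unfolding incident_def by simp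
  have "card (split_classes A l) \<le> 1" if lA: "l \<in> A"
  proof -
    have "C = D" if CD: "C \<in> split_classes A l" "D \<in> split_classes A l" for C D
    proof -
      obtain x y where xy: "x \<in> nbs l" "y \<in> nbs l" and
        C: "C = {z. equivclp (hyperadj nbs A) x z}" and D: "D = {z. equivclp (hyperadj nbs A) y z}"
        using split_classes_subset[OF A] CD by (meson imageE subsetD)
      have "equivclp (hyperadj nbs A) x y" using lA xy unfolding hyperadj_def by blast
      then show ?thesis unfolding C D equivclp_Collect_eq_iff .
    qed
    moreover have "finite (split_classes A l)" unfolding split_classes_def by simp
    ultimately show ?thesis using card_le_Suc0_iff_eq[of "split_classes A l"] by simp
  qed
  moreover have "card (split_classes A l) \<le> card (nbs l)"
    by (rule surj_card_le[OF finite_nbs[OF lL] split_classes_subset[OF A]])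
  ultimately show ?thesis using card_nbs_root[OF l] l unfolding root_triples_def by auto
qed

lemma comp_count_bound:
  assumes A: "A \<subseteq> L"
  shows "(6 * k + 6) * comp_count V nbs A \<le>
    3 * card (inner_edges - A) + (6 * k + 6) + card (root_triples - A)"
proof -
  let ?Cs = "classes V (hyperadj nbs A)"
  have "(6 * k + 6) * comp_count V nbs A = (\<Sum>C\<in>?Cs. 6 * k + 6)" by simp
  also have "\<dots> \<le> (\<Sum>C\<in>?Cs. card {l \<in> L. splits C (verts l)})"
  proof (rule sum_mono)
    fix C assume C: "C \<in> ?Cs"
    have "C \<subseteq> V" by (rule classes_hyperadj_subset[OF C]) (use A nbs_subset in blast)
    then show "6 * k + 6 \<le> card {l \<in> L. splits C (verts l)}"
      using in_classes_nonempty[OF C] root by (intro cut_bound) auto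
  qed
  also have "\<dots> = (\<Sum>l\<in>L. card (split_classes A l))"
    by (rule sum_multicount_gen) (simp_all add: split_classes_def)
  also have "\<dots> = (\<Sum>l\<in>inner_edges. card (split_classes A l)) + (\<Sum>l\<in>incident v. card (split_classes A l))"
    by (subst L_eq(1), rule sum.union_disjoint) (simp_all add: L_eq(2))
  also have "\<dots> \<le> (\<Sum>l\<in>inner_edges. if l \<in> A then 0 else 3) +
      (\<Sum>l\<in>incident v. 1 + (if l \<in> root_triples - A then 1 else 0))"
    by (intro add_mono sum_mono card_split_classes_inner card_split_classes_root A)
  also have "\<dots> = 3 * card (inner_edges - A) + (6 * k + 6) + card (root_triples - A)"
  proof -
    have "incident v \<inter> {l. l \<in> root_triples \<and> l \<notin> A} = root_triples - A" unfolding root_triples_def by blast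
    then show ?thesis
      unfolding sum.distrib
      using card_incident_root by (simp add: sum.If_cases Diff_eq Collect_neg_eq mult.commute)
  qed
  finally show ?thesis .
qed

definition inner_cut :: "'v set \<Rightarrow> nat" where
  "inner_cut Y = card {l \<in> inner_edges. splits Y (nbs l)}"

definition weak :: "'v set \<Rightarrow> bool" where
  "weak Y \<longleftrightarrow> Y \<subseteq> V \<and> Y \<noteq> {} \<and> Y \<noteq> V \<and> inner_cut Y < k"

lemma inner_edge_or_root_triple_if_splits:
  assumes l: "l \<in> L" "splits Y (verts l)" "splits (V - Y) (verts l)" and Y: "Y \<subseteq> V"
  shows "l \<in> inner_edges \<union> root_triples" and "splits Y (nbs l)"
proof -
  obtain x y where "x \<in> verts l" "x \<in> Y" "y \<in> verts l" "y \<in> V - Y"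
    using l(2,3) unfolding splits_def by blast
  then have xy: "x \<in> nbs l" "x \<in> Y" "y \<in> nbs l" "y \<notin> Y" using Y unfolding nbs_def by auto
  then show "splits Y (nbs l)" unfolding splits_def by blast
  have "{x, y} \<subseteq> nbs l" "x \<noteq> y" using xy by auto
  then have "2 \<le> card (nbs l)" using card_mono[OF finite_nbs, of l "{x, y}"] l(1) by simp
  then show "l \<in> inner_edges \<union> root_triples"
    using card_nbs_root[of l] l(1) unfolding inner_edges_def root_triples_def by auto
qed

lemma bipartition_bound:
  assumes Y: "Y \<subseteq> V" "Y \<noteq> {}" "Y \<noteq> V"
  shows "6 * k + 6 \<le> 2 * inner_cut Y + card {l \<in> root_triples. splits Y (nbs l)}"
proof -
  let ?A = "{l \<in> L. splits Y (verts l)}" and ?B = "{l \<in> L. splits (V - Y) (verts l)}"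
  let ?I = "{l \<in> inner_edges. splits Y (nbs l)}" and ?R = "{l \<in> root_triples. splits Y (nbs l)}"
  have "V - Y \<noteq> {}" using Y by blast
  then have "2 * (6 * k + 6) \<le> card ?A + card ?B"
    using cut_bound[of Y] cut_bound[of "V - Y"] Y root by fastforce
  also have "\<dots> = card (?A \<union> ?B) + card (?A \<inter> ?B)" by (rule card_Un_Int) auto
  also have "card (?A \<union> ?B) \<le> card (?I \<union> incident v)"
  proof (rule card_mono)
    show "?A \<union> ?B \<subseteq> ?I \<union> incident v"
    proof
      fix l assume l: "l \<in> ?A \<union> ?B"
      show "l \<in> ?I \<union> incident v"
      proof (cases "l \<in> incident v")
        case False
        then have inner: "l \<in> inner_edges" using l unfolding inner_edges_def by blast
        have "verts l \<subseteq> V" using nbs_subset[of l] nbs_inner[OF inner] l by auto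
        then have "splits Y (verts l)" using l unfolding splits_def by blast
        then show ?thesis using inner nbs_inner[OF inner] by simp
      qed simp
    qed
  qed simp
  also have "\<dots> \<le> inner_cut Y + (6 * k + 6)"
    unfolding inner_cut_def card_incident_root[symmetric] by (rule card_Un_le)
  also have "card (?A \<inter> ?B) \<le> card (?I \<union> ?R)"
    using inner_edge_or_root_triple_if_splits[OF _ _ _ Y(1)] by (intro card_mono) auto
  also have "\<dots> \<le> inner_cut Y + card ?R" unfolding inner_cut_def by (rule card_Un_le)
  finally show ?thesis by simp
qed

lemma three_traces:
  assumes Y: "Y \<subseteq> V" "Y \<noteq> {}" "Y \<noteq> V" and Z: "Z \<subseteq> V" "Z \<noteq> {}" "Z \<noteq> V" and "Z \<noteq> Y" "Z \<noteq> V - Y"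
  shows "3 \<le> card ((\<lambda>x. (x \<in> Y, x \<in> Z)) ` V)"
proof -
  define f where "f x = (x \<in> Y, x \<in> Z)" for x
  obtain x where x: "x \<in> V" "x \<in> Z \<longleftrightarrow> x \<notin> Y" using assms(7) Y(1) Z(1) by blast
  obtain y where y: "y \<in> V" "y \<in> Z \<longleftrightarrow> y \<in> Y" using assms(8) Y(1) Z(1) by blast
  obtain a b where ab: "a \<in> V" "b \<in> V" "a \<in> Y" "b \<notin> Y" using Y by blast
  obtain c d where cd: "c \<in> V" "d \<in> V" "c \<in> Z" "d \<notin> Z" using Z by blast
  obtain z where z: "z \<in> V" "f z \<noteq> f x" "f z \<noteq> f y"
  proof (cases "x \<in> Y \<longleftrightarrow> y \<in> Y")
    case True
    then have "f a \<noteq> f x \<and> f a \<noteq> f y \<or> f b \<noteq> f x \<and> f b \<noteq> f y" using ab unfolding f_def by auto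
    then show ?thesis using that[of a] that[of b] ab(1,2) by blast
  next
    case False
    then have "f c \<noteq> f x \<and> f c \<noteq> f y \<or> f d \<noteq> f x \<and> f d \<noteq> f y" using cd x y unfolding f_def by auto
    then show ?thesis using that[of c] that[of d] cd(1,2) by blast
  qed
  have "f x \<noteq> f y" using x y unfolding f_def by auto
  then have "card {f x, f y, f z} = 3" using z by auto
  moreover have "card {f x, f y, f z} \<le> card (f ` V)" using x(1) y(1) z(1) by (intro card_mono) auto
  ultimately show ?thesis unfolding f_def by simp
qed

lemma weak_unique:
  assumes Y: "weak Y" and Z: "weak Z"
  shows "Z = Y \<or> Z = V - Y"
proof (rule ccontr)
  assume neg: "\<not> ?thesis"
  let ?IY = "{l \<in> inner_edges. splits Y (nbs l)}" and ?IZ = "{l \<in> inner_edges. splits Z (nbs l)}"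
  define A where "A = inner_edges - ?IY - ?IZ"
  have AL: "A \<subseteq> L" unfolding A_def inner_edges_def by blast
  have "3 \<le> card ((\<lambda>x. (x \<in> Y, x \<in> Z)) ` V)" using Y Z neg unfolding weak_def by (intro three_traces) auto
  also have "\<dots> \<le> comp_count V nbs A"
  proof (rule card_image_le_card_classes)
    show "(x \<in> Y, x \<in> Z) = (y \<in> Y, y \<in> Z)" if "hyperadj nbs A x y" for x y
      using that unfolding hyperadj_def A_def splits_def by blast
  qed simp
  finally have "(6 * k + 6) * 3 \<le> (6 * k + 6) * comp_count V nbs A" by (rule mult_le_mono2)
  also note comp_count_bound[OF AL]
  finally have bound: "(6 * k + 6) * 3 \<le> 3 * card (inner_edges - A) + (6 * k + 6) + card (root_triples - A)" .
  have "card (inner_edges - A) \<le> card (?IY \<union> ?IZ)" by (rule card_mono) (auto simp: A_def)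
  also have "\<dots> \<le> inner_cut Y + inner_cut Z" unfolding inner_cut_def by (rule card_Un_le)
  finally have "card (inner_edges - A) + 2 \<le> 2 * k" using Y Z unfolding weak_def by linarith
  moreover have "card (root_triples - A) \<le> card root_triples" by (intro card_mono) auto
  ultimately show False using bound card_root_triples_pairs by simp
qed

definition forest_bound :: "nat \<Rightarrow> nat" where
  "forest_bound p = max (k * (p - 1)) ((2 * k + 2) * (p - 1) - card root_triples div 3)"

lemma convex_increasing_forest_bound: "convex_increasing forest_bound"
  unfolding convex_increasing_def
proof (intro allI impI)
  fix a p q b :: nat assume "a \<le> p" "a \<le> q" "p + q \<le> a + b"
  define w where "w = card root_triples div 3"
  define h where "h x = max (k * x) ((2 * k + 2) * x - w)" for x
  have lower: "k * x \<le> h x" "2 * (k * x) + 2 * x \<le> h x + w" for x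
    unfolding h_def by (simp_all add: algebra_simps)
  have upper: "h x = k * x \<or> h x + w = 2 * (k * x) + 2 * x" for x
    unfolding h_def by (auto simp: algebra_simps max_def)
  have h_convex: "h P + h Q \<le> h A + h B" if PQ: "A \<le> P" "A \<le> Q" "P + Q \<le> A + B" for P Q A B
  proof -
    obtain d where d: "P = A + d" using PQ(1) le_Suc_ex by blast
    obtain d' where d': "Q = A + d'" using PQ(2) le_Suc_ex by blast
    obtain e where e: "B = A + d + d' + e"
      using PQ(3) le_Suc_ex[of "P + Q" "A + B"] unfolding d d' by auto
    have products: "k * P = k * A + k * d" "k * Q = k * A + k * d'" "k * B = k * A + k * d + k * d' + k * e"
      unfolding d d' e by (simp_all add: algebra_simps)
    from upper[of P] upper[of Q] show ?thesis
      using lower[of A] lower[of B] products d d' e by (elim disjE) linarith+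
  qed
  have "forest_bound x = h (x - 1)" for x unfolding forest_bound_def h_def w_def by simp
  then show "forest_bound p + forest_bound q \<le> forest_bound a + forest_bound b"
    using h_convex[of "a - 1" "p - 1" "q - 1" "b - 1"] \<open>a \<le> p\<close> \<open>a \<le> q\<close> \<open>p + q \<le> a + b\<close> by simp
qed

definition free_triples :: "('l \<Rightarrow> nat) \<Rightarrow> 'l set" where
  "free_triples \<phi> = {l \<in> root_triples. \<phi> l = 0}"

definition free_edges :: "('l \<Rightarrow> nat) \<Rightarrow> 'l set" where
  "free_edges \<phi> = inner_edges \<union> free_triples \<phi>"

definition used_triples :: "('l \<Rightarrow> nat) \<Rightarrow> 'l set" where
  "used_triples \<phi> = root_triples - free_triples \<phi>"

lemma finite_free_edges [simp]: "finite (free_edges \<phi>)" "finite (used_triples \<phi>)"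
  unfolding free_edges_def free_triples_def used_triples_def by auto

lemma L_eq_free_used: "L = free_edges \<phi> \<union> used_triples \<phi> \<union> root_pairs"
  using L_eq(1) incident_root_eq(1) unfolding free_edges_def used_triples_def free_triples_def by blast

lemma free_used_disjoint:
  "free_edges \<phi> \<inter> used_triples \<phi> = {}" "free_edges \<phi> \<inter> root_pairs = {}" "used_triples \<phi> \<inter> root_pairs = {}"
  using L_eq(2) incident_root_eq unfolding free_edges_def used_triples_def free_triples_def by blast+

lemma card_nbs_free: "l \<in> free_edges \<phi> \<Longrightarrow> card (nbs l) \<in> {2, 3}"
  using card_nbs_inner unfolding free_edges_def free_triples_def root_triples_def by auto

lemma two_classes_bound:
  assumes root_free: "\<And>Y. weak Y \<Longrightarrow> k \<le> inner_cut Y + card {l \<in> free_triples \<phi>. splits Y (nbs l)}"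
    and A: "A \<subseteq> free_edges \<phi>" and two: "comp_count V nbs A = 2"
  shows "k \<le> card (free_edges \<phi> - A)"
proof -
  let ?Cs = "classes V (hyperadj nbs A)"
  obtain Y Z where YZ: "?Cs = {Y, Z}" "Y \<noteq> Z" using two by (auto simp: card_2_iff)
  then have mem: "Y \<in> ?Cs" "Z \<in> ?Cs" by auto
  have "A \<subseteq> L" using A L_eq_free_used by blast
  then have sub: "C \<subseteq> V" if "C \<in> ?Cs" for C
    using classes_hyperadj_subset[OF that] nbs_subset by blast
  obtain z where z: "z \<in> Z" using in_classes_nonempty[OF mem(2)] by blast
  then have "z \<notin> Y" using in_classes_eq[OF mem(1)] in_classes_eq[OF mem(2)] YZ(2) by metis
  then have Y: "Y \<subseteq> V" "Y \<noteq> {}" "Y \<noteq> V" using sub mem z in_classes_nonempty by blast+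
  have "\<not> splits Y (nbs l)" if "l \<in> A" for l
  proof
    assume "splits Y (nbs l)"
    then obtain x y where x: "x \<in> nbs l" "x \<in> Y" and y: "y \<in> nbs l" "y \<notin> Y" unfolding splits_def by blast
    then have "equivclp (hyperadj nbs A) x y" using that unfolding hyperadj_def by blast
    then show False using in_classes_eq[OF mem(1) x(2)] y(2) by blast
  qed
  then have unsplit:
      "{l \<in> inner_edges. splits Y (nbs l)} \<union> {l \<in> free_triples \<phi>. splits Y (nbs l)} \<subseteq> free_edges \<phi> - A"
    unfolding free_edges_def by blast
  have "k \<le> inner_cut Y + card {l \<in> free_triples \<phi>. splits Y (nbs l)}"
  proof (cases "weak Y")
    case True
    then show ?thesis by (rule root_free)
  next
    case False
    then show ?thesis using Y unfolding weak_def by simp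
  qed
  also have "\<dots> = card ({l \<in> inner_edges. splits Y (nbs l)} \<union> {l \<in> free_triples \<phi>. splits Y (nbs l)})"
    unfolding inner_cut_def using L_eq(2) incident_root_eq(1)
    by (intro card_Un_disjoint[symmetric]) (auto simp: free_triples_def)
  also have "\<dots> \<le> card (free_edges \<phi> - A)" using unsplit by (intro card_mono) auto
  finally show ?thesis .
qed

lemma free_edges_partition_connected:
  assumes root_free: "\<And>Y. weak Y \<Longrightarrow> k \<le> inner_cut Y + card {l \<in> free_triples \<phi>. splits Y (nbs l)}"
    and V: "V \<noteq> {}"
  shows "partition_connected forest_bound V (free_edges \<phi>) nbs"
  unfolding partition_connected_def
proof (intro allI impI)
  fix A assume A: "A \<subseteq> free_edges \<phi>"
  obtain q where q: "comp_count V nbs A = Suc q"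
    using card_classes_pos[OF _ V, of "hyperadj nbs A"] by (auto simp: Suc_le_eq gr0_conv_Suc)
  have "A \<subseteq> L" using A L_eq_free_used by blast
  moreover have "card (inner_edges - A) \<le> card (free_edges \<phi> - A)"
      "card (root_triples - A) \<le> card root_triples"
    by (auto intro!: card_mono simp: free_edges_def free_triples_def)
  ultimately have bound: "6 * (k * q) + 6 * q \<le> 3 * card (free_edges \<phi> - A) + card root_triples"
    using comp_count_bound[of A] unfolding q by (simp add: algebra_simps)
  have "k * q \<le> card (free_edges \<phi> - A)"
  proof -
    consider (one_class) "q = 0" | (two_classes) "q = 1" | (more_classes) d where "q = Suc (Suc d)"
      by (metis One_nat_def not0_implies_Suc)
    then show ?thesis
    proof cases
      case two_classes
      then show ?thesis using two_classes_bound[OF root_free A] q by simp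
    next
      case more_classes
      have "card root_triples \<le> 6 * k + 6" using card_root_triples_pairs by simp
      then show ?thesis using bound unfolding more_classes by (simp add: algebra_simps)
    qed simp
  qed
  moreover have "(2 * k + 2) * q - card root_triples div 3 \<le> card (free_edges \<phi> - A)"
    using bound by (simp add: algebra_simps)
  ultimately show "forest_bound (comp_count V nbs A) \<le> card (free_edges \<phi> - A)"
    unfolding forest_bound_def q by simp
qed

lemma card_root_pairs_at_le:
  assumes t: "t \<in> V" "V \<noteq> {t}" and deg: "card (incident t) = 6 * k + 6"
  shows "card {l \<in> root_pairs. t \<in> nbs l} \<le> 3 * k + 3"
proof -
  let ?D = "{l \<in> root_pairs. t \<in> nbs l}"
  have D: "?D \<subseteq> incident v \<inter> incident t"
    unfolding root_pairs_def incident_def nbs_def by auto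
  have "{v, t} \<subseteq> T" "{v, t} \<noteq> T" using t root by auto
  then have "6 * k + 6 \<le> card {l \<in> L. splits {v, t} (verts l)}" by (intro cut_bound) auto
  also have "\<dots> \<le> card (incident v \<union> incident t - ?D)"
  proof (rule card_mono)
    have "l \<notin> ?D" if "splits {v, t} (verts l)" for l
    proof
      assume "l \<in> ?D"
      then have "nbs l = {t}" unfolding root_pairs_def by (auto simp: card_1_singleton_iff)
      then show False using that unfolding splits_def nbs_def by auto
    qed
    then show "{l \<in> L. splits {v, t} (verts l)} \<subseteq> incident v \<union> incident t - ?D"
      unfolding incident_def splits_def by blast
  qed simp
  also have "\<dots> = card (incident v \<union> incident t) - card ?D"
    using D by (intro card_Diff_subset) (auto intro: finite_subset)
  finally have "6 * k + 6 \<le> card (incident v \<union> incident t) - card ?D" .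
  moreover have "card (incident v \<union> incident t) + card (incident v \<inter> incident t) =
      card (incident v) + card (incident t)"
    by (rule card_Un_Int[symmetric]) simp_all
  moreover have "card ?D \<le> card (incident v \<inter> incident t)" using D by (intro card_mono) auto
  ultimately show ?thesis using deg card_incident_root by linarith
qed

text \<open>The slack \<open>2 * k + 2\<close> against \<open>k\<close> in \<open>forest_bound\<close> pays for the demands at \<open>\<sigma>\<close> terminals.\<close>

lemma forest_bound_slack:
  assumes "1 \<le> \<sigma>" "1 \<le> p" and a: "a \<le> card root_pairs" "\<sigma> = 1 \<Longrightarrow> a \<le> 3 * k + 3"
  shows "2 * (k * (p - 1)) + a \<le> (4 * k + 5) * \<sigma> + forest_bound (max 1 (p + 1 - \<sigma>))"
proof -
  obtain s where s: "\<sigma> = Suc s" using assms(1) by (metis One_nat_def Suc_le_D)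
  have pairs: "a + card root_triples div 3 \<le> (2 * k + 5) * \<sigma> + 2 * k"
  proof (cases "\<sigma> = 1")
    case True
    then show ?thesis using a card_root_triples_pairs by simp
  next
    case False
    then have "(2 * k + 5) * 2 \<le> (2 * k + 5) * \<sigma>" using assms(1) by (intro mult_le_mono2) simp
    then have "4 * k + 10 \<le> (2 * k + 5) * \<sigma>" by simp
    moreover have "card root_triples div 3 \<le> card root_triples" by simp
    ultimately show ?thesis using a(1) card_root_triples_pairs by linarith
  qed
  show ?thesis
  proof (cases "\<sigma> \<le> p")
    case True
    then obtain q where q: "p = \<sigma> + q" using le_Suc_ex by blast
    then have "(2 * k + 2) * q \<le> forest_bound (max 1 (p + 1 - \<sigma>)) + card root_triples div 3"
      unfolding forest_bound_def by simp
    then show ?thesis using pairs unfolding q s by (simp add: algebra_simps)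
  next
    case False
    then have "k * (p - 1) \<le> k * (\<sigma> - 1)" by (intro mult_le_mono2) simp
    then show ?thesis using pairs unfolding s by (simp add: algebra_simps)
  qed
qed

definition colour_at :: "('l \<Rightarrow> 'v set) \<Rightarrow> ('l \<Rightarrow> nat) \<Rightarrow> 'l \<Rightarrow> 'v \<Rightarrow> nat" where
  "colour_at P c l t = (if t \<in> P l then c l else 0)"

definition extension :: "('v \<Rightarrow> 'l set) \<Rightarrow> ('v \<Rightarrow> nat) \<Rightarrow> ('l \<Rightarrow> nat) \<Rightarrow> ('l \<Rightarrow> 'v set) \<Rightarrow> ('l \<Rightarrow> nat) \<Rightarrow> bool" where
  "extension good r \<phi> P c \<longleftrightarrow>
     (\<forall>l\<in>L. P l \<subseteq> verts l \<and> card (P l) = 2 \<and> c l \<le> k) \<and>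
     (\<forall>l\<in>incident v. colour_at P c l v = \<phi> l) \<and>
     (\<forall>i\<in>{1..k}. \<forall>s\<in>V. \<forall>t\<in>V. equivclp (hyperadj P {l \<in> L. c l = i \<and> v \<notin> P l}) s t) \<and>
     (\<forall>t\<in>V. r t \<le> card {l \<in> incident t \<inter> good t. colour_at P c l t = 0})"

end

text \<open>The free edges are trimmed to the pairs \<open>N'\<close>, and each triple at the root with a nonzero colour
  to the pair of the root and \<open>route\<close>.\<close>

locale trimmed_hypergraph = rooted_hypergraph L verts T v k
  for L :: "'l set" and verts :: "'l \<Rightarrow> 'v set" and T :: "'v set" and v :: 'v and k :: nat +
  fixes \<phi> :: "'l \<Rightarrow> nat" and good :: "'v \<Rightarrow> 'l set" and r :: "'v \<Rightarrow> nat"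
    and N' :: "'l \<Rightarrow> 'v set" and route :: "'l \<Rightarrow> 'v"
  assumes precolour_le: "\<And>l. \<phi> l \<le> k" and two_terminals: "2 \<le> card V"
    and demand: "\<And>t. t \<in> V \<Longrightarrow> admissible k (incident t) (good t) (r t)"
    and trimmed: "\<And>l. l \<in> free_edges \<phi> \<Longrightarrow> N' l \<subseteq> nbs l \<and> card (N' l) = 2"
    and trimmed_connected: "partition_connected forest_bound V (free_edges \<phi>) N'"
    and route: "\<And>l. l \<in> used_triples \<phi> \<Longrightarrow> route l \<in> nbs l"
    and route_balanced: "\<And>t. card {l \<in> used_triples \<phi>. l \<in> good t \<and> route l = t} \<le>
      card {l \<in> used_triples \<phi>. l \<in> good t \<and> t \<in> nbs l \<and> route l \<noteq> t} + 1"
begin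

definition released :: "'v \<Rightarrow> 'l set" where
  "released t = {l \<in> incident t \<inter> good t. l \<in> free_edges \<phi> \<and> t \<notin> N' l \<or>
     l \<in> used_triples \<phi> \<and> route l \<noteq> t \<or> l \<in> root_pairs \<and> \<phi> l = 0}"

definition reservable :: "'v \<Rightarrow> 'l set" where
  "reservable t = {l \<in> free_edges \<phi>. t \<in> N' l \<and> l \<in> good t}"

definition missing :: "'v \<Rightarrow> nat" where
  "missing t = r t - card (released t)"

lemma finite_released [simp]: "finite (released t)" "finite (reservable t)"
  unfolding released_def reservable_def by auto

lemma N'_subset: "l \<in> free_edges \<phi> \<Longrightarrow> N' l \<subseteq> V"
  using trimmed[of l] nbs_subset[of l] L_eq_free_used[of \<phi>] by blast

lemma missing_bound:
  assumes t: "t \<in> V" and pos: "0 < missing t"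
  shows "2 * missing t + (4 * k + 5) \<le> card (reservable t) + card {l \<in> root_pairs. t \<in> nbs l}"
proof -
  let ?pairs = "{l \<in> root_pairs. t \<in> nbs l}"
  let ?at = "{l \<in> used_triples \<phi>. l \<in> good t \<and> route l = t}"
    and ?off = "{l \<in> used_triples \<phi>. l \<in> good t \<and> t \<in> nbs l \<and> route l \<noteq> t}"
  have deg: "card (incident t) = 6 * k + 6" "2 * r t + card (incident t - good t) \<le> 2 * k"
    using demand[OF t] pos unfolding admissible_def missing_def by auto
  have "incident t \<inter> good t \<subseteq> reservable t \<union> released t \<union> ?at \<union> ?pairs"
    using L_eq_free_used[of \<phi>] t unfolding incident_def reservable_def released_def nbs_def by auto
  then have "card (incident t \<inter> good t) \<le> card (reservable t \<union> released t \<union> ?at \<union> ?pairs)"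
    by (rule card_mono[rotated]) simp
  also have "\<dots> \<le> card (reservable t) + card (released t) + card ?at + card ?pairs"
    by (meson add_le_mono card_Un_le le_refl le_trans)
  also have "card ?at \<le> card ?off + 1" by (rule route_balanced)
  also have "card ?off \<le> card (released t)"
    using L_eq_free_used[of \<phi>] by (intro card_mono) (auto simp: released_def incident_def nbs_def)
  finally have "card (incident t \<inter> good t) \<le> card (reservable t) + 2 * card (released t) + 1 + card ?pairs"
    by simp
  moreover have "card (incident t) = card (incident t \<inter> good t) + card (incident t - good t)"
    by (rule card_Int_Diff) simp
  ultimately show ?thesis using deg pos unfolding missing_def by linarith
qed

lemma root_pairs_at_sum_le:
  assumes S: "S \<subseteq> V" and pos: "\<And>t. t \<in> S \<Longrightarrow> 0 < missing t"
  shows "(\<Sum>t\<in>S. card {l \<in> root_pairs. t \<in> nbs l}) \<le> card root_pairs"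
    and "card S = 1 \<Longrightarrow> (\<Sum>t\<in>S. card {l \<in> root_pairs. t \<in> nbs l}) \<le> 3 * k + 3"
proof -
  have "finite S" using S finite_subset by fastforce
  have "(\<Sum>t\<in>S. card {l \<in> root_pairs. t \<in> nbs l}) = card (\<Union>t\<in>S. {l \<in> root_pairs. t \<in> nbs l})"
    by (rule card_UN_disjoint[symmetric]) (use \<open>finite S\<close> in \<open>auto simp: root_pairs_def card_1_singleton_iff\<close>)
  also have "\<dots> \<le> card root_pairs" by (rule card_mono) auto
  finally show "(\<Sum>t\<in>S. card {l \<in> root_pairs. t \<in> nbs l}) \<le> card root_pairs" .
  assume "card S = 1"
  then obtain t where t: "S = {t}" by (auto simp: card_1_singleton_iff)
  then have "card (incident t) = 6 * k + 6"
    using demand[of t] pos[of t] S unfolding admissible_def missing_def by auto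
  moreover have "t \<in> V" using t S by simp
  moreover have "V \<noteq> {t}"
  proof
    assume "V = {t}"
    then show False using two_terminals by simp
  qed
  ultimately show "(\<Sum>t\<in>S. card {l \<in> root_pairs. t \<in> nbs l}) \<le> 3 * k + 3"
    using card_root_pairs_at_le[of t] t by simp
qed

lemma missing_packing_bound:
  assumes A: "A \<subseteq> free_edges \<phi>" and S: "S \<subseteq> V" and pos: "\<And>t. t \<in> S \<Longrightarrow> 0 < missing t"
  shows "k * (comp_count V N' A - 1) + sum missing S \<le>
    card (free_edges \<phi> - A) + (\<Sum>t\<in>S. card (A \<inter> reservable t))"
proof (cases "S = {}")
  case True
  have "k * (comp_count V N' A - 1) \<le> forest_bound (comp_count V N' A)" unfolding forest_bound_def by simp
  also have "\<dots> \<le> card (free_edges \<phi> - A)" using trimmed_connected A unfolding partition_connected_def by blast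
  finally show ?thesis using True by simp
next
  case False
  let ?pairs = "\<lambda>t. card {l \<in> root_pairs. t \<in> nbs l}"
  have "finite S" using S finite_subset by fastforce
  have V: "finite V" "V \<noteq> {}" using two_terminals by (simp, metis card.empty not_numeral_le_zero)
  have "(\<Sum>t\<in>S. card (reservable t - A)) + forest_bound (max 1 (comp_count V N' A + 1 - card S)) \<le>
      2 * card (free_edges \<phi> - A)"
  proof (rule partition_connected_incidence_bound[OF V(1) _ _ trimmed_connected _ S False A])
    show "mono forest_bound" by (rule convex_increasing_mono[OF convex_increasing_forest_bound])
  qed (use trimmed N'_subset in \<open>auto simp: reservable_def\<close>)
  moreover have "2 * (k * (comp_count V N' A - 1)) + (\<Sum>t\<in>S. ?pairs t) \<le>
      (4 * k + 5) * card S + forest_bound (max 1 (comp_count V N' A + 1 - card S))"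
  proof (rule forest_bound_slack)
    show "1 \<le> card S" using False \<open>finite S\<close> by (simp add: Suc_leI card_gt_0_iff)
    show "1 \<le> comp_count V N' A" by (rule card_classes_pos[OF V])
  qed (use root_pairs_at_sum_le[OF S pos] in blast)+
  moreover have "(\<Sum>t\<in>S. 2 * missing t + (4 * k + 5)) \<le> (\<Sum>t\<in>S. card (reservable t) + ?pairs t)"
    using missing_bound pos S by (intro sum_mono) blast
  then have "2 * sum missing S + (4 * k + 5) * card S \<le> (\<Sum>t\<in>S. card (reservable t)) + (\<Sum>t\<in>S. ?pairs t)"
    by (simp add: sum.distrib sum_distrib_left mult.commute)
  moreover have "card (reservable t) = card (reservable t - A) + card (A \<inter> reservable t)" for t
    using card_Int_Diff[of "reservable t" A] by (simp add: Int_commute)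
  then have "(\<Sum>t\<in>S. card (reservable t)) = (\<Sum>t\<in>S. card (reservable t - A)) + (\<Sum>t\<in>S. card (A \<inter> reservable t))"
    by (simp add: sum.distrib)
  ultimately show ?thesis by linarith
qed

definition trace :: "'l \<Rightarrow> 'v set" where
  "trace l = (if l \<in> free_edges \<phi> then N' l else if l \<in> used_triples \<phi> then {v, route l} else verts l)"

lemma root_notin_N': "l \<in> free_edges \<phi> \<Longrightarrow> v \<notin> N' l"
  using N'_subset by blast

lemma root_pair_verts: "l \<in> root_pairs \<Longrightarrow> v \<in> verts l \<and> card (verts l) = 2"
  using card_verts[of l] unfolding root_pairs_def incident_def nbs_def by (auto simp: card_Diff_singleton_if)

lemma trace_pair:
  assumes "l \<in> L"
  shows "trace l \<subseteq> verts l" "card (trace l) = 2"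
proof -
  consider (free) "l \<in> free_edges \<phi>" | (used) "l \<in> used_triples \<phi>" "l \<notin> free_edges \<phi>"
    | (pair) "l \<in> root_pairs" "l \<notin> free_edges \<phi>" "l \<notin> used_triples \<phi>"
    using assms L_eq_free_used[of \<phi>] by blast
  then have "trace l \<subseteq> verts l \<and> card (trace l) = 2"
  proof cases
    case free
    then show ?thesis using trimmed[OF free] unfolding trace_def nbs_def by auto
  next
    case used
    then have "v \<in> verts l" unfolding used_triples_def root_triples_def incident_def by blast
    then show ?thesis using used route[OF used(1)] unfolding trace_def nbs_def by auto
  next
    case pair
    then show ?thesis using root_pair_verts unfolding trace_def by simp
  qed
  then show "trace l \<subseteq> verts l" "card (trace l) = 2" by blast+
qed

lemma colour_at_root:
  assumes "l \<in> incident v"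
  shows "colour_at trace (\<lambda>l. if l \<in> free_edges \<phi> then c l else \<phi> l) l v = \<phi> l"
proof (cases "l \<in> free_edges \<phi>")
  case True
  then have "\<phi> l = 0" using assms L_eq(2) unfolding free_edges_def free_triples_def by blast
  then show ?thesis using True root_notin_N' unfolding colour_at_def trace_def by simp
next
  case False
  then have "v \<in> trace l" using assms unfolding trace_def incident_def by simp
  then show ?thesis using False unfolding colour_at_def by simp
qed

lemma extension_if_packing:
  assumes c: "\<And>l. c l \<le> k"
    and trees: "\<And>i s t. i \<in> {1..k} \<Longrightarrow> s \<in> V \<Longrightarrow> t \<in> V \<Longrightarrow> equivclp (hyperadj N' {l \<in> free_edges \<phi>. c l = i}) s t"
    and reserved: "\<And>t. t \<in> V \<Longrightarrow> missing t \<le> card {l \<in> reservable t. c l = 0}"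
  shows "extension good r \<phi> trace (\<lambda>l. if l \<in> free_edges \<phi> then c l else \<phi> l)" (is "extension _ _ _ _ ?c")
  unfolding extension_def
proof (intro conjI ballI)
  fix i s t assume "i \<in> {1..k}" "s \<in> V" "t \<in> V"
  then have "equivclp (hyperadj N' {l \<in> free_edges \<phi>. c l = i}) s t" by (rule trees)
  then show "equivclp (hyperadj trace {l \<in> L. ?c l = i \<and> v \<notin> trace l}) s t"
  proof (rule equivclp_mono)
    fix x y assume "hyperadj N' {l \<in> free_edges \<phi>. c l = i} x y"
    then obtain l where l: "l \<in> free_edges \<phi>" "c l = i" "x \<in> N' l" "y \<in> N' l" unfolding hyperadj_def by blast
    then have "l \<in> {l \<in> L. ?c l = i \<and> v \<notin> trace l}" "trace l = N' l"
      using root_notin_N'[OF l(1)] L_eq_free_used[of \<phi>] unfolding trace_def by auto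
    then show "hyperadj trace {l \<in> L. ?c l = i \<and> v \<notin> trace l} x y"
      using l(3,4) unfolding hyperadj_def by blast
  qed
next
  fix t assume t: "t \<in> V"
  let ?reserved = "{l \<in> reservable t. c l = 0}"
  have "r t \<le> card (released t) + card ?reserved" using reserved[OF t] unfolding missing_def by linarith
  also have "\<dots> = card (released t \<union> ?reserved)"
    using free_used_disjoint[of \<phi>]
    by (intro card_Un_disjoint[symmetric]) (auto simp: released_def reservable_def)
  also have "\<dots> \<le> card {l \<in> incident t \<inter> good t. colour_at trace ?c l t = 0}"
  proof (rule card_mono)
    have "l \<in> incident t \<inter> good t \<and> colour_at trace ?c l t = 0" if l: "l \<in> ?reserved" for l
      using l trimmed[of l] L_eq_free_used[of \<phi>]
      unfolding reservable_def incident_def nbs_def colour_at_def by auto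
    moreover have "l \<in> incident t \<inter> good t \<and> colour_at trace ?c l t = 0" if l: "l \<in> released t" for l
      using l t free_used_disjoint[of \<phi>] unfolding released_def colour_at_def trace_def by auto
    ultimately show "released t \<union> ?reserved \<subseteq> {l \<in> incident t \<inter> good t. colour_at trace ?c l t = 0}" by blast
  qed simp
  finally show "r t \<le> card {l \<in> incident t \<inter> good t. colour_at trace ?c l t = 0}" .
qed (use c precolour_le trace_pair colour_at_root in auto)

lemma extension_exists_if_trimmed: "\<exists>P c. extension good r \<phi> P c"
proof -
  have V: "finite V" "V \<noteq> {}" using two_terminals by (simp, metis card.empty not_numeral_le_zero)
  obtain c :: "'l \<Rightarrow> nat" where "\<And>l. c l \<le> k"
    "\<And>i s t. i \<in> {1..k} \<Longrightarrow> s \<in> V \<Longrightarrow> t \<in> V \<Longrightarrow> equivclp (hyperadj N' {l \<in> free_edges \<phi>. c l = i}) s t"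
    "\<And>t. t \<in> V \<Longrightarrow> missing t \<le> card {l \<in> reservable t. c l = 0}"
  proof (rule reserved_tree_packing[OF V finite_free_edges(1), where k = k and D = missing])
    show "N' l \<subseteq> V" if "l \<in> free_edges \<phi>" for l by (rule N'_subset[OF that])
    show "reservable t \<subseteq> free_edges \<phi>" for t unfolding reservable_def by blast
    show "k * (comp_count V N' A - 1) + sum missing S \<le>
        card (free_edges \<phi> - A) + (\<Sum>t\<in>S. card (A \<inter> reservable t))"
      if "A \<subseteq> free_edges \<phi>" "S \<subseteq> V" "\<And>t. t \<in> S \<Longrightarrow> 0 < missing t" for A S
      by (rule missing_packing_bound[OF that])
  qed blast
  from extension_if_packing[OF this] show ?thesis by blast
qed

end

context rooted_hypergraph
begin

lemma extension_exists:
  assumes \<phi>: "\<And>l. \<phi> l \<le> k" and two: "2 \<le> card V"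
    and root_free: "\<And>Y. weak Y \<Longrightarrow> k \<le> inner_cut Y + card {l \<in> free_triples \<phi>. splits Y (nbs l)}"
    and demand: "\<And>t. t \<in> V \<Longrightarrow> admissible k (incident t) (good t) (r t)"
  shows "\<exists>P c. extension good r \<phi> P c"
proof -
  have V: "finite V" "V \<noteq> {}" using two by (simp, metis card.empty not_numeral_le_zero)
  have "nbs l \<subseteq> V \<and> card (nbs l) \<in> {2, 3}" if "l \<in> free_edges \<phi>" for l
    using that nbs_subset[of l] card_nbs_free L_eq_free_used by blast
  moreover have "partition_connected forest_bound V (free_edges \<phi>) nbs"
    by (rule free_edges_partition_connected[OF root_free V(2)])
  ultimately obtain N' where N': "\<And>l. l \<in> free_edges \<phi> \<Longrightarrow> N' l \<subseteq> nbs l \<and> card (N' l) = 2"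
    and connected: "partition_connected forest_bound V (free_edges \<phi>) N'"
    by (rule partition_connected_trim[OF V(1) finite_free_edges(1) convex_increasing_forest_bound, where N = nbs])
      auto
  have "card (nbs l) = 2" if "l \<in> used_triples \<phi>" for l
    using that unfolding used_triples_def root_triples_def by blast
  from balanced_choice_exists[OF finite_free_edges(2), of \<phi> nbs good, OF this]
  obtain route where "\<forall>l\<in>used_triples \<phi>. route l \<in> nbs l"
    "\<forall>t. card {l \<in> used_triples \<phi>. l \<in> good t \<and> route l = t} \<le>
      card {l \<in> used_triples \<phi>. l \<in> good t \<and> t \<in> nbs l \<and> route l \<noteq> t} + 1"
    by blast
  then interpret trimmed_hypergraph L verts T v k \<phi> good r N' route
    using \<phi> two demand N' connected by unfold_locales blast+
  show ?thesis by (rule extension_exists_if_trimmed)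
qed

lemma extends_precolourings_single:
  assumes V: "V = {s}" and demand: "admissible k (incident s) (good s) (r s)"
  shows "extends_precolourings k (incident v) (\<lambda>\<phi>. \<exists>P c. extension good r \<phi> P c)"
proof -
  have T: "T = {v, s}" "s \<noteq> v" using V root by auto
  have verts: "verts l = {v, s}" if "l \<in> L" for l
    using verts_subset[OF that] card_verts[OF that] card_mono[of "{v, s}" "verts l"]
      card_subset_eq[of "{v, s}" "verts l"] T
    by auto
  then have "incident s = incident v" unfolding incident_def by auto
  then have "admissible k (incident v) (good s) (r s)" using demand by simp
  then show ?thesis
  proof (rule extends_precolouringsI)
    fix \<phi> :: "'l \<Rightarrow> nat" assume \<phi>: "\<And>e. \<phi> e \<le> k" "r s \<le> card {e \<in> incident v \<inter> good s. \<phi> e = 0}"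
    have "extension good r \<phi> verts \<phi>"
      unfolding extension_def V
    proof (intro conjI ballI)
      show "colour_at verts \<phi> l v = \<phi> l" if "l \<in> incident v" for l
        using that unfolding colour_at_def incident_def by simp
      have "{l \<in> incident s \<inter> good s. colour_at verts \<phi> l s = 0} = {e \<in> incident v \<inter> good s. \<phi> e = 0}"
        using \<open>incident s = incident v\<close> unfolding colour_at_def incident_def by auto
      then show "r t \<le> card {l \<in> incident t \<inter> good t. colour_at verts \<phi> l t = 0}" if "t \<in> {s}" for t
        using that \<phi>(2) by simp
    qed (use verts T \<phi>(1) in auto)
    then show "\<exists>P c. extension good r \<phi> P c" by blast
  qed
qed

lemma admissible_weak:
  assumes "weak Y"
  shows "admissible k (incident v) {l \<in> root_triples. splits Y (nbs l)} (k - inner_cut Y)"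
proof -
  let ?G = "{l \<in> root_triples. splits Y (nbs l)}"
  have "card (incident v - ?G) = card (incident v) - card ?G"
    by (rule card_Diff_subset) (auto simp: root_triples_def)
  then show ?thesis
    using bipartition_bound[of Y] assms card_incident_root unfolding admissible_def weak_def by auto
qed

theorem hypergraph_extends_precolourings:
  assumes V: "V \<noteq> {}" and demand: "\<And>t. t \<in> V \<Longrightarrow> admissible k (incident t) (good t) (r t)"
  shows "extends_precolourings k (incident v) (\<lambda>\<phi>. \<exists>P c. extension good r \<phi> P c)"
proof -
  have "card V \<noteq> 0" using V by simp
  then consider (single) "card V = 1" | (no_weak) "2 \<le> card V" "\<nexists>Y. weak Y"
    | (weak) Y where "2 \<le> card V" "weak Y"
    by (metis One_nat_def Suc_leI le_neq_implies_less not_gr_zero numeral_2_eq_2)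
  then show ?thesis
  proof cases
    case single
    then obtain s where "V = {s}" by (auto simp: card_1_singleton_iff)
    then show ?thesis using demand by (intro extends_precolourings_single) auto
  next
    case no_weak
    have "admissible k (incident v) UNIV 0" unfolding admissible_def by simp
    then show ?thesis
      by (rule extends_precolouringsI) (use no_weak extension_exists[OF _ _ _ demand] in blast)
  next
    case weak
    show ?thesis
    proof (rule extends_precolouringsI[OF admissible_weak[OF weak(2)]])
      fix \<phi> :: "'l \<Rightarrow> nat" assume \<phi>: "\<And>l. \<phi> l \<le> k"
        and n: "k - inner_cut Y \<le> card {e \<in> incident v \<inter> {l \<in> root_triples. splits Y (nbs l)}. \<phi> e = 0}"
      show "\<exists>P c. extension good r \<phi> P c"
      proof (rule extension_exists[OF \<phi> weak(1) _ demand])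
        fix Z assume "weak Z"
        have same: "splits Z (nbs l) \<longleftrightarrow> splits Y (nbs l)" if "l \<in> L" for l
          using weak_unique[OF weak(2) \<open>weak Z\<close>] nbs_subset[OF that] unfolding splits_def by blast
        have "{e \<in> incident v \<inter> {l \<in> root_triples. splits Y (nbs l)}. \<phi> e = 0} =
            {l \<in> free_triples \<phi>. splits Z (nbs l)}"
          using same unfolding free_triples_def root_triples_def incident_def by auto
        moreover have "inner_cut Z = inner_cut Y"
          using same unfolding inner_cut_def inner_edges_def by (metis (lifting) Diff_iff)
        ultimately show "k \<le> inner_cut Z + card {l \<in> free_triples \<phi>. splits Z (nbs l)}" using n by simp
      qed
    qed
  qed
qed

end

section \<open>Edge cuts and splittable pairs\<close>

text \<open>From here on a graph is given by its edge set \<open>E\<close> and the map \<open>g\<close> sending the half-edge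
  \<open>(e, b)\<close> to its vertex.\<close>

definition cut_edges :: "'e set \<Rightarrow> ('e \<times> bool \<Rightarrow> 'v) \<Rightarrow> 'v set \<Rightarrow> 'e set" where
  "cut_edges E g X = {e \<in> E. (g (e, False) \<in> X) \<noteq> (g (e, True) \<in> X)}"

definition between :: "'e set \<Rightarrow> ('e \<times> bool \<Rightarrow> 'v) \<Rightarrow> 'v set \<Rightarrow> 'v set \<Rightarrow> 'e set" where
  "between E g A B = {e \<in> E. g (e, False) \<in> A \<and> g (e, True) \<in> B \<or> g (e, False) \<in> B \<and> g (e, True) \<in> A}"

definition vertex_set :: "'e set \<Rightarrow> ('e \<times> bool \<Rightarrow> 'v) \<Rightarrow> 'v set \<Rightarrow> 'v set" where
  "vertex_set E g T = T \<union> g ` (E \<times> UNIV)"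

definition opposite :: "('e \<times> bool \<Rightarrow> 'v) \<Rightarrow> 'v \<Rightarrow> 'e \<Rightarrow> 'v" where
  "opposite g w e = (if g (e, False) = w then g (e, True) else g (e, False))"

lemma finite_cut [simp]: "finite E \<Longrightarrow> finite (cut_edges E g X)"
  unfolding cut_edges_def by simp

lemma finite_between [simp]: "finite E \<Longrightarrow> finite (between E g A B)"
  unfolding between_def by simp

lemma between_mono: "A \<subseteq> A' \<Longrightarrow> B \<subseteq> B' \<Longrightarrow> between E g A B \<subseteq> between E g A' B'"
  unfolding between_def by blast

lemma cut_empty [simp]: "cut_edges E g {} = {}"
  unfolding cut_edges_def by simp

lemma cut_Compl [simp]: "cut_edges E g (- X) = cut_edges E g X"
  unfolding cut_edges_def by auto

lemma card_Collect_eq_sum: "finite E \<Longrightarrow> card {e \<in> E. P e} = (\<Sum>e\<in>E. if P e then 1 else 0)"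
  by (simp add: sum.If_cases Int_def)

lemma card_cut_Int_Un:
  assumes "finite E"
  shows "card (cut_edges E g X) + card (cut_edges E g Y) =
    card (cut_edges E g (X \<inter> Y)) + card (cut_edges E g (X \<union> Y)) + 2 * card (between E g (X - Y) (Y - X))"
  unfolding cut_edges_def between_def card_Collect_eq_sum[OF assms] sum_distrib_left sum.distrib[symmetric]
  by (intro sum.cong refl) auto

lemma card_cut_Diff:
  assumes "finite E"
  shows "card (cut_edges E g X) + card (cut_edges E g Y) =
    card (cut_edges E g (X - Y)) + card (cut_edges E g (Y - X)) + 2 * card (between E g (X \<inter> Y) (- (X \<union> Y)))"
  unfolding cut_edges_def between_def card_Collect_eq_sum[OF assms] sum_distrib_left sum.distrib[symmetric]
  by (intro sum.cong refl) auto

lemma card_cut_insert: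
  assumes "finite E" "w \<notin> X"
  shows "card (cut_edges E g X) + card (cut_edges E g {w}) =
    card (cut_edges E g (insert w X)) + 2 * card (between E g X {w})"
proof -
  have "X - {w} = X" "{w} - X = {w}" "X \<inter> {w} = {}" "X \<union> {w} = insert w X" using assms(2) by auto
  then show ?thesis using card_cut_Int_Un[OF assms(1), of g X "{w}"] by simp
qed

lemma finite_vertex_set: "finite E \<Longrightarrow> finite T \<Longrightarrow> finite (vertex_set E g T)"
  unfolding vertex_set_def by simp

lemma half_edge_in_vertex_set: "fst h \<in> E \<Longrightarrow> g h \<in> vertex_set E g T"
  unfolding vertex_set_def by (cases h) auto

lemma terminals_subset_vertex_set: "T \<subseteq> vertex_set E g T"
  unfolding vertex_set_def by blast

lemma cut_Int_vertex_set: "cut_edges E g (X \<inter> vertex_set E g T) = cut_edges E g X"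
  unfolding cut_edges_def using half_edge_in_vertex_set[of "(_, _)" E g T] by auto

lemma in_vertex_set_if_incident: "e \<in> cut_edges E g {w} \<Longrightarrow> w \<in> vertex_set E g T"
  using half_edge_in_vertex_set[of "(e, False)" E g T] half_edge_in_vertex_set[of "(e, True)" E g T]
  unfolding cut_edges_def by auto

locale reduced_graph =
  fixes E :: "'e set" and g :: "'e \<times> bool \<Rightarrow> 'v" and T :: "'v set" and K :: nat
  assumes finite_edges: "finite E" and finite_terminals: "finite T" and K_ge_3: "3 \<le> K"
    and cut_ge: "\<And>X. X \<inter> T \<noteq> {} \<Longrightarrow> T - X \<noteq> {} \<Longrightarrow> K \<le> card (cut_edges E g X)"
    and tight_trivial: "\<And>X. X \<inter> T \<noteq> {} \<Longrightarrow> T - X \<noteq> {} \<Longrightarrow> X \<subseteq> vertex_set E g T \<Longrightarrow> card (cut_edges E g X) = K \<Longrightarrow>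
      (\<exists>t. X = {t}) \<or> (\<exists>t. vertex_set E g T - X = {t})"
    and tight_cover: "\<And>e. e \<in> E \<Longrightarrow> \<exists>t\<in>T. card (cut_edges E g {t}) = K \<and> e \<in> cut_edges E g {t}"
begin

abbreviation VV :: "'v set" where "VV \<equiv> vertex_set E g T"

abbreviation opp :: "'v \<Rightarrow> 'e \<Rightarrow> 'v" where "opp \<equiv> opposite g"

lemma opposite_cases:
  assumes "e \<in> cut_edges E g {w}"
  shows "g (e, False) = w \<and> g (e, True) = opp w e \<or> g (e, True) = w \<and> g (e, False) = opp w e"
  using assms unfolding cut_edges_def opposite_def by auto

lemma opposite_tight_terminal:
  assumes "w \<notin> T" "e \<in> cut_edges E g {w}"
  shows "opp w e \<in> T" "card (cut_edges E g {opp w e}) = K"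
proof -
  have "e \<in> E" using assms(2) unfolding cut_edges_def by simp
  then obtain t where t: "t \<in> T" "card (cut_edges E g {t}) = K" "e \<in> cut_edges E g {t}"
    using tight_cover by blast
  have "opp w e = t" using t assms unfolding cut_edges_def opposite_def by auto
  then show "opp w e \<in> T" "card (cut_edges E g {opp w e}) = K" using t by auto
qed

lemma in_between_opposite:
  assumes "w \<notin> X" "e \<in> cut_edges E g {w}"
  shows "e \<in> between E g X {w} \<longleftrightarrow> opp w e \<in> X"
  using opposite_cases[OF assms(2)] assms unfolding between_def cut_edges_def by auto

lemma between_singleton_eq:
  assumes "w \<notin> X"
  shows "between E g X {w} = {e \<in> cut_edges E g {w}. opp w e \<in> X}"
proof -
  have "between E g X {w} \<subseteq> cut_edges E g {w}" using assms unfolding between_def cut_edges_def by auto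
  then show ?thesis using in_between_opposite[OF assms] by blast
qed

definition dangerous :: "'v \<Rightarrow> 'v set \<Rightarrow> bool" where
  "dangerous w X \<longleftrightarrow>
     X \<subseteq> VV \<and> w \<notin> X \<and> X \<inter> T \<noteq> {} \<and> T - X \<noteq> {} \<and> card (cut_edges E g X) \<le> K + 1"

definition maximal_dangerous :: "'v \<Rightarrow> 'v set \<Rightarrow> bool" where
  "maximal_dangerous w X \<longleftrightarrow> dangerous w X \<and> (\<forall>Y. dangerous w Y \<longrightarrow> X \<subseteq> Y \<longrightarrow> Y = X)"

lemma dangerous_subset_maximal:
  assumes "dangerous w X"
  obtains Y where "maximal_dangerous w Y" "X \<subseteq> Y"
proof -
  have "finite {Y. dangerous w Y}"
    by (rule finite_subset[of _ "Pow VV"])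
      (use finite_vertex_set[OF finite_edges finite_terminals] in \<open>auto simp: dangerous_def\<close>)
  then obtain Y where "dangerous w Y" "X \<subseteq> Y" "\<And>Z. dangerous w Z \<Longrightarrow> Y \<subseteq> Z \<Longrightarrow> Y = Z"
    using finite_has_maximal2[of "{Y. dangerous w Y}" X] assms by auto
  then show thesis using that unfolding maximal_dangerous_def by metis
qed

lemma dangerous_degree_share:
  assumes w: "w \<notin> T" and X: "dangerous w X"
  shows "2 * card {e \<in> cut_edges E g {w}. opp w e \<in> X} \<le> card (cut_edges E g {w}) + 1"
proof -
  have wX: "w \<notin> X" using X unfolding dangerous_def by simp
  have "K \<le> card (cut_edges E g (insert w X))" using X w unfolding dangerous_def by (intro cut_ge) auto
  then show ?thesis
    using card_cut_insert[OF finite_edges wX, of g] between_singleton_eq[OF wX] X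
    unfolding dangerous_def by simp
qed

lemma in_between_Int_Compl:
  assumes "e \<in> cut_edges E g {w}" "opp w e \<in> A" "w \<in> B"
  shows "e \<in> between E g A B"
  using opposite_cases[OF assms(1)] assms unfolding between_def cut_edges_def by auto

lemma maximal_dangerous_crossing:
  assumes w: "w \<notin> T" and X: "maximal_dangerous w X" and Y: "maximal_dangerous w Y"
    and e: "e \<in> cut_edges E g {w}" "opp w e \<in> X \<inter> Y"
    and crossing: "(X - Y) \<inter> T \<noteq> {}" "(Y - X) \<inter> T \<noteq> {}"
  shows "is_singleton (X - Y)" "is_singleton (Y - X)" "between E g (X \<inter> Y) (- (X \<union> Y)) = {e}"
    "card (cut_edges E g X) = K + 1"
proof -
  have dangerous: "dangerous w X" "dangerous w Y" using X Y unfolding maximal_dangerous_def by auto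
  then have XY: "X \<subseteq> VV" "Y \<subseteq> VV" "w \<notin> X" "w \<notin> Y" unfolding dangerous_def by auto
  note opp_T = opposite_tight_terminal(1)[OF w e(1)]
  have cuts: "K \<le> card (cut_edges E g (X - Y))" "K \<le> card (cut_edges E g (Y - X))"
    using crossing opp_T e(2) by (intro cut_ge; auto)+
  have e_between: "e \<in> between E g (X \<inter> Y) (- (X \<union> Y))"
    using in_between_Int_Compl[OF e(1,2)] XY by simp
  then have "card (between E g (X \<inter> Y) (- (X \<union> Y))) \<noteq> 0" using finite_edges by auto
  then have tight: "card (cut_edges E g X) = K + 1"
      "card (cut_edges E g (X - Y)) = K" "card (cut_edges E g (Y - X)) = K"
    "card (between E g (X \<inter> Y) (- (X \<union> Y))) = 1"
    using card_cut_Diff[OF finite_edges, of g X Y] dangerous cuts unfolding dangerous_def by linarith+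
  then show "card (cut_edges E g X) = K + 1" "between E g (X \<inter> Y) (- (X \<union> Y)) = {e}"
    using e_between by (auto simp: card_1_singleton_iff)
  have "w \<in> VV" by (rule in_vertex_set_if_incident[OF e(1)])
  moreover have "opp w e \<in> VV" "opp w e \<noteq> w" using opp_T terminals_subset_vertex_set[of T E g] w by auto
  ultimately have "\<not> (\<exists>t. VV - (X - Y) = {t})" "\<not> (\<exists>t. VV - (Y - X) = {t})"
    using XY e(2) by (metis Diff_iff IntD1 IntD2 singletonD)+
  moreover have "T - (X - Y) \<noteq> {}" "T - (Y - X) \<noteq> {}" "X - Y \<subseteq> VV" "Y - X \<subseteq> VV"
    using opp_T e(2) XY by auto
  ultimately show "is_singleton (X - Y)" "is_singleton (Y - X)"
    using tight_trivial[OF crossing(1) _ _ tight(2)] tight_trivial[OF crossing(2) _ _ tight(3)]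
    unfolding is_singleton_def by metis+
qed

lemma maximal_dangerous_meeting:
  assumes w: "w \<notin> T" and X: "maximal_dangerous w X" and Y: "maximal_dangerous w Y" and "X \<noteq> Y"
    and e: "e \<in> cut_edges E g {w}" "opp w e \<in> X \<inter> Y"
    and not_crossing: "(X - Y) \<inter> T = {} \<or> (Y - X) \<inter> T = {}"
  shows "X \<inter> Y = {opp w e}" "between E g (X - Y) (Y - X) = {}"
proof -
  have dangerous: "dangerous w X" "dangerous w Y" using X Y unfolding maximal_dangerous_def by auto
  then have XY: "X \<subseteq> VV" "Y \<subseteq> VV" "w \<notin> X" "w \<notin> Y" unfolding dangerous_def by auto
  note opp_T = opposite_tight_terminal(1)[OF w e(1)]
  obtain u where u: "u \<in> T" "u \<notin> X \<union> Y" using not_crossing dangerous unfolding dangerous_def by blast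
  have "K \<le> card (cut_edges E g (X \<inter> Y))" using opp_T e(2) u by (intro cut_ge) auto
  moreover have "\<not> dangerous w (X \<union> Y)" using X Y \<open>X \<noteq> Y\<close> unfolding maximal_dangerous_def by blast
  then have "K + 2 \<le> card (cut_edges E g (X \<union> Y))" using XY u dangerous unfolding dangerous_def by auto
  ultimately have tight: "card (cut_edges E g (X \<inter> Y)) = K" "card (between E g (X - Y) (Y - X)) = 0"
    using card_cut_Int_Un[OF finite_edges, of g X Y] dangerous unfolding dangerous_def by linarith+
  then show "between E g (X - Y) (Y - X) = {}" using finite_edges by simp
  have "w \<in> VV" by (rule in_vertex_set_if_incident[OF e(1)])
  moreover have "u \<in> VV" "u \<noteq> w" using u(1) terminals_subset_vertex_set[of T E g] w by auto
  ultimately have "\<not> (\<exists>t. VV - (X \<inter> Y) = {t})" using u(2) XY by (metis Diff_iff IntD1 UnCI singletonD)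
  moreover have "(X \<inter> Y) \<inter> T \<noteq> {}" "T - (X \<inter> Y) \<noteq> {}" "X \<inter> Y \<subseteq> VV" using opp_T e(2) u XY by auto
  ultimately have "\<exists>t. X \<inter> Y = {t}" using tight_trivial[OF _ _ _ tight(1)] by blast
  then show "X \<inter> Y = {opp w e}" using e(2) by (metis singletonD)
qed

lemma maximal_dangerous_two_common_edges:
  assumes w: "w \<notin> T" and X: "maximal_dangerous w X" and Y: "maximal_dangerous w Y" and "X \<noteq> Y"
    and e: "e \<in> cut_edges E g {w}" "opp w e \<in> X \<inter> Y"
    and f: "f \<in> cut_edges E g {w}" "opp w f \<in> X \<inter> Y" and "e \<noteq> f"
  shows "opp w e = opp w f" "X \<inter> Y = {opp w e}" "between E g (X - Y) (Y - X) = {}"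
proof -
  have "w \<notin> X \<union> Y" using X Y unfolding maximal_dangerous_def dangerous_def by auto
  then have "f \<in> between E g (X \<inter> Y) (- (X \<union> Y))"
    using in_between_Int_Compl[OF f(1,2)] by simp
  then have "(X - Y) \<inter> T = {} \<or> (Y - X) \<inter> T = {}"
    using maximal_dangerous_crossing(3)[OF w X Y e] \<open>e \<noteq> f\<close> by (metis singletonD)
  then show meet: "X \<inter> Y = {opp w e}" and "between E g (X - Y) (Y - X) = {}"
    using maximal_dangerous_meeting[OF w X Y \<open>X \<noteq> Y\<close> e] by simp_all
  then show "opp w e = opp w f" using f(2) by (metis singletonD)
qed

definition splittable :: "'v \<Rightarrow> 'e \<Rightarrow> 'e \<Rightarrow> bool" where
  "splittable w e f \<longleftrightarrow>
     (\<forall>X. w \<notin> X \<longrightarrow> T - X \<noteq> {} \<longrightarrow> opp w e \<in> X \<longrightarrow> opp w f \<in> X \<longrightarrow> K + 2 \<le> card (cut_edges E g X))"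

lemma obtain_maximal_dangerous:
  assumes w: "w \<notin> T" and ef: "e \<in> cut_edges E g {w}" "f \<in> cut_edges E g {w}" and "\<not> splittable w e f"
  obtains X where "maximal_dangerous w X" "opp w e \<in> X" "opp w f \<in> X"
proof -
  obtain X where X: "w \<notin> X" "T - X \<noteq> {}" "opp w e \<in> X" "opp w f \<in> X" "card (cut_edges E g X) < K + 2"
    using assms(4) unfolding splittable_def by (auto simp: not_le)
  have opp_T: "opp w e \<in> T" "opp w f \<in> T" using opposite_tight_terminal(1)[OF w] ef by blast+
  have T: "T \<subseteq> VV" by (rule terminals_subset_vertex_set)
  have "card (cut_edges E g (X \<inter> VV)) < K + 2" using X(5) by (simp add: cut_Int_vertex_set)
  then have "dangerous w (X \<inter> VV)" using X opp_T(1) T unfolding dangerous_def by auto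
  then obtain Y where Y: "maximal_dangerous w Y" "X \<inter> VV \<subseteq> Y" by (rule dangerous_subset_maximal)
  have "opp w e \<in> Y" "opp w f \<in> Y" using Y(2) X(3,4) opp_T T by auto
  then show thesis by (rule that[OF Y(1)])
qed

end

locale unsplittable_vertex = reduced_graph E g T K
  for E :: "'e set" and g :: "'e \<times> bool \<Rightarrow> 'v" and T :: "'v set" and K :: nat +
  fixes w :: 'v
  assumes w_notin_T: "w \<notin> T" and degree: "4 \<le> card (cut_edges E g {w})"
    and unsplittable: "\<And>e f. e \<in> cut_edges E g {w} \<Longrightarrow> f \<in> cut_edges E g {w} \<Longrightarrow> e \<noteq> f \<Longrightarrow> \<not> splittable w e f"
begin

abbreviation D :: "'e set" where "D \<equiv> cut_edges E g {w}"

lemma obtain_common_maximal_dangerous: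
  assumes "e \<in> D" "f \<in> D" "e \<noteq> f"
  obtains X where "maximal_dangerous w X" "opp w e \<in> X" "opp w f \<in> X"
  using obtain_maximal_dangerous[OF w_notin_T assms(1,2) unsplittable[OF assms]] by blast

lemma maximal_dangerous_degree_share:
  assumes "maximal_dangerous w X"
  shows "2 * card {e \<in> D. opp w e \<in> X} \<le> card D + 1"
  using dangerous_degree_share[OF w_notin_T] assms unfolding maximal_dangerous_def by blast

lemma obtain_outside:
  assumes "maximal_dangerous w X"
  obtains f where "f \<in> D" "opp w f \<notin> X"
proof -
  have "{e \<in> D. opp w e \<in> X} \<noteq> D" using maximal_dangerous_degree_share[OF assms] degree by auto
  then show thesis using that by blast
qed

end

text \<open>If no pair at \<open>w\<close> is splittable, there are maximal dangerous sets \<open>X\<close> and \<open>Y\<close> that share the far end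
  of \<open>u\<close>. They cover all neighbours of \<open>w\<close>, so the degree bound makes the edge \<open>x\<close> to \<open>X - Y\<close> a double
  edge. The maximal dangerous set that contains the far ends of \<open>x\<close> and \<open>z\<close> then yields a contradiction.\<close>

locale crossing_dangerous_sets = unsplittable_vertex E g T K w
  for E :: "'e set" and g :: "'e \<times> bool \<Rightarrow> 'v" and T :: "'v set" and K :: nat and w :: 'v +
  fixes X Y :: "'v set" and u x z :: 'e
  assumes maximal: "maximal_dangerous w X" "maximal_dangerous w Y"
    and edges: "u \<in> D" "x \<in> D" "z \<in> D"
    and ends: "opp w u \<in> X \<inter> Y" "opp w x \<in> X - Y" "opp w z \<in> Y - X"
begin

lemma w_notin: "w \<notin> X" "w \<notin> Y"
  using maximal unfolding maximal_dangerous_def dangerous_def by auto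

lemma opp_in_T: "opp w u \<in> T" "opp w x \<in> T" "opp w z \<in> T"
  using opposite_tight_terminal(1)[OF w_notin_T] edges by blast+

lemma differences: "X - Y = {opp w x}" "Y - X = {opp w z}"
  and between_outside: "between E g (X \<inter> Y) (- (X \<union> Y)) = {u}"
  and card_cut_X: "card (cut_edges E g X) = K + 1"
proof -
  have crossing: "(X - Y) \<inter> T \<noteq> {}" "(Y - X) \<inter> T \<noteq> {}" using ends opp_in_T by blast+
  note crossing_sets = maximal_dangerous_crossing[OF w_notin_T maximal edges(1) ends(1) crossing]
  show "X - Y = {opp w x}" "Y - X = {opp w z}"
    using crossing_sets(1,2) ends(2,3) by (metis is_singletonE singletonD)+
  show "between E g (X \<inter> Y) (- (X \<union> Y)) = {u}" "card (cut_edges E g X) = K + 1"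
    using crossing_sets(3,4) by auto
qed

lemma XY_eq: "X = insert (opp w x) (X \<inter> Y)" "Y = insert (opp w z) (X \<inter> Y)"
  using differences by blast+

lemma obtain_edge_to_z:
  obtains f where "f \<in> between E g (X \<inter> Y) {opp w z}"
proof -
  let ?I = "X \<inter> Y"
  have "between E g ?I {opp w z} \<noteq> {}"
  proof
    assume none: "between E g ?I {opp w z} = {}"
    have "- ?I = {opp w x} \<union> {opp w z} \<union> - (X \<union> Y)" using differences by blast
    then have "between E g ?I (- ?I) =
        between E g ?I {opp w x} \<union> between E g ?I {opp w z} \<union> between E g ?I (- (X \<union> Y))"
      unfolding between_def by auto
    moreover have "cut_edges E g ?I = between E g ?I (- ?I)" unfolding between_def cut_edges_def by auto
    ultimately have "cut_edges E g ?I = insert u (between E g ?I {opp w x})"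
      using none between_outside by simp
    then have "card (cut_edges E g ?I) \<le> Suc (card (between E g ?I {opp w x}))"
      using finite_edges by (simp add: card_insert_if)
    moreover have "K \<le> card (cut_edges E g ?I)" using ends opp_in_T by (intro cut_ge) auto
    moreover have "opp w x \<notin> ?I" using ends by simp
    from card_cut_insert[OF finite_edges this, of g]
    have "card (cut_edges E g ?I) + card (cut_edges E g {opp w x}) =
        card (cut_edges E g X) + 2 * card (between E g ?I {opp w x})"
      using XY_eq(1) by simp
    ultimately show False
      using card_cut_X opposite_tight_terminal(2)[OF w_notin_T edges(2)] K_ge_3 by simp
  qed
  then show thesis using that by blast
qed

lemma no_common_edge:
  assumes Z: "maximal_dangerous w Z" "Z \<noteq> V" and V: "V \<in> {X, Y}" "maximal_dangerous w V"
    and e: "e \<in> D" "opp w e \<in> V" "opp w e \<noteq> opp w u" "opp w u \<in> Z"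
  shows "opp w e \<notin> Z"
proof
  assume "opp w e \<in> Z"
  moreover have "opp w u \<in> V" using V(1) ends(1) by blast
  ultimately show False
    using maximal_dangerous_two_common_edges(1)[OF w_notin_T Z(1) V(2) Z(2) edges(1) _ e(1)] e by auto
qed

lemma opposite_in_union:
  assumes y: "y \<in> D"
  shows "opp w y \<in> X \<union> Y"
proof (rule ccontr)
  assume y_out: "opp w y \<notin> X \<union> Y"
  then have "u \<noteq> y" using ends by blast
  then obtain Z where Z: "maximal_dangerous w Z" "opp w u \<in> Z" "opp w y \<in> Z"
    by (rule obtain_common_maximal_dangerous[OF edges(1) y])
  have ne: "Z \<noteq> X" "Z \<noteq> Y" using Z y_out by auto
  have "opp w x \<noteq> opp w u" "opp w z \<noteq> opp w u" using ends by (metis DiffD2 IntD1 IntD2)+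
  then have xz_out: "opp w x \<notin> Z" "opp w z \<notin> Z"
    using no_common_edge[OF Z(1) ne(1) _ maximal(1) edges(2)]
      no_common_edge[OF Z(1) ne(2) _ maximal(2) edges(3)]
      ends Z(2) by auto
  interpret XZ: crossing_dangerous_sets E g T K w X Z u x y
    by unfold_locales (use maximal Z edges y ends xz_out y_out in auto)
  have "X \<inter> Z = X \<inter> Y" using XZ.differences(1) differences(1) by blast
  obtain f where f: "f \<in> between E g (X \<inter> Y) {opp w z}" by (rule obtain_edge_to_z)
  have "X \<inter> Y \<subseteq> X \<inter> Z" "{opp w z} \<subseteq> - (X \<union> Z)" using \<open>X \<inter> Z = X \<inter> Y\<close> xz_out(2) ends(3) by simp_all
  then have "f \<in> between E g (X \<inter> Z) (- (X \<union> Z))" by (rule subsetD[OF between_mono f])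
  then have "f = u" using XZ.between_outside by blast
  moreover have "f \<notin> cut_edges E g {w}"
    using f w_notin opp_in_T w_notin_T unfolding between_def cut_edges_def by auto
  ultimately show False using edges(1) by blast
qed

lemma unique_edge_to_inter:
  assumes "y \<in> D" "opp w y \<in> X \<inter> Y"
  shows "y = u"
  using in_between_Int_Compl[OF assms, of "- (X \<union> Y)"] w_notin between_outside by blast

lemma two_parallel_edges_to_x:
  obtains x' where "x' \<in> D" "x' \<noteq> x" "opp w x' = opp w x"
proof -
  let ?Dx = "{e \<in> D. opp w e = opp w x}" and ?Dz = "{e \<in> D. opp w e = opp w z}"
  have finite_D: "finite D" using finite_edges by simp
  have u_notin: "u \<notin> ?Dx" "u \<notin> ?Dz" "?Dx \<inter> ?Dz = {}" using ends by auto
  have parts: "{e \<in> D. opp w e \<in> X} = insert u ?Dx" "{e \<in> D. opp w e \<in> Y} = insert u ?Dz"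
    using unique_edge_to_inter edges(1) ends XY_eq by blast+
  have "D = insert u (?Dx \<union> ?Dz)" using opposite_in_union parts by blast
  then have "card D = card (insert u (?Dx \<union> ?Dz))" by (rule arg_cong)
  also have "\<dots> = Suc (card ?Dx + card ?Dz)"
    using u_notin finite_D by (simp add: card_Un_disjoint)
  finally have "card D = Suc (card ?Dx + card ?Dz)" .
  moreover have "2 * Suc (card ?Dx) \<le> card D + 1" "2 * Suc (card ?Dz) \<le> card D + 1"
    using maximal_dangerous_degree_share[OF maximal(1)] maximal_dangerous_degree_share[OF maximal(2)]
      u_notin finite_D unfolding parts by simp_all
  ultimately have "2 \<le> card ?Dx" using degree by presburger
  then have "\<not> ?Dx \<subseteq> {x}" using card_mono[of "{x}" ?Dx] by auto
  then show thesis using that by blast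
qed

lemma no_crossing_dangerous_sets: False
proof -
  obtain x' where x': "x' \<in> D" "x' \<noteq> x" "opp w x' = opp w x" by (rule two_parallel_edges_to_x)
  obtain f where f: "f \<in> between E g (X \<inter> Y) {opp w z}" by (rule obtain_edge_to_z)
  have "x \<noteq> z" using ends by auto
  then obtain Z where Z: "maximal_dangerous w Z" "opp w x \<in> Z" "opp w z \<in> Z"
    by (rule obtain_common_maximal_dangerous[OF edges(2,3)])
  have "X \<noteq> Z" using Z ends by blast
  moreover have "opp w x \<in> X \<inter> Z" "opp w x' \<in> X \<inter> Z" using Z ends x'(3) by auto
  ultimately have XZ: "X \<inter> Z = {opp w x}" "between E g (X - Z) (Z - X) = {}"
    using maximal_dangerous_two_common_edges(2,3)[OF w_notin_T maximal(1) Z(1) _ edges(2) _ x'(1)] x'(2)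
    by metis+
  have "X \<inter> Y \<subseteq> X - Z" "{opp w z} \<subseteq> Z - X" using XZ(1) differences(1) Z(3) ends(3) by blast+
  then have "f \<in> between E g (X - Z) (Z - X)" by (rule subsetD[OF between_mono f])
  then show False using XZ(2) by blast
qed

end

context unsplittable_vertex
begin

lemma no_unsplittable_vertex: False
proof -
  have "\<not> card D \<le> Suc 0" using degree by simp
  then obtain u u' where u: "u \<in> D" "u' \<in> D" "u \<noteq> u'"
    using card_le_Suc0_iff_eq[of D] finite_edges by auto
  obtain X\<^sub>0 where X0: "maximal_dangerous w X\<^sub>0" "opp w u \<in> X\<^sub>0"
    by (rule obtain_common_maximal_dangerous[OF u])
  obtain z where z: "z \<in> D" "opp w z \<notin> X\<^sub>0" by (rule obtain_outside[OF X0(1)])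
  have "u \<noteq> z" "opp w u \<noteq> opp w z" using X0(2) z(2) by metis+
  obtain Y where Y: "maximal_dangerous w Y" "opp w u \<in> Y" "opp w z \<in> Y"
    by (rule obtain_common_maximal_dangerous[OF u(1) z(1) \<open>u \<noteq> z\<close>])
  obtain x where x: "x \<in> D" "opp w x \<notin> Y" by (rule obtain_outside[OF Y(1)])
  have "u \<noteq> x" using x(2) Y(2) by metis
  obtain X where X: "maximal_dangerous w X" "opp w u \<in> X" "opp w x \<in> X"
    by (rule obtain_common_maximal_dangerous[OF u(1) x(1) \<open>u \<noteq> x\<close>])
  have "X \<noteq> Y" using X x by blast
  then have "opp w z \<notin> X"
    using maximal_dangerous_two_common_edges(1)[OF w_notin_T X(1) Y(1) _ u(1) _ z(1)] X Y
      \<open>u \<noteq> z\<close> \<open>opp w u \<noteq> opp w z\<close> by blast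
  then interpret crossing_dangerous_sets E g T K w X Y u x z
    by unfold_locales (use X Y u x z in auto)
  show False by (rule no_crossing_dangerous_sets)
qed

end

theorem (in reduced_graph) splittable_pair_exists:
  assumes "w \<notin> T" "4 \<le> card (cut_edges E g {w})"
  obtains e f where "e \<in> cut_edges E g {w}" "f \<in> cut_edges E g {w}" "e \<noteq> f" "splittable w e f"
proof (rule ccontr)
  assume "\<not> thesis"
  then interpret unsplittable_vertex E g T K w
    using that assms by unfold_locales blast+
  show False by (rule no_unsplittable_vertex)
qed

section \<open>Trails with a root\<close>

definition flip :: "'e \<times> bool \<Rightarrow> 'e \<times> bool" where
  "flip h = (fst h, \<not> snd h)"

lemma flip_simps [simp]: "fst (flip h) = fst h" "flip (flip h) = h" "flip h \<noteq> h" "h \<noteq> flip h"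
  unfolding flip_def by (auto simp: prod_eq_iff)

lemma eq_or_flip_if_same_edge: "fst h = fst h' \<Longrightarrow> h' = h \<or> h' = flip h"
  unfolding flip_def by (auto simp: prod_eq_iff)

lemma half_edge_in_cut_iff: "fst h \<in> cut_edges E g X \<longleftrightarrow> fst h \<in> E \<and> (g h \<in> X) \<noteq> (g (flip h) \<in> X)"
  unfolding cut_edges_def flip_def by (cases h; cases "snd h") auto


definition trail_step ::
    "'e set \<Rightarrow> ('e \<times> bool \<Rightarrow> 'v) \<Rightarrow> 'v set \<Rightarrow> 'v set \<Rightarrow> ('e \<times> bool \<Rightarrow> 'e \<times> bool) \<Rightarrow>
      'e \<times> bool \<Rightarrow> 'e \<times> bool \<Rightarrow> bool" where
  "trail_step F g T S m h h' \<longleftrightarrow> fst h \<in> F \<and> fst h' \<in> F \<and>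
     (h' = flip h \<or> g h \<notin> T \<and> h' = m h \<or> g h \<in> S \<and> g h' = g h)"

abbreviation linked ::
    "'e set \<Rightarrow> ('e \<times> bool \<Rightarrow> 'v) \<Rightarrow> 'v set \<Rightarrow> 'v set \<Rightarrow> ('e \<times> bool \<Rightarrow> 'e \<times> bool) \<Rightarrow>
      'e \<times> bool \<Rightarrow> 'e \<times> bool \<Rightarrow> bool" where
  "linked F g T S m \<equiv> equivclp (trail_step F g T S m)"

definition mating :: "'e set \<Rightarrow> ('e \<times> bool \<Rightarrow> 'v) \<Rightarrow> 'v set \<Rightarrow> ('e \<times> bool \<Rightarrow> 'e \<times> bool) \<Rightarrow> bool" where
  "mating F g T m \<longleftrightarrow>
     (\<forall>h. fst h \<in> F \<and> g h \<notin> T \<longrightarrow> fst (m h) \<in> F \<and> m h \<noteq> h \<and> m (m h) = h \<and> g (m h) = g h)"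

definition meets :: "'e set \<Rightarrow> ('e \<times> bool \<Rightarrow> 'v) \<Rightarrow> 'v \<Rightarrow> bool" where
  "meets F g t \<longleftrightarrow> (\<exists>h. fst h \<in> F \<and> g h = t)"

text \<open>Trails do not pass through the root \<open>v\<close>. The last conjunct lets \<open>F\<close> be empty if \<open>v\<close> is not met and
  only one terminal is to be connected.\<close>

definition rooted_connection ::
    "'e set \<Rightarrow> ('e \<times> bool \<Rightarrow> 'v) \<Rightarrow> 'v set \<Rightarrow> 'v \<Rightarrow> ('e \<times> bool \<Rightarrow> 'e \<times> bool) \<Rightarrow> bool" where
  "rooted_connection F g T v m \<longleftrightarrow> mating F g T m \<and>
     (\<forall>h h'. fst h \<in> F \<and> fst h' \<in> F \<and> g h \<in> T \<and> g h' \<in> T \<longrightarrow> linked F g T (T - {v}) m h h') \<and>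
     (\<forall>s\<in>T - {v}. T - {v} \<noteq> {s} \<or> meets F g v \<longrightarrow> meets F g s)"

definition routing ::
    "'e set \<Rightarrow> ('e \<times> bool \<Rightarrow> 'v) \<Rightarrow> 'v set \<Rightarrow> 'v \<Rightarrow> nat \<Rightarrow> ('e \<Rightarrow> nat) \<Rightarrow> ('e \<times> bool \<Rightarrow> 'e \<times> bool) \<Rightarrow> bool" where
  "routing E g T v k c m \<longleftrightarrow> (\<forall>e\<in>E. c e \<le> k) \<and> (\<forall>i\<in>{1..k}. rooted_connection {e \<in> E. c e = i} g T v m)"

definition solution :: "'e set \<Rightarrow> ('e \<times> bool \<Rightarrow> 'v) \<Rightarrow> 'v set \<Rightarrow> 'v \<Rightarrow> nat \<Rightarrow> ('v \<Rightarrow> 'e set) \<Rightarrow> ('v \<Rightarrow> nat) \<Rightarrow>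
    ('e \<Rightarrow> nat) \<Rightarrow> ('e \<Rightarrow> nat) \<Rightarrow> ('e \<times> bool \<Rightarrow> 'e \<times> bool) \<Rightarrow> bool" where
  "solution E g T v k good r \<phi> c m \<longleftrightarrow> routing E g T v k c m \<and>
     (\<forall>t\<in>T - {v}. r t \<le> card {e \<in> cut_edges E g {t} \<inter> good t. c e = 0}) \<and> (\<forall>e\<in>cut_edges E g {v}. c e = \<phi> e)"

definition solvable :: "'e set \<Rightarrow> ('e \<times> bool \<Rightarrow> 'v) \<Rightarrow> 'v set \<Rightarrow> 'v \<Rightarrow> nat \<Rightarrow> bool" where
  "solvable E g T v k \<longleftrightarrow> (\<forall>good r. (\<forall>t\<in>T - {v}. admissible k (cut_edges E g {t}) (good t) (r t)) \<longrightarrow>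
     extends_precolourings k (cut_edges E g {v}) (\<lambda>\<phi>. \<exists>c m. solution E g T v k good r \<phi> c m))"

definition rooted :: "'e set \<Rightarrow> ('e \<times> bool \<Rightarrow> 'v) \<Rightarrow> 'v set \<Rightarrow> 'v \<Rightarrow> nat \<Rightarrow> bool" where
  "rooted E g T v k \<longleftrightarrow> finite E \<and> finite T \<and> v \<in> T \<and> T - {v} \<noteq> {} \<and> card (cut_edges E g {v}) = 6 * k + 6 \<and>
     (\<forall>X. X \<inter> T \<noteq> {} \<longrightarrow> T - X \<noteq> {} \<longrightarrow> 6 * k + 6 \<le> card (cut_edges E g X))"

lemma matingD:
  assumes "mating F g T m" "fst h \<in> F" "g h \<notin> T"
  shows "fst (m h) \<in> F" "m h \<noteq> h" "m (m h) = h" "g (m h) = g h"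
  using assms unfolding mating_def by blast+

lemma linked_flip: "fst h \<in> F \<Longrightarrow> linked F g T S m h (flip h)"
  unfolding trail_step_def by (intro r_into_equivclp) simp

lemma solutionD:
  assumes "solution E g T v k good r \<phi> c m"
  shows "routing E g T v k c m"
    and "\<And>t. t \<in> T - {v} \<Longrightarrow> r t \<le> card {e \<in> cut_edges E g {t} \<inter> good t. c e = 0}"
    and "\<And>e. e \<in> cut_edges E g {v} \<Longrightarrow> c e = \<phi> e"
  using assms unfolding solution_def by blast+

lemma rooted_connectionD:
  assumes "rooted_connection F g T v m"
  shows "mating F g T m"
    and "\<And>h h'. fst h \<in> F \<Longrightarrow> fst h' \<in> F \<Longrightarrow> g h \<in> T \<Longrightarrow> g h' \<in> T \<Longrightarrow> linked F g T (T - {v}) m h h'"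
    and "\<And>s. s \<in> T - {v} \<Longrightarrow> T - {v} \<noteq> {s} \<or> meets F g v \<Longrightarrow> meets F g s"
  using assms unfolding rooted_connection_def by blast+

section \<open>Gluing along a tight cut\<close>

definition contract_edges :: "'e set \<Rightarrow> ('e \<times> bool \<Rightarrow> 'v) \<Rightarrow> 'v set \<Rightarrow> 'e set" where
  "contract_edges E g X = {e \<in> E. g (e, False) \<in> X \<or> g (e, True) \<in> X}"

definition contract_map :: "('e \<times> bool \<Rightarrow> 'v) \<Rightarrow> 'v set \<Rightarrow> 'v \<Rightarrow> 'e \<times> bool \<Rightarrow> 'v" where
  "contract_map g X t h = (if g h \<in> X then g h else t)"

lemma half_edge_in_contract_edges_iff:
  "fst h \<in> contract_edges E g X \<longleftrightarrow> fst h \<in> E \<and> (g h \<in> X \<or> g (flip h) \<in> X)"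
  unfolding contract_edges_def flip_def by (cases h; cases "snd h") auto

lemma contract_edges_subset: "contract_edges E g X \<subseteq> E"
  unfolding contract_edges_def by blast

lemma cut_subset_contract_edges: "cut_edges E g X \<subseteq> contract_edges E g X"
  unfolding cut_edges_def contract_edges_def by blast

lemma contract_edges_Collect: "{e \<in> contract_edges E g X. P e} = contract_edges {e \<in> E. P e} g X"
  unfolding contract_edges_def by blast

lemma cut_contract:
  assumes "t \<notin> X"
  shows "cut_edges (contract_edges E g X) (contract_map g X t) Z =
    cut_edges E g (if t \<in> Z then (Z \<inter> X) \<union> - X else Z \<inter> X)"
  using assms unfolding cut_edges_def contract_edges_def contract_map_def by auto

lemma cut_contract_root:
  assumes "t \<notin> X"
  shows "cut_edges (contract_edges E g X) (contract_map g X t) {t} = cut_edges E g X"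
proof -
  have "({t} \<inter> X) \<union> - X = - X" using assms by blast
  then show ?thesis using cut_contract[OF assms, of E g "{t}"] by simp
qed

lemma cut_contract_inside:
  assumes "t \<notin> X" "s \<in> X"
  shows "cut_edges (contract_edges E g X) (contract_map g X t) {s} = cut_edges E g {s}"
proof -
  have "{s} \<inter> X = {s}" "t \<noteq> s" using assms by auto
  then show ?thesis using cut_contract[OF assms(1), of E g "{s}"] by simp
qed

lemma card_cut_contract_ge:
  assumes cut_ge: "\<And>X. X \<inter> T \<noteq> {} \<Longrightarrow> T - X \<noteq> {} \<Longrightarrow> K \<le> card (cut_edges E g X)"
    and t: "t \<in> T" "t \<notin> X"
    and Z: "Z \<inter> insert t (T \<inter> X) \<noteq> {}" "insert t (T \<inter> X) - Z \<noteq> {}"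
  shows "K \<le> card (cut_edges (contract_edges E g X) (contract_map g X t) Z)"
proof (cases "t \<in> Z")
  case True
  then obtain u where u: "u \<in> T" "u \<in> X" "u \<notin> Z" using Z(2) by blast
  have "((Z \<inter> X) \<union> - X) \<inter> T \<noteq> {}" "T - ((Z \<inter> X) \<union> - X) \<noteq> {}" using t u by blast+
  then have "K \<le> card (cut_edges E g ((Z \<inter> X) \<union> - X))" by (rule cut_ge)
  then show ?thesis using cut_contract[OF t(2), of E g Z] True by simp
next
  case False
  then obtain u where u: "u \<in> T" "u \<in> X" "u \<in> Z" using Z(1) by blast
  have "(Z \<inter> X) \<inter> T \<noteq> {}" "T - (Z \<inter> X) \<noteq> {}" using t u by blast+
  then have "K \<le> card (cut_edges E g (Z \<inter> X))" by (rule cut_ge)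
  then show ?thesis using cut_contract[OF t(2), of E g Z] False by simp
qed

locale glued_connections =
  fixes F :: "'e set" and g :: "'e \<times> bool \<Rightarrow> 'v" and T :: "'v set" and v :: 'v and X :: "'v set" and s :: 'v
    and m\<^sub>1 m\<^sub>2 :: "'e \<times> bool \<Rightarrow> 'e \<times> bool"
  assumes v: "v \<in> T" "v \<notin> X" and s: "s \<in> T" "s \<in> X"
    and inner: "rooted_connection (contract_edges F g X) (contract_map g X v) (insert v (T \<inter> X)) v m\<^sub>1"
    and outer: "rooted_connection (contract_edges F g (- X)) (contract_map g (- X) s) (insert s (T - X)) v m\<^sub>2"
begin

abbreviation F\<^sub>1 :: "'e set" where "F\<^sub>1 \<equiv> contract_edges F g X"
abbreviation g\<^sub>1 :: "'e \<times> bool \<Rightarrow> 'v" where "g\<^sub>1 \<equiv> contract_map g X v"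
abbreviation T\<^sub>1 :: "'v set" where "T\<^sub>1 \<equiv> insert v (T \<inter> X)"
abbreviation F\<^sub>2 :: "'e set" where "F\<^sub>2 \<equiv> contract_edges F g (- X)"
abbreviation g\<^sub>2 :: "'e \<times> bool \<Rightarrow> 'v" where "g\<^sub>2 \<equiv> contract_map g (- X) s"
abbreviation T\<^sub>2 :: "'v set" where "T\<^sub>2 \<equiv> insert s (T - X)"

definition m :: "'e \<times> bool \<Rightarrow> 'e \<times> bool" where "m h = (if g h \<in> X then m\<^sub>1 h else m\<^sub>2 h)"

abbreviation link :: "'e \<times> bool \<Rightarrow> 'e \<times> bool \<Rightarrow> bool" where "link \<equiv> linked F g T (T - {v}) m"

lemma F1_iff: "fst h \<in> F\<^sub>1 \<longleftrightarrow> fst h \<in> F \<and> (g h \<in> X \<or> g (flip h) \<in> X)"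
  by (rule half_edge_in_contract_edges_iff)

lemma F2_iff: "fst h \<in> F\<^sub>2 \<longleftrightarrow> fst h \<in> F \<and> (g h \<notin> X \<or> g (flip h) \<notin> X)"
  using half_edge_in_contract_edges_iff[of h F g "- X"] by simp

lemma g1_eq: "g\<^sub>1 h = (if g h \<in> X then g h else v)" and g2_eq: "g\<^sub>2 h = (if g h \<in> X then s else g h)"
  unfolding contract_map_def by auto

lemma inner_step:
  assumes "trail_step F\<^sub>1 g\<^sub>1 T\<^sub>1 (T\<^sub>1 - {v}) m\<^sub>1 h h'"
  shows "trail_step F g T (T - {v}) m h h'"
  using assms v unfolding trail_step_def F1_iff g1_eq m_def by (auto split: if_splits)

lemma inner_linked:
  assumes "fst h \<in> F\<^sub>1" "fst h' \<in> F\<^sub>1" "g h \<in> X \<Longrightarrow> g h \<in> T" "g h' \<in> X \<Longrightarrow> g h' \<in> T"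
  shows "link h h'"
proof -
  have "g\<^sub>1 h \<in> T\<^sub>1" "g\<^sub>1 h' \<in> T\<^sub>1" using assms(3,4) unfolding g1_eq by auto
  then have "linked F\<^sub>1 g\<^sub>1 T\<^sub>1 (T\<^sub>1 - {v}) m\<^sub>1 h h'" using rooted_connectionD(2)[OF inner assms(1,2)] by blast
  then show ?thesis by (rule equivclp_mono) (rule inner_step)
qed

lemma flip_outside:
  assumes "fst h \<in> F\<^sub>2" "g h \<in> X"
  shows "fst (flip h) \<in> F\<^sub>1" "g (flip h) \<notin> X"
  using assms F1_iff[of "flip h"] F2_iff[of h] by auto

lemma outer_step:
  assumes "trail_step F\<^sub>2 g\<^sub>2 T\<^sub>2 (T\<^sub>2 - {v}) m\<^sub>2 h h'"
  shows "link h h'"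
proof (cases "g h \<in> X \<and> g h' \<in> X")
  case True
  have F2: "fst h \<in> F\<^sub>2" "fst h' \<in> F\<^sub>2" using assms unfolding trail_step_def by auto
  then have F: "fst h \<in> F" "fst h' \<in> F" unfolding F2_iff by auto
  have "link (flip h) (flip h')"
    using flip_outside F2 True by (intro inner_linked) blast+
  then show ?thesis using linked_flip[OF F(1)] linked_flip[OF F(2)] by (meson equivclp_sym equivclp_trans)
next
  case False
  then have "trail_step F g T (T - {v}) m h h'"
    using assms s unfolding trail_step_def F2_iff g2_eq m_def by (auto split: if_splits)
  then show ?thesis by blast
qed

lemma outer_linked:
  assumes "fst h \<in> F\<^sub>2" "fst h' \<in> F\<^sub>2" "g h \<notin> X \<Longrightarrow> g h \<in> T" "g h' \<notin> X \<Longrightarrow> g h' \<in> T"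
  shows "link h h'"
proof -
  have "g\<^sub>2 h \<in> T\<^sub>2" "g\<^sub>2 h' \<in> T\<^sub>2" using assms(3,4) unfolding g2_eq by auto
  then have "linked F\<^sub>2 g\<^sub>2 T\<^sub>2 (T\<^sub>2 - {v}) m\<^sub>2 h h'" using rooted_connectionD(2)[OF outer assms(1,2)] by blast
  then show ?thesis by (rule equivclp_le) (rule outer_step)
qed

lemma mating_glued: "mating F g T m"
  unfolding mating_def
proof (intro allI impI)
  fix h assume "fst h \<in> F \<and> g h \<notin> T"
  then have h: "fst h \<in> F" "g h \<notin> T" by auto
  show "fst (m h) \<in> F \<and> m h \<noteq> h \<and> m (m h) = h \<and> g (m h) = g h"
  proof (cases "g h \<in> X")
    case True
    have h1: "fst h \<in> F\<^sub>1" "g\<^sub>1 h \<notin> T\<^sub>1" using h True v unfolding F1_iff g1_eq by auto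
    note mate = matingD[OF rooted_connectionD(1)[OF inner] h1]
    have "g (m\<^sub>1 h) = g h" using mate(4) True v(2) unfolding g1_eq by (auto split: if_splits)
    then show ?thesis using mate True unfolding m_def F1_iff by simp
  next
    case False
    have h2: "fst h \<in> F\<^sub>2" "g\<^sub>2 h \<notin> T\<^sub>2" using h False s unfolding F2_iff g2_eq by auto
    note mate = matingD[OF rooted_connectionD(1)[OF outer] h2]
    have "g (m\<^sub>2 h) = g h" using mate(4) False s(2) unfolding g2_eq by (auto split: if_splits)
    then show ?thesis using mate False unfolding m_def F2_iff by simp
  qed
qed

lemma obtain_cut_half_edge:
  assumes "T\<^sub>2 - {v} \<noteq> {s} \<or> meets F\<^sub>2 g\<^sub>2 v"
  obtains p where "fst p \<in> F\<^sub>2" "g p \<in> X"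
proof -
  have "s \<in> T\<^sub>2 - {v}" using s v by auto
  then have "meets F\<^sub>2 g\<^sub>2 s" using rooted_connectionD(3)[OF outer _ assms] by blast
  then obtain p where "fst p \<in> F\<^sub>2" "g\<^sub>2 p = s" unfolding meets_def by blast
  then show thesis using that[of p] s(2) unfolding g2_eq by (auto split: if_splits)
qed

lemma linked_across:
  assumes p: "fst p \<in> F" "g p \<in> T" "g p \<in> X" and q: "fst q \<in> F" "g q \<in> T" "g q \<notin> X"
  shows "link p q"
proof -
  have q2: "fst q \<in> F\<^sub>2" using q unfolding F2_iff by simp
  have "T\<^sub>2 - {v} \<noteq> {s} \<or> meets F\<^sub>2 g\<^sub>2 v"
  proof (cases "g q = v")
    case True
    then have "g\<^sub>2 q = v" using q(3) unfolding g2_eq by simp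
    then show ?thesis using q2 unfolding meets_def by blast
  next
    case False
    then have "g q \<in> T\<^sub>2 - {v}" "g q \<noteq> s" using q s by auto
    then show ?thesis by blast
  qed
  then obtain h where h: "fst h \<in> F\<^sub>2" "g h \<in> X" by (rule obtain_cut_half_edge)
  have "link q h" using q2 q h by (intro outer_linked) auto
  moreover have "link h (flip h)" using h(1) unfolding F2_iff by (intro linked_flip) simp
  moreover have "link (flip h) p"
    using flip_outside[OF h] p by (intro inner_linked) (auto simp: F1_iff)
  ultimately show ?thesis by (meson equivclp_sym equivclp_trans)
qed

lemma linked_glued:
  assumes h: "fst h \<in> F" "g h \<in> T" and h': "fst h' \<in> F" "g h' \<in> T"
  shows "link h h'"
proof (cases "g h \<in> X"; cases "g h' \<in> X")
  assume "g h \<in> X" "g h' \<in> X"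
  then show ?thesis using h h' by (intro inner_linked) (auto simp: F1_iff)
next
  assume "g h \<in> X" "g h' \<notin> X"
  then show ?thesis using linked_across h h' by blast
next
  assume "g h \<notin> X" "g h' \<in> X"
  then have "link h' h" using linked_across[OF h' _ h] by blast
  then show ?thesis by (rule equivclp_sym)
next
  assume "g h \<notin> X" "g h' \<notin> X"
  then show ?thesis using h h' by (intro outer_linked) (auto simp: F2_iff)
qed

lemma meets_glued:
  assumes t: "t \<in> T - {v}" and needed: "T - {v} \<noteq> {t} \<or> meets F g v"
  shows "meets F g t"
proof (cases "t \<in> X")
  case True
  have T1: "T\<^sub>1 - {v} = T \<inter> X" using v by blast
  have "T\<^sub>1 - {v} \<noteq> {t} \<or> meets F\<^sub>1 g\<^sub>1 v"
  proof (cases "T \<inter> X = {t}")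
    case single: True
    then have "s = t" using s by blast
    have "T\<^sub>2 - {v} \<noteq> {s} \<or> meets F\<^sub>2 g\<^sub>2 v"
      using needed
    proof
      assume "T - {v} \<noteq> {t}"
      then show ?thesis using single \<open>s = t\<close> t by blast
    next
      assume "meets F g v"
      then obtain h where "fst h \<in> F" "g h = v" unfolding meets_def by blast
      then have "fst h \<in> F\<^sub>2" "g\<^sub>2 h = v" using v(2) unfolding F2_iff g2_eq by simp_all
      then show ?thesis unfolding meets_def by blast
    qed
    then obtain p where "fst p \<in> F\<^sub>2" "g p \<in> X" by (rule obtain_cut_half_edge)
    then have "fst (flip p) \<in> F\<^sub>1" "g\<^sub>1 (flip p) = v" using flip_outside[of p] unfolding g1_eq by simp_all
    then show ?thesis unfolding meets_def by blast
  qed (simp add: T1)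
  then have "meets F\<^sub>1 g\<^sub>1 t" using rooted_connectionD(3)[OF inner] t True by blast
  then obtain h where "fst h \<in> F\<^sub>1" "g\<^sub>1 h = t" unfolding meets_def by blast
  then have "fst h \<in> F" "g h = t" using t unfolding F1_iff g1_eq by (auto split: if_splits)
  then show ?thesis unfolding meets_def by blast
next
  case False
  then have "t \<in> T\<^sub>2 - {v}" "s \<in> T\<^sub>2 - {v}" "s \<noteq> t" using t s v by auto
  then have "meets F\<^sub>2 g\<^sub>2 t" using rooted_connectionD(3)[OF outer, of t] by blast
  then obtain h where "fst h \<in> F\<^sub>2" "g\<^sub>2 h = t" unfolding meets_def by blast
  then have "fst h \<in> F" "g h = t" using \<open>s \<noteq> t\<close> unfolding F2_iff g2_eq by (auto split: if_splits)
  then show ?thesis unfolding meets_def by blast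
qed

lemma rooted_connection_glued: "rooted_connection F g T v m"
  unfolding rooted_connection_def using mating_glued linked_glued meets_glued by blast

end

lemma routing_glue:
  assumes v: "v \<in> T" "v \<notin> X" and s: "s \<in> T" "s \<in> X"
    and inner: "routing (contract_edges E g X) (contract_map g X v) (insert v (T \<inter> X)) v k c\<^sub>1 m\<^sub>1"
    and outer: "routing (contract_edges E g (- X)) (contract_map g (- X) s) (insert s (T - X)) v k c\<^sub>2 m\<^sub>2"
    and agree\<^sub>1: "\<And>e. e \<in> contract_edges E g X \<Longrightarrow> c e = c\<^sub>1 e"
    and agree\<^sub>2: "\<And>e. e \<in> contract_edges E g (- X) \<Longrightarrow> c e = c\<^sub>2 e"
  shows "routing E g T v k c (\<lambda>h. if g h \<in> X then m\<^sub>1 h else m\<^sub>2 h)"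
  unfolding routing_def
proof (intro conjI ballI)
  fix e assume "e \<in> E"
  then have "e \<in> contract_edges E g X \<or> e \<in> contract_edges E g (- X)" unfolding contract_edges_def by blast
  then show "c e \<le> k" using inner outer agree\<^sub>1 agree\<^sub>2 unfolding routing_def by metis
next
  fix i assume i: "i \<in> {1..k}"
  have classes: "contract_edges {e \<in> E. c e = i} g X = {e \<in> contract_edges E g X. c\<^sub>1 e = i}"
    "contract_edges {e \<in> E. c e = i} g (- X) = {e \<in> contract_edges E g (- X). c\<^sub>2 e = i}"
    unfolding contract_edges_Collect[symmetric] using agree\<^sub>1 agree\<^sub>2 by auto
  interpret glued_connections "{e \<in> E. c e = i}" g T v X s m\<^sub>1 m\<^sub>2
    by unfold_locales (use v s inner outer i in \<open>simp_all add: classes routing_def\<close>)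
  show "rooted_connection {e \<in> E. c e = i} g T v (\<lambda>h. if g h \<in> X then m\<^sub>1 h else m\<^sub>2 h)"
    using rooted_connection_glued unfolding m_def[abs_def] .
qed

lemma unused_contract:
  assumes "u \<notin> X" "t \<in> X" and agree: "\<And>e. e \<in> contract_edges E g X \<Longrightarrow> c e = c' e"
  shows "{e \<in> cut_edges (contract_edges E g X) (contract_map g X u) {t} \<inter> A. c' e = 0} =
    {e \<in> cut_edges E g {t} \<inter> A. c e = (0 :: nat)}"
proof -
  have "c e = c' e" if "e \<in> cut_edges E g {t}" for e
    using that assms(2) by (intro agree) (auto simp: cut_edges_def contract_edges_def)
  then show ?thesis unfolding cut_contract_inside[OF assms(1,2)] by auto
qed

lemma solution_glue:
  assumes v: "v \<in> T" "v \<notin> X" and s: "s \<in> T" "s \<in> X"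
    and inner: "solution (contract_edges E g X) (contract_map g X v) (insert v (T \<inter> X)) v k good r \<phi>\<^sub>1 c\<^sub>1 m\<^sub>1"
    and outer: "solution (contract_edges E g (- X)) (contract_map g (- X) s) (insert s (T - X)) v k
      (good(s := G)) (r(s := n)) \<phi> c\<^sub>2 m\<^sub>2"
    and agree: "\<And>e. e \<in> cut_edges E g X \<Longrightarrow> c\<^sub>1 e = c\<^sub>2 e"
  shows "\<exists>c m. solution E g T v k good r \<phi> c m"
proof -
  let ?E\<^sub>1 = "contract_edges E g X" and ?E\<^sub>2 = "contract_edges E g (- X)"
  define c where "c e = (if e \<in> ?E\<^sub>1 then c\<^sub>1 e else c\<^sub>2 e)" for e
  have agree\<^sub>1: "c e = c\<^sub>1 e" if "e \<in> ?E\<^sub>1" for e using that unfolding c_def by simp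
  have agree\<^sub>2: "c e = c\<^sub>2 e" if "e \<in> ?E\<^sub>2" for e
  proof (cases "e \<in> ?E\<^sub>1")
    case True
    then have "e \<in> cut_edges E g X" using that unfolding contract_edges_def cut_edges_def by blast
    then show ?thesis using agree True unfolding c_def by simp
  qed (simp add: c_def)
  have sX: "s \<notin> - X" using s by simp
  have "routing E g T v k c (\<lambda>h. if g h \<in> X then m\<^sub>1 h else m\<^sub>2 h)"
    by (rule routing_glue[OF v s solutionD(1)[OF inner] solutionD(1)[OF outer] agree\<^sub>1 agree\<^sub>2])
  moreover have "r t \<le> card {e \<in> cut_edges E g {t} \<inter> good t. c e = 0}" if t: "t \<in> T - {v}" for t
  proof (cases "t \<in> X")
    case True
    have "t \<in> insert v (T \<inter> X) - {v}" using t True by blast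
    then show ?thesis
      using solutionD(2)[OF inner, of t] unused_contract[where A = "good t", OF v(2) True agree\<^sub>1] by simp
  next
    case False
    then have "t \<in> insert s (T - X) - {v}" "t \<noteq> s" "t \<in> - X" using t s by blast+
    then show ?thesis
      using solutionD(2)[OF outer, of t] unused_contract[where t = t and A = "good t", OF sX _ agree\<^sub>2] by simp
  qed
  moreover have "c e = \<phi> e" if "e \<in> cut_edges E g {v}" for e
  proof -
    have "e \<in> ?E\<^sub>2" using that v unfolding cut_edges_def contract_edges_def by blast
    moreover have "cut_edges ?E\<^sub>2 (contract_map g (- X) s) {v} = cut_edges E g {v}"
      using cut_contract_inside[OF sX] v by simp
    ultimately show ?thesis using solutionD(3)[OF outer, of e] agree\<^sub>2 that by simp
  qed
  ultimately show ?thesis unfolding solution_def by blast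
qed

lemma solution_glue_extending:
  assumes v: "v \<in> T" "v \<notin> X" and s: "s \<in> T" "s \<in> X"
    and extends: "\<And>\<phi>. (\<forall>e. \<phi> e \<le> k) \<and> n \<le> card {e \<in> cut_edges E g X \<inter> G. \<phi> e = 0} \<Longrightarrow>
      \<exists>c m. solution (contract_edges E g X) (contract_map g X v) (insert v (T \<inter> X)) v k good r \<phi> c m"
    and outer: "solution (contract_edges E g (- X)) (contract_map g (- X) s) (insert s (T - X)) v k
      (good(s := G)) (r(s := n)) \<phi> c\<^sub>2 m\<^sub>2"
  shows "\<exists>c m. solution E g T v k good r \<phi> c m"
proof -
  have sX: "s \<notin> - X" "s \<in> insert s (T - X) - {v}" using s v by auto
  define \<phi>\<^sub>1 where "\<phi>\<^sub>1 e = (if e \<in> cut_edges E g X then c\<^sub>2 e else 0)" for e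
  have "cut_edges E g X \<subseteq> contract_edges E g (- X)" using cut_subset_contract_edges[of E g "- X"] by simp
  then have "\<phi>\<^sub>1 e \<le> k" for e using solutionD(1)[OF outer] unfolding \<phi>\<^sub>1_def routing_def by auto
  moreover have "n \<le> card {e \<in> cut_edges E g X \<inter> G. c\<^sub>2 e = 0}"
    using solutionD(2)[OF outer sX(2)] cut_contract_root[OF sX(1), of E g] by simp
  then have "n \<le> card {e \<in> cut_edges E g X \<inter> G. \<phi>\<^sub>1 e = 0}"
    unfolding \<phi>\<^sub>1_def by (simp cong: conj_cong)
  ultimately obtain c\<^sub>1 m\<^sub>1 where inner:
      "solution (contract_edges E g X) (contract_map g X v) (insert v (T \<inter> X)) v k good r \<phi>\<^sub>1 c\<^sub>1 m\<^sub>1"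
    using extends by blast
  have "c\<^sub>1 e = c\<^sub>2 e" if "e \<in> cut_edges E g X" for e
    using solutionD(3)[OF inner, of e] that unfolding cut_contract_root[OF v(2)] \<phi>\<^sub>1_def by simp
  then show ?thesis by (rule solution_glue[OF v s inner outer])
qed

text \<open>The side of \<open>X\<close> is solved first: the good edges it wants unused at \<open>v\<close> become a demand at the
  contracted vertex \<open>s\<close> of the other side, whose solution then precolours the cut.\<close>

theorem solvable_glue:
  fixes E :: "'e set" and T :: "'v set"
  assumes v: "v \<in> T" "v \<notin> X" and s: "s \<in> T" "s \<in> X"
    and inner: "solvable (contract_edges E g X) (contract_map g X v) (insert v (T \<inter> X)) v k"
    and outer: "solvable (contract_edges E g (- X)) (contract_map g (- X) s) (insert s (T - X)) v k"
  shows "solvable E g T v k"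
  unfolding solvable_def
proof (intro allI impI)
  fix good :: "'v \<Rightarrow> 'e set" and r :: "'v \<Rightarrow> nat"
  assume demand: "\<forall>t\<in>T - {v}. admissible k (cut_edges E g {t}) (good t) (r t)"
  let ?E\<^sub>1 = "contract_edges E g X" and ?g\<^sub>1 = "contract_map g X v" and ?T\<^sub>1 = "insert v (T \<inter> X)"
  let ?E\<^sub>2 = "contract_edges E g (- X)" and ?g\<^sub>2 = "contract_map g (- X) s" and ?T\<^sub>2 = "insert s (T - X)"
  have sX: "s \<notin> - X" using s by simp
  have cuts: "cut_edges ?E\<^sub>1 ?g\<^sub>1 {v} = cut_edges E g X" "cut_edges ?E\<^sub>2 ?g\<^sub>2 {s} = cut_edges E g X"
      "cut_edges ?E\<^sub>2 ?g\<^sub>2 {v} = cut_edges E g {v}"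
    using cut_contract_root[OF v(2), of E g] cut_contract_root[OF sX, of E g]
      cut_contract_inside[OF sX, of v E g] v by simp_all
  have "admissible k (cut_edges ?E\<^sub>1 ?g\<^sub>1 {t}) (good t) (r t)" if "t \<in> ?T\<^sub>1 - {v}" for t
    using demand that cut_contract_inside[OF v(2), of t E g] by simp
  then have "extends_precolourings k (cut_edges E g X) (\<lambda>\<phi>. \<exists>c m. solution ?E\<^sub>1 ?g\<^sub>1 ?T\<^sub>1 v k good r \<phi> c m)"
    using inner unfolding solvable_def cuts(1) by blast
  then obtain G n where G: "admissible k (cut_edges E g X) G n"
    and extends_inner: "\<And>\<phi>. (\<forall>e. \<phi> e \<le> k) \<and> n \<le> card {e \<in> cut_edges E g X \<inter> G. \<phi> e = 0} \<Longrightarrow>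
      \<exists>c m. solution ?E\<^sub>1 ?g\<^sub>1 ?T\<^sub>1 v k good r \<phi> c m"
    unfolding extends_precolourings_def by blast
  have "admissible k (cut_edges ?E\<^sub>2 ?g\<^sub>2 {t}) ((good(s := G)) t) ((r(s := n)) t)" if "t \<in> ?T\<^sub>2 - {v}" for t
    using demand that G cuts(2) cut_contract_inside[OF sX, of t E g] by (cases "t = s") simp_all
  then have "extends_precolourings k (cut_edges E g {v})
      (\<lambda>\<phi>. \<exists>c m. solution ?E\<^sub>2 ?g\<^sub>2 ?T\<^sub>2 v k (good(s := G)) (r(s := n)) \<phi> c m)"
    using outer unfolding solvable_def cuts(3) by blast
  then obtain G' n' where G': "admissible k (cut_edges E g {v}) G' n'"
    and extends_outer: "\<And>\<phi>. (\<forall>e. \<phi> e \<le> k) \<and> n' \<le> card {e \<in> cut_edges E g {v} \<inter> G'. \<phi> e = 0} \<Longrightarrow>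
      \<exists>c m. solution ?E\<^sub>2 ?g\<^sub>2 ?T\<^sub>2 v k (good(s := G)) (r(s := n)) \<phi> c m"
    unfolding extends_precolourings_def by blast
  show "extends_precolourings k (cut_edges E g {v}) (\<lambda>\<phi>. \<exists>c m. solution E g T v k good r \<phi> c m)"
  proof (rule extends_precolouringsI[OF G'])
    fix \<phi> :: "'e \<Rightarrow> nat"
    assume "\<And>e. \<phi> e \<le> k" "n' \<le> card {e \<in> cut_edges E g {v} \<inter> G'. \<phi> e = 0}"
    then obtain c\<^sub>2 m\<^sub>2 where "solution ?E\<^sub>2 ?g\<^sub>2 ?T\<^sub>2 v k (good(s := G)) (r(s := n)) \<phi> c\<^sub>2 m\<^sub>2"
      using extends_outer by blast
    with extends_inner show "\<exists>c m. solution E g T v k good r \<phi> c m"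
      by (rule solution_glue_extending[OF v s])
  qed
qed

section \<open>Deleting edges and detaching half-edges\<close>

text \<open>\<open>g\<close> arises from \<open>g'\<close> by identifying vertices outside \<open>T\<close>.\<close>

definition identifies :: "'e set \<Rightarrow> 'v set \<Rightarrow> ('e \<times> bool \<Rightarrow> 'v) \<Rightarrow> ('e \<times> bool \<Rightarrow> 'v) \<Rightarrow> bool" where
  "identifies E T g' g \<longleftrightarrow> (\<forall>h. fst h \<in> E \<and> (g' h \<in> T \<or> g h \<in> T) \<longrightarrow> g' h = g h) \<and>
     (\<forall>h h'. fst h \<in> E \<and> fst h' \<in> E \<and> g' h = g' h' \<longrightarrow> g h = g h')"

lemma identifies_terminal_iff: "identifies E T g' g \<Longrightarrow> fst h \<in> E \<Longrightarrow> t \<in> T \<Longrightarrow> g' h = t \<longleftrightarrow> g h = t"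
  unfolding identifies_def by metis

lemma rooted_connection_identify:
  assumes F: "F \<subseteq> E" and id: "identifies E T g' g" and v: "v \<in> T" and conn: "rooted_connection F g' T v m"
  shows "rooted_connection F g T v m"
proof -
  have terminal: "g' h = t \<longleftrightarrow> g h = t" if "fst h \<in> F" "t \<in> T" for h t
    using identifies_terminal_iff[OF id] that F by blast
  have T: "g' h \<in> T \<longleftrightarrow> g h \<in> T" if "fst h \<in> F" for h
    using terminal[OF that, of "g h"] terminal[OF that, of "g' h"] by auto
  have meets: "meets F g' t \<longleftrightarrow> meets F g t" if "t \<in> T" for t
    using terminal that unfolding meets_def by blast
  have step: "trail_step F g T (T - {v}) m h h'" if "trail_step F g' T (T - {v}) m h h'" for h h'
    using that terminal T unfolding trail_step_def by (metis DiffE)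
  have "mating F g T m"
    unfolding mating_def
  proof (intro allI impI)
    fix h assume h: "fst h \<in> F \<and> g h \<notin> T"
    then have "g' h \<notin> T" using T by blast
    note mate = matingD[OF rooted_connectionD(1)[OF conn] _ this]
    then have "g (m h) = g h" using id F h unfolding identifies_def by (metis subsetD)
    then show "fst (m h) \<in> F \<and> m h \<noteq> h \<and> m (m h) = h \<and> g (m h) = g h" using mate h by blast
  qed
  moreover have "linked F g T (T - {v}) m h h'" if "fst h \<in> F \<and> fst h' \<in> F \<and> g h \<in> T \<and> g h' \<in> T" for h h'
  proof -
    have "linked F g' T (T - {v}) m h h'" using that T by (intro rooted_connectionD(2)[OF conn]) auto
    then show ?thesis by (rule equivclp_mono) (rule step)
  qed
  moreover have "meets F g t" if "t \<in> T - {v}" "T - {v} \<noteq> {t} \<or> meets F g v" for t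
    using rooted_connectionD(3)[OF conn that(1)] that meets v by blast
  ultimately show ?thesis unfolding rooted_connection_def by blast
qed

lemma solution_lift:
  assumes E': "E' \<subseteq> E" and E: "finite E" and id: "identifies E' T g' g" and v: "v \<in> T"
    and cut_subset: "\<And>t. t \<in> T \<Longrightarrow> cut_edges E' g' {t} \<subseteq> cut_edges E g {t}"
    and root_cut: "cut_edges E' g' {v} = cut_edges E g {v}" and sol: "solution E' g' T v k good r \<phi> c m"
  shows "solution E g T v k good r \<phi> (\<lambda>e. if e \<in> E' then c e else 0) m" (is "solution _ _ _ _ _ _ _ _ ?c _")
proof -
  note R = solutionD(1)[OF sol]
  have "rooted_connection {e \<in> E. ?c e = i} g T v m" if "i \<in> {1..k}" for i
  proof -
    have "rooted_connection {e \<in> E'. c e = i} g' T v m" using R that unfolding routing_def by blast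
    then have "rooted_connection {e \<in> E'. c e = i} g T v m"
      by (rule rooted_connection_identify[OF _ id v, rotated]) blast
    moreover have "{e \<in> E. ?c e = i} = {e \<in> E'. c e = i}" using E' that by auto
    ultimately show ?thesis by simp
  qed
  then have "routing E g T v k ?c m" using R unfolding routing_def by simp
  moreover have cut_E': "cut_edges E' g' Z \<subseteq> E'" for Z unfolding cut_edges_def by blast
  have "r t \<le> card {e \<in> cut_edges E g {t} \<inter> good t. ?c e = 0}" if "t \<in> T - {v}" for t
  proof -
    have "r t \<le> card {e \<in> cut_edges E' g' {t} \<inter> good t. c e = 0}" by (rule solutionD(2)[OF sol that])
    also have "\<dots> \<le> card {e \<in> cut_edges E g {t} \<inter> good t. ?c e = 0}"
      using E cut_subset[of t] that by (intro card_mono) auto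
    finally show ?thesis .
  qed
  moreover have "?c e = \<phi> e" if "e \<in> cut_edges E g {v}" for e
    using solutionD(3)[OF sol, of e] that cut_E'[of "{v}"] unfolding root_cut by auto
  ultimately show ?thesis unfolding solution_def by blast
qed

theorem solvable_lift:
  fixes E :: "'e set" and T :: "'v set"
  assumes E': "E' \<subseteq> E" and E: "finite E" and id: "identifies E' T g' g" and v: "v \<in> T"
    and cut_subset: "\<And>t. t \<in> T \<Longrightarrow> cut_edges E' g' {t} \<subseteq> cut_edges E g {t}"
    and tight_cut: "\<And>t. t \<in> T \<Longrightarrow> card (cut_edges E g {t}) = 6 * k + 6 \<Longrightarrow>
      cut_edges E' g' {t} = cut_edges E g {t}"
    and root_tight: "card (cut_edges E g {v}) = 6 * k + 6" and solvable: "solvable E' g' T v k"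
  shows "solvable E g T v k"
  unfolding solvable_def
proof (intro allI impI)
  fix good :: "'v \<Rightarrow> 'e set" and r :: "'v \<Rightarrow> nat"
  assume "\<forall>t\<in>T - {v}. admissible k (cut_edges E g {t}) (good t) (r t)"
  then have "\<forall>t\<in>T - {v}. admissible k (cut_edges E' g' {t}) (good t) (r t)"
    using tight_cut unfolding admissible_def by (metis DiffD1)
  moreover have root_cut: "cut_edges E' g' {v} = cut_edges E g {v}" by (rule tight_cut[OF v root_tight])
  ultimately have "extends_precolourings k (cut_edges E g {v}) (\<lambda>\<phi>. \<exists>c m. solution E' g' T v k good r \<phi> c m)"
    using solvable unfolding solvable_def by metis
  then show "extends_precolourings k (cut_edges E g {v}) (\<lambda>\<phi>. \<exists>c m. solution E g T v k good r \<phi> c m)"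
    using solution_lift[OF E' E id v cut_subset root_cut] unfolding extends_precolourings_def by meson
qed

definition graph_size :: "'e set \<Rightarrow> ('e \<times> bool \<Rightarrow> 'v) \<Rightarrow> 'v set \<Rightarrow> nat" where
  "graph_size E g T =
     card E + (\<Sum>w\<in>vertex_set E g T - T. (card (cut_edges E g {w}))\<^sup>2) + card (vertex_set E g T)"

locale detached_pair =
  fixes E :: "'e set" and g :: "'e \<times> bool \<Rightarrow> 'v" and T :: "'v set" and w z :: 'v and h\<^sub>1 h\<^sub>2 :: "'e \<times> bool"
  assumes finite: "finite E" "finite T" and distinct: "fst h\<^sub>1 \<noteq> fst h\<^sub>2" and in_E: "fst h\<^sub>1 \<in> E" "fst h\<^sub>2 \<in> E"
    and at_w: "g h\<^sub>1 = w" "g h\<^sub>2 = w" and no_loop: "g (flip h\<^sub>1) \<noteq> w" "g (flip h\<^sub>2) \<noteq> w"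
    and w: "w \<notin> T" and fresh: "z \<notin> vertex_set E g T"
begin

definition g' :: "'e \<times> bool \<Rightarrow> 'v" where "g' = g(h\<^sub>1 := z, h\<^sub>2 := z)"

lemma g'_simps: "g' h\<^sub>1 = z" "g' h\<^sub>2 = z" "g' (flip h\<^sub>1) = g (flip h\<^sub>1)" "g' (flip h\<^sub>2) = g (flip h\<^sub>2)"
proof -
  have "flip h\<^sub>1 \<noteq> h\<^sub>2" "flip h\<^sub>2 \<noteq> h\<^sub>1" using distinct by (metis flip_simps(1))+
  then show "g' h\<^sub>1 = z" "g' h\<^sub>2 = z" "g' (flip h\<^sub>1) = g (flip h\<^sub>1)" "g' (flip h\<^sub>2) = g (flip h\<^sub>2)"
    unfolding g'_def by auto
qed

lemma g'_cases: "(h = h\<^sub>1 \<or> h = h\<^sub>2) \<and> g' h = z \<and> g h = w \<or> h \<noteq> h\<^sub>1 \<and> h \<noteq> h\<^sub>2 \<and> g' h = g h"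
  using at_w unfolding g'_def by auto

lemma z_unused: "fst h \<in> E \<Longrightarrow> g h \<noteq> z" "z \<notin> T"
  using half_edge_in_vertex_set[of h E g T] terminals_subset_vertex_set[of T E g] fresh by auto

lemma w_ne_z: "w \<noteq> z"
  using z_unused(1)[OF in_E(1)] at_w by simp

lemma identifies_g': "identifies E T g' g"
  unfolding identifies_def
proof (intro conjI allI impI)
  show "g' h = g h" if "fst h \<in> E \<and> (g' h \<in> T \<or> g h \<in> T)" for h
    using g'_cases[of h] that w z_unused(2) by auto
  show "g h = g h'" if "fst h \<in> E \<and> fst h' \<in> E \<and> g' h = g' h'" for h h'
    using g'_cases[of h] g'_cases[of h'] that z_unused(1)[of h] z_unused(1)[of h'] by metis
qed

lemma cut_unchanged: "(w \<in> X \<longleftrightarrow> z \<in> X) \<Longrightarrow> cut_edges E g' X = cut_edges E g X"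
proof -
  assume "w \<in> X \<longleftrightarrow> z \<in> X"
  then have "g' h \<in> X \<longleftrightarrow> g h \<in> X" for h using g'_cases[of h] by auto
  then show ?thesis unfolding cut_edges_def by simp
qed

lemma terminal_cut_unchanged: "t \<in> T \<Longrightarrow> cut_edges E g' {t} = cut_edges E g {t}"
  by (rule cut_unchanged) (use w z_unused(2) in auto)

lemma cut_Diff_detached: "cut_edges E g' X - {fst h\<^sub>1, fst h\<^sub>2} = cut_edges E g X - {fst h\<^sub>1, fst h\<^sub>2}"
proof -
  have "g' (e, b) = g (e, b)" if "e \<noteq> fst h\<^sub>1" "e \<noteq> fst h\<^sub>2" for e b
    using g'_cases[of "(e, b)"] that by auto
  then show ?thesis unfolding cut_edges_def by auto
qed

lemma detached_edge_in_cut_iff: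
  assumes "z \<in> X" "w \<notin> X"
  shows "fst h\<^sub>1 \<in> cut_edges E g' X \<longleftrightarrow> g (flip h\<^sub>1) \<notin> X" "fst h\<^sub>2 \<in> cut_edges E g' X \<longleftrightarrow> g (flip h\<^sub>2) \<notin> X"
    "fst h\<^sub>1 \<in> cut_edges E g X \<longleftrightarrow> g (flip h\<^sub>1) \<in> X" "fst h\<^sub>2 \<in> cut_edges E g X \<longleftrightarrow> g (flip h\<^sub>2) \<in> X"
  using assms in_E at_w g'_simps unfolding half_edge_in_cut_iff by auto

lemma card_cut_exchange:
  assumes gained: "a \<in> cut_edges E g' X" "a \<notin> cut_edges E g X"
    and lost: "cut_edges E g X - {b} \<subseteq> cut_edges E g' X"
  shows "card (cut_edges E g X) \<le> card (cut_edges E g' X)"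
proof -
  have "card (cut_edges E g X) \<le> Suc (card (cut_edges E g X - {b}))"
    using card_Suc_Diff1[of "cut_edges E g X" b] finite by (cases "b \<in> cut_edges E g X") auto
  also have "\<dots> = card (insert a (cut_edges E g X - {b}))"
    using gained(2) finite by (intro card_insert_disjoint[symmetric]) auto
  also have "\<dots> \<le> card (cut_edges E g' X)" using gained(1) lost finite by (intro card_mono) auto
  finally show ?thesis .
qed

lemma card_cut_separating_ge:
  assumes X: "z \<in> X" "w \<notin> X" and K: "K \<le> card (cut_edges E g X)"
    and safe: "g (flip h\<^sub>1) \<in> X \<Longrightarrow> g (flip h\<^sub>2) \<in> X \<Longrightarrow> K + 2 \<le> card (cut_edges E g X)"
  shows "K \<le> card (cut_edges E g' X)"
proof -
  note detached = detached_edge_in_cut_iff[OF X]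
  consider (both) "g (flip h\<^sub>1) \<in> X" "g (flip h\<^sub>2) \<in> X" | (first) "g (flip h\<^sub>1) \<notin> X" | (second) "g (flip h\<^sub>2) \<notin> X"
    by blast
  then show ?thesis
  proof cases
    case both
    have "cut_edges E g X \<subseteq> cut_edges E g' X \<union> {fst h\<^sub>1, fst h\<^sub>2}" using cut_Diff_detached[of X] by blast
    then have "card (cut_edges E g X) \<le> card (cut_edges E g' X \<union> {fst h\<^sub>1, fst h\<^sub>2})"
      using finite by (intro card_mono) auto
    also have "\<dots> \<le> card (cut_edges E g' X) + card {fst h\<^sub>1, fst h\<^sub>2}" by (rule card_Un_le)
    finally show ?thesis using safe[OF both] distinct by simp
  next
    case first
    then have "cut_edges E g X - {fst h\<^sub>2} = cut_edges E g' X - {fst h\<^sub>1, fst h\<^sub>2}"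
      using detached(3) unfolding cut_Diff_detached by blast
    then have "cut_edges E g X - {fst h\<^sub>2} \<subseteq> cut_edges E g' X" by blast
    then show ?thesis using card_cut_exchange[of "fst h\<^sub>1"] detached(1,3) first K by fastforce
  next
    case second
    then have "cut_edges E g X - {fst h\<^sub>1} = cut_edges E g' X - {fst h\<^sub>1, fst h\<^sub>2}"
      using detached(4) unfolding cut_Diff_detached by blast
    then have "cut_edges E g X - {fst h\<^sub>1} \<subseteq> cut_edges E g' X" by blast
    then show ?thesis using card_cut_exchange[of "fst h\<^sub>2"] detached(2,4) second K by fastforce
  qed
qed

lemma card_cut_detached_ge:
  assumes cut_ge: "\<And>X. X \<inter> T \<noteq> {} \<Longrightarrow> T - X \<noteq> {} \<Longrightarrow> K \<le> card (cut_edges E g X)"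
    and safe: "\<And>X. w \<notin> X \<Longrightarrow> T - X \<noteq> {} \<Longrightarrow> g (flip h\<^sub>1) \<in> X \<Longrightarrow> g (flip h\<^sub>2) \<in> X \<Longrightarrow> K + 2 \<le> card (cut_edges E g X)"
    and X: "X \<inter> T \<noteq> {}" "T - X \<noteq> {}"
  shows "K \<le> card (cut_edges E g' X)"
proof -
  consider (together) "w \<in> X \<longleftrightarrow> z \<in> X" | (z_inside) "z \<in> X" "w \<notin> X" | (z_outside) "z \<in> - X" "w \<notin> - X" by blast
  then show ?thesis
  proof cases
    case together
    then show ?thesis using cut_unchanged cut_ge[OF X] by simp
  next
    case z_inside
    then show ?thesis using card_cut_separating_ge[OF z_inside cut_ge[OF X]] safe[of X] X by blast
  next
    case z_outside
    have "(- X) \<inter> T \<noteq> {}" "T - (- X) \<noteq> {}" using X by auto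
    then have "K \<le> card (cut_edges E g' (- X))"
      using card_cut_separating_ge[OF z_outside cut_ge] safe[of "- X"] z_outside by blast
    then show ?thesis by simp
  qed
qed

lemma vertex_set_detached: "vertex_set E g' T \<subseteq> insert z (vertex_set E g T)"
proof
  fix u assume "u \<in> vertex_set E g' T"
  then consider (terminal) "u \<in> T" | (half_edge) h where "fst h \<in> E" "g' h = u"
    unfolding vertex_set_def by auto
  then show "u \<in> insert z (vertex_set E g T)"
  proof cases
    case terminal
    then show ?thesis using terminals_subset_vertex_set[of T E g] by blast
  next
    case half_edge
    then show ?thesis using g'_cases[of h] half_edge_in_vertex_set[OF half_edge(1), of g T] by auto
  qed
qed

lemma card_cut_z_le: "card (cut_edges E g' {z}) \<le> 2"
proof -
  have "cut_edges E g {z} = {}" using z_unused(1)[of "(_, _)"] unfolding cut_edges_def by auto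
  then have "cut_edges E g' {z} \<subseteq> {fst h\<^sub>1, fst h\<^sub>2}" using cut_Diff_detached[of "{z}"] by blast
  then have "card (cut_edges E g' {z}) \<le> card {fst h\<^sub>1, fst h\<^sub>2}" by (intro card_mono) auto
  then show ?thesis using distinct by simp
qed

lemma card_cut_w_le: "card (cut_edges E g' {w}) \<le> card (cut_edges E g {w}) - 2"
proof -
  have "fst h\<^sub>1 \<notin> cut_edges E g' {w}" "fst h\<^sub>2 \<notin> cut_edges E g' {w}"
    unfolding half_edge_in_cut_iff using g'_simps w_ne_z no_loop by auto
  then have "cut_edges E g' {w} \<subseteq> cut_edges E g {w} - {fst h\<^sub>1, fst h\<^sub>2}"
    unfolding cut_Diff_detached[symmetric] by blast
  then have "card (cut_edges E g' {w}) \<le> card (cut_edges E g {w} - {fst h\<^sub>1, fst h\<^sub>2})"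
    using finite by (intro card_mono) auto
  moreover have "{fst h\<^sub>1, fst h\<^sub>2} \<subseteq> cut_edges E g {w}"
    using in_E at_w no_loop by (simp add: half_edge_in_cut_iff)
  ultimately show ?thesis using distinct by (simp add: card_Diff_subset)
qed

lemma graph_size_detached:
  assumes deg: "4 \<le> card (cut_edges E g {w})"
  shows "graph_size E g' T < graph_size E g T"
proof -
  let ?V = "vertex_set E g T" and ?V' = "vertex_set E g' T"
  let ?d = "\<lambda>u. (card (cut_edges E g {u}))\<^sup>2" and ?d' = "\<lambda>u. (card (cut_edges E g' {u}))\<^sup>2"
  have finite_V: "finite ?V" using finite by (rule finite_vertex_set)
  have w_V: "w \<in> ?V - T" using half_edge_in_vertex_set[OF in_E(1), of g T] at_w w by simp
  have "sum ?d' (?V' - T) \<le> sum ?d' (insert z (?V - T))"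
    by (rule sum_mono2) (use finite_V vertex_set_detached in auto)
  also have "\<dots> = ?d' z + sum ?d' (?V - T)" using finite_V fresh by simp
  also have "sum ?d' (?V - T) = ?d' w + sum ?d' (?V - T - {w})" using finite_V w_V by (intro sum.remove) auto
  also have "sum ?d' (?V - T - {w}) = sum ?d (?V - T - {w})"
  proof (rule sum.cong)
    fix u assume "u \<in> ?V - T - {w}"
    then have "cut_edges E g' {u} = cut_edges E g {u}" by (intro cut_unchanged) (use fresh in auto)
    then show "?d' u = ?d u" by simp
  qed simp
  finally have new: "sum ?d' (?V' - T) \<le> ?d' z + (?d' w + sum ?d (?V - T - {w}))" .
  have old: "sum ?d (?V - T) = ?d w + sum ?d (?V - T - {w})" using finite_V w_V by (intro sum.remove) auto
  obtain n where n: "card (cut_edges E g {w}) = n + 2" "2 \<le> n"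
  proof -
    have "card (cut_edges E g {w}) = (card (cut_edges E g {w}) - 2) + 2" using deg by simp
    then show thesis using that deg by simp
  qed
  have "?d' z \<le> 2\<^sup>2" by (rule power_mono[OF card_cut_z_le]) simp
  then have "?d' z \<le> 4" by simp
  moreover have "?d' w \<le> n\<^sup>2" using card_cut_w_le n(1) by (intro power_mono) simp_all
  moreover have "?d w = n\<^sup>2 + 4 * n + 4" unfolding n(1) by (simp add: power2_eq_square algebra_simps)
  ultimately have "sum ?d' (?V' - T) + 8 \<le> sum ?d (?V - T)" using new old n(2) by linarith
  moreover have "card ?V' \<le> card ?V + 1"
    using card_mono[OF _ vertex_set_detached] finite_V fresh by simp
  ultimately show ?thesis unfolding graph_size_def by linarith
qed

lemma solvable_detached:
  assumes "solvable E g' T v k" "v \<in> T" "card (cut_edges E g {v}) = 6 * k + 6"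
  shows "solvable E g T v k"
  using assms by (intro solvable_lift[OF _ finite(1) identifies_g']) (simp_all add: terminal_cut_unchanged)

end

section \<open>Graphs whose nonterminals have degree at most three\<close>

lemma admissible_vimage:
  assumes "inj_on f B"
  shows "admissible k (f ` B) G n \<longleftrightarrow> admissible k B (f -` G) n"
proof -
  have "f ` B - G = f ` (B - f -` G)" by blast
  then have "card (f ` B - G) = card (B - f -` G)"
    using card_image[OF inj_on_subset[OF assms Diff_subset]] by metis
  then show ?thesis unfolding admissible_def using card_image[OF assms] by simp
qed

lemma extends_precolourings_image:
  assumes inj: "inj_on f B" and ext: "extends_precolourings k (f ` B) Ext'"
    and transfer: "\<And>\<phi> \<phi>'. (\<And>e. e \<in> B \<Longrightarrow> \<phi>' (f e) = \<phi> e) \<Longrightarrow> Ext' \<phi>' \<Longrightarrow> Ext \<phi>"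
  shows "extends_precolourings k B Ext"
proof -
  obtain G n where G: "admissible k (f ` B) G n"
    and solve: "\<And>\<phi>. (\<forall>e. \<phi> e \<le> k) \<and> n \<le> card {e \<in> f ` B \<inter> G. \<phi> e = 0} \<Longrightarrow> Ext' \<phi>"
    using ext unfolding extends_precolourings_def by blast
  have "admissible k B (f -` G) n" using G admissible_vimage[OF inj] by blast
  then show ?thesis
  proof (rule extends_precolouringsI)
    fix \<phi> assume \<phi>: "\<And>e. \<phi> e \<le> k" and n: "n \<le> card {e \<in> B \<inter> f -` G. \<phi> e = 0}"
    define \<phi>' where "\<phi>' = \<phi> \<circ> inv_into B f"
    have \<phi>': "\<phi>' (f e) = \<phi> e" if "e \<in> B" for e using that inj unfolding \<phi>'_def by simp
    then have "{l \<in> f ` B \<inter> G. \<phi>' l = 0} = f ` {e \<in> B \<inter> f -` G. \<phi> e = 0}" by force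
    moreover have "inj_on f {e \<in> B \<inter> f -` G. \<phi> e = 0}" by (rule inj_on_subset[OF inj]) blast
    ultimately have "n \<le> card {l \<in> f ` B \<inter> G. \<phi>' l = 0}" using n by (simp add: card_image)
    moreover have "\<phi>' l \<le> k" for l unfolding \<phi>'_def using \<phi> by simp
    ultimately have "Ext' \<phi>'" by (intro solve) blast
    then show "Ext \<phi>" using transfer[of \<phi>' \<phi>] \<phi>' by blast
  qed
qed

text \<open>A link is a vertex outside \<open>T\<close> together with its edges, or an edge joining two vertices of \<open>T\<close>.\<close>

locale star_graph = reduced_graph E g T "6 * k + 6"
  for E :: "'e set" and g :: "'e \<times> bool \<Rightarrow> 'v" and T :: "'v set" and k :: nat +
  fixes v :: 'v
  assumes root: "v \<in> T" "T - {v} \<noteq> {}" and root_tight: "card (cut_edges E g {v}) = 6 * k + 6"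
    and degree_le_3: "\<And>w. w \<notin> T \<Longrightarrow> card (cut_edges E g {w}) \<le> 3"
begin

definition link_of :: "'e \<Rightarrow> 'v + 'e" where
  "link_of e =
    (if g (e, False) \<notin> T then Inl (g (e, False)) else if g (e, True) \<notin> T then Inl (g (e, True)) else Inr e)"

definition link_verts :: "'v + 'e \<Rightarrow> 'v set" where
  "link_verts l = {t \<in> T. \<exists>e\<in>cut_edges E g {t}. link_of e = l}"

lemma edge_ends:
  assumes "e \<in> E"
  shows "g (e, False) \<noteq> g (e, True)" "g (e, False) \<in> T \<or> g (e, True) \<in> T"
  using tight_cover[OF assms] unfolding cut_edges_def by auto

lemma no_loop: "fst h \<in> E \<Longrightarrow> g (flip h) \<noteq> g h"
  using edge_ends(1)[of "fst h"] unfolding flip_def by (cases h; cases "snd h") auto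

lemma terminal_end: "fst h \<in> E \<Longrightarrow> g h \<in> T \<or> g (flip h) \<in> T"
  using edge_ends(2)[of "fst h"] unfolding flip_def by (cases h; cases "snd h") auto

lemma half_edge_in_cut: "fst h \<in> E \<Longrightarrow> fst h \<in> cut_edges E g {g h}"
  unfolding half_edge_in_cut_iff using no_loop by simp

lemma obtain_half_edge:
  assumes "e \<in> cut_edges E g {u}"
  obtains h where "fst h = e" "g h = u"
  using assms that[of "(e, False)"] that[of "(e, True)"] unfolding cut_edges_def by auto

lemma half_edge_eqI:
  assumes "fst h \<in> E" "fst h = fst h'" "g h = g h'"
  shows "h = h'"
  using eq_or_flip_if_same_edge[OF assms(2)] no_loop[OF assms(1)] assms(3) by metis

lemma in_E_if_in_cut: "e \<in> cut_edges E g X \<Longrightarrow> e \<in> E"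
  unfolding cut_edges_def by simp

lemma link_of_Inl_iff:
  assumes "e \<in> E"
  shows "link_of e = Inl w \<longleftrightarrow> w \<notin> T \<and> e \<in> cut_edges E g {w}"
  using edge_ends[OF assms] assms unfolding link_of_def cut_edges_def by auto

lemma link_of_Inr_iff: "link_of e = Inr f \<longleftrightarrow> f = e \<and> g (e, False) \<in> T \<and> g (e, True) \<in> T"
  unfolding link_of_def by auto

lemma opposite_eq_terminal:
  assumes "w \<notin> T" "e \<in> cut_edges E g {w}" "t \<in> T" "e \<in> cut_edges E g {t}"
  shows "opp w e = t"
  using assms opposite_tight_terminal(1)[OF assms(1,2)] unfolding cut_edges_def opposite_def by auto

lemma opposite_flip:
  assumes "fst h \<in> E" "g h \<notin> T"
  shows "opp (g h) (fst h) = g (flip h)"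
proof (rule opposite_eq_terminal[OF assms(2) half_edge_in_cut[OF assms(1)]])
  show "g (flip h) \<in> T" using terminal_end assms by blast
  show "fst h \<in> cut_edges E g {g (flip h)}" using half_edge_in_cut[of "flip h"] assms(1) by simp
qed

lemma opposite_in_cut:
  assumes "w \<notin> T" "e \<in> cut_edges E g {w}"
  shows "e \<in> cut_edges E g {opp w e}"
  using opposite_cases[OF assms(2)] assms opposite_tight_terminal(1)[OF assms] unfolding cut_edges_def by auto

lemma parallel_edges_le_half:
  assumes w: "w \<notin> T" and e: "e \<in> cut_edges E g {w}"
  shows "2 * card {f \<in> cut_edges E g {w}. opp w f = opp w e} \<le> card (cut_edges E g {w})"
proof -
  let ?t = "opp w e"
  note t = opposite_tight_terminal[OF w e]
  have wt: "w \<notin> {?t}" using t(1) w by auto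
  have "T - insert w {?t} \<noteq> {}" using root w by blast
  then have "6 * k + 6 \<le> card (cut_edges E g (insert w {?t}))" using t(1) by (intro cut_ge) auto
  moreover have "between E g {?t} {w} = {f \<in> cut_edges E g {w}. opp w f = ?t}"
    using between_singleton_eq[OF wt] by simp
  ultimately show ?thesis using card_cut_insert[OF finite_edges wt, of g] t(2) by simp
qed

lemma inj_on_opposite:
  assumes w: "w \<notin> T"
  shows "inj_on (opp w) (cut_edges E g {w})"
proof (rule inj_onI, rule ccontr)
  fix e f assume ef: "e \<in> cut_edges E g {w}" "f \<in> cut_edges E g {w}" "opp w e = opp w f" "e \<noteq> f"
  then have "card {e, f} \<le> card {f \<in> cut_edges E g {w}. opp w f = opp w e}"
    using finite_edges by (intro card_mono) auto
  then show False using parallel_edges_le_half[OF w ef(1)] degree_le_3[OF w] ef(4) by simp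
qed

lemma degree_ge_2:
  assumes w: "w \<notin> T" and e: "e \<in> cut_edges E g {w}"
  shows "2 \<le> card (cut_edges E g {w})"
proof -
  have "card {e} \<le> card {f \<in> cut_edges E g {w}. opp w f = opp w e}"
    using e finite_edges by (intro card_mono) auto
  then show ?thesis using parallel_edges_le_half[OF w e] by simp
qed

lemma inj_on_link_of:
  assumes t: "t \<in> T"
  shows "inj_on link_of (cut_edges E g {t})"
proof (rule inj_onI)
  fix e f assume e: "e \<in> cut_edges E g {t}" and f: "f \<in> cut_edges E g {t}" and eq: "link_of e = link_of f"
  show "e = f"
  proof (cases "link_of e")
    case (Inl w)
    then have w: "w \<notin> T" "e \<in> cut_edges E g {w}" "f \<in> cut_edges E g {w}"
      using link_of_Inl_iff e f eq in_E_if_in_cut by metis+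
    then have "opp w e = opp w f" using opposite_eq_terminal[OF w(1)] t e f by metis
    then show ?thesis using inj_onD[OF inj_on_opposite[OF w(1)]] w by blast
  next
    case (Inr a)
    then show ?thesis using eq link_of_Inr_iff by metis
  qed
qed

lemma link_verts_Inl:
  assumes w: "w \<notin> T"
  shows "link_verts (Inl w) = opp w ` cut_edges E g {w}"
proof (intro equalityI subsetI)
  fix t assume "t \<in> link_verts (Inl w)"
  then obtain e where "t \<in> T" "e \<in> cut_edges E g {t}" "link_of e = Inl w" unfolding link_verts_def by blast
  then show "t \<in> opp w ` cut_edges E g {w}"
    using link_of_Inl_iff[OF in_E_if_in_cut] opposite_eq_terminal[OF w] by (metis imageI)
next
  fix t assume "t \<in> opp w ` cut_edges E g {w}"
  then obtain e where e: "e \<in> cut_edges E g {w}" "t = opp w e" by blast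
  then show "t \<in> link_verts (Inl w)"
    using opposite_tight_terminal(1)[OF w e(1)] opposite_in_cut[OF w e(1)]
      link_of_Inl_iff[OF in_E_if_in_cut[OF e(1)]] w unfolding link_verts_def by blast
qed

lemma link_verts_Inr:
  assumes "e \<in> E" "link_of e = Inr e"
  shows "link_verts (Inr e) = {g (e, False), g (e, True)}"
  using assms link_of_Inr_iff edge_ends(1)[OF assms(1)] unfolding link_verts_def cut_edges_def by auto

lemma card_link_verts:
  assumes "l \<in> link_of ` E"
  shows "card (link_verts l) \<in> {2, 3}"
proof -
  obtain e where e: "e \<in> E" "l = link_of e" using assms by blast
  show ?thesis
  proof (cases l)
    case (Inl w)
    then have w: "w \<notin> T" "e \<in> cut_edges E g {w}" using link_of_Inl_iff[OF e(1)] e(2) by auto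
    have "card (link_verts l) = card (cut_edges E g {w})"
      unfolding Inl link_verts_Inl[OF w(1)] by (rule card_image[OF inj_on_opposite[OF w(1)]])
    then show ?thesis using degree_ge_2[OF w] degree_le_3[OF w(1)] by auto
  next
    case (Inr f)
    then have "link_of e = Inr e" "l = Inr e" using e(2) link_of_Inr_iff by auto
    then show ?thesis using link_verts_Inr[OF e(1)] edge_ends(1)[OF e(1)] by simp
  qed
qed

lemma finite_link_verts: "finite (link_verts l)"
  unfolding link_verts_def using finite_terminals by simp

text \<open>A vertex outside \<open>T\<close> with at least two neighbours in \<open>X\<close> is moved to the side of \<open>X\<close>; each link
  then contributes at most one edge to the cut.\<close>

definition majority :: "'v set \<Rightarrow> 'v set" where
  "majority X = {w. w \<notin> T \<and> 2 \<le> card (link_verts (Inl w) \<inter> X)}"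

lemma star_edge_in_cut_iff:
  assumes X: "X \<subseteq> T" and w: "w \<notin> T" and e: "e \<in> cut_edges E g {w}"
  shows "e \<in> cut_edges E g (X \<union> majority X) \<longleftrightarrow> (opp w e \<in> X \<longleftrightarrow> w \<notin> majority X)"
proof -
  have "opp w e \<notin> majority X" "w \<notin> X"
    using opposite_tight_terminal(1)[OF w e] w X unfolding majority_def by auto
  then show ?thesis using opposite_cases[OF e] in_E_if_in_cut[OF e] unfolding cut_edges_def by auto
qed

lemma link_of_cut_splits:
  assumes X: "X \<subseteq> T" and e: "e \<in> cut_edges E g (X \<union> majority X)"
  shows "splits X (link_verts (link_of e))"
proof (cases "link_of e")
  case (Inl w)
  note eE = in_E_if_in_cut[OF e]
  have w: "w \<notin> T" "e \<in> cut_edges E g {w}" using link_of_Inl_iff[OF eE] Inl by auto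
  have opp_e: "opp w e \<in> link_verts (Inl w)" using link_verts_Inl[OF w(1)] w(2) by blast
  have "2 \<le> card (link_verts (Inl w))" using card_link_verts[of "Inl w"] Inl eE by force
  then have "w \<notin> majority X \<Longrightarrow> \<not> link_verts (Inl w) \<subseteq> X"
    using w(1) unfolding majority_def by (auto simp: Int_absorb2)
  moreover have "w \<in> majority X \<Longrightarrow> link_verts (Inl w) \<inter> X \<noteq> {}" unfolding majority_def by auto
  ultimately show ?thesis using star_edge_in_cut_iff[OF X w] e opp_e unfolding Inl splits_def by blast
next
  case (Inr f)
  then have "link_of e = Inr e" "g (e, False) \<in> T" "g (e, True) \<in> T" using link_of_Inr_iff by auto
  then show ?thesis
    using e link_verts_Inr[OF in_E_if_in_cut[OF e]] unfolding splits_def cut_edges_def majority_def by auto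
qed

lemma inj_on_link_of_cut:
  assumes X: "X \<subseteq> T"
  shows "inj_on link_of (cut_edges E g (X \<union> majority X))"
proof (rule inj_onI, rule ccontr)
  fix e f assume e: "e \<in> cut_edges E g (X \<union> majority X)" and f: "f \<in> cut_edges E g (X \<union> majority X)"
    and eq: "link_of e = link_of f" and ne: "e \<noteq> f"
  show False
  proof (cases "link_of e")
    case (Inl w)
    then have w: "w \<notin> T" "e \<in> cut_edges E g {w}" "f \<in> cut_edges E g {w}"
      using link_of_Inl_iff e f eq in_E_if_in_cut by metis+
    let ?N = "link_verts (Inl w)"
    have "opp w e \<noteq> opp w f" using inj_on_opposite[OF w(1)] w ne unfolding inj_on_def by blast
    then have two: "2 \<le> card S" if "{opp w e, opp w f} \<subseteq> S" "finite S" for S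
      using card_mono[OF that(2,1)] by simp
    have opp: "{opp w e, opp w f} \<subseteq> ?N" using link_verts_Inl[OF w(1)] w by blast
    have sides: "opp w e \<in> X \<longleftrightarrow> w \<notin> majority X" "opp w f \<in> X \<longleftrightarrow> w \<notin> majority X"
      using star_edge_in_cut_iff[OF X w(1)] w e f by blast+
    show False
    proof (cases "w \<in> majority X")
      case True
      then have "2 \<le> card (?N - X)" using opp sides finite_link_verts by (intro two) auto
      moreover have "2 \<le> card (?N \<inter> X)" using True unfolding majority_def by simp
      moreover have "card ?N = card (?N \<inter> X) + card (?N - X)" by (rule card_Int_Diff[OF finite_link_verts])
      moreover have "card ?N \<le> 3" using card_link_verts[of "Inl w"] Inl in_E_if_in_cut[OF e] by force
      ultimately show False by linarith
    next
      case False
      then have "2 \<le> card (?N \<inter> X)" using opp sides finite_link_verts by (intro two) auto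
      then show False using False w(1) unfolding majority_def by simp
    qed
  next
    case (Inr a)
    then show False using eq ne link_of_Inr_iff by metis
  qed
qed

lemma link_cut_ge:
  assumes X: "X \<subseteq> T" "X \<noteq> {}" "X \<noteq> T"
  shows "6 * k + 6 \<le> card {l \<in> link_of ` E. splits X (link_verts l)}"
proof -
  let ?C = "cut_edges E g (X \<union> majority X)"
  have "(X \<union> majority X) \<inter> T = X" using X(1) unfolding majority_def by auto
  then have "6 * k + 6 \<le> card ?C" using X by (intro cut_ge) auto
  also have "\<dots> = card (link_of ` ?C)" by (rule card_image[OF inj_on_link_of_cut[OF X(1)], symmetric])
  also have "\<dots> \<le> card {l \<in> link_of ` E. splits X (link_verts l)}"
    using link_of_cut_splits[OF X(1)] in_E_if_in_cut finite_edges by (intro card_mono) auto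
  finally show ?thesis .
qed

lemma incident_links: "t \<in> T \<Longrightarrow> {l \<in> link_of ` E. t \<in> link_verts l} = link_of ` cut_edges E g {t}"
  unfolding link_verts_def using in_E_if_in_cut[of _ "{t}"] by (auto, metis imageI)

sublocale links: rooted_hypergraph "link_of ` E" link_verts T v k
proof
  have "card {l \<in> link_of ` E. v \<in> link_verts l} = card (cut_edges E g {v})"
    unfolding incident_links[OF root(1)] by (rule card_image[OF inj_on_link_of[OF root(1)]])
  then show "card {l \<in> link_of ` E. v \<in> link_verts l} = 6 * k + 6" using root_tight by simp
  show "finite (link_of ` E)" using finite_edges by simp
  show "link_verts l \<subseteq> T" for l unfolding link_verts_def by blast
qed (use finite_terminals root(1) card_link_verts link_cut_ge in auto)

lemma incident_eq: "t \<in> T \<Longrightarrow> links.incident t = link_of ` cut_edges E g {t}"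
  unfolding links.incident_def by (rule incident_links)

end

locale star_extension = star_graph E g T k v
  for E :: "'e set" and g :: "'e \<times> bool \<Rightarrow> 'v" and T :: "'v set" and k :: nat and v :: 'v +
  fixes good :: "'v \<Rightarrow> ('v + 'e) set" and r :: "'v \<Rightarrow> nat" and \<phi> :: "'v + 'e \<Rightarrow> nat"
    and P :: "'v + 'e \<Rightarrow> 'v set" and c :: "'v + 'e \<Rightarrow> nat"
  assumes extension: "links.extension good r \<phi> P c"
begin

lemma trace: "l \<in> link_of ` E \<Longrightarrow> P l \<subseteq> link_verts l \<and> card (P l) = 2 \<and> c l \<le> k"
  and root_colour: "l \<in> links.incident v \<Longrightarrow> links.colour_at P c l v = \<phi> l"
  and trace_linked: "i \<in> {1..k} \<Longrightarrow> s \<in> T - {v} \<Longrightarrow> t \<in> T - {v} \<Longrightarrow>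
      equivclp (hyperadj P {l \<in> link_of ` E. c l = i \<and> v \<notin> P l}) s t"
  and reserved: "t \<in> T - {v} \<Longrightarrow> r t \<le> card {l \<in> links.incident t \<inter> good t. links.colour_at P c l t = 0}"
  using extension unfolding links.extension_def by blast+

definition edge_colour :: "'e \<Rightarrow> nat" where
  "edge_colour e = (if \<forall>t\<in>T. e \<in> cut_edges E g {t} \<longrightarrow> t \<in> P (link_of e) then c (link_of e) else 0)"

lemma edge_colour_eq:
  assumes t: "t \<in> T" "e \<in> cut_edges E g {t}"
  shows "edge_colour e = links.colour_at P c (link_of e) t"
proof -
  note eE = in_E_if_in_cut[OF t(2)]
  have "t' \<in> P (link_of e) \<longleftrightarrow> t \<in> P (link_of e)" if t': "t' \<in> T" "e \<in> cut_edges E g {t'}" for t'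
  proof (cases "link_of e")
    case (Inl w)
    then have "w \<notin> T" "e \<in> cut_edges E g {w}" using link_of_Inl_iff[OF eE] by auto
    then show ?thesis using opposite_eq_terminal t t' by metis
  next
    case (Inr f)
    then have e: "link_of e = Inr e" using link_of_Inr_iff by simp
    have "card (link_verts (link_of e)) = 2" using link_verts_Inr[OF eE e] edge_ends(1)[OF eE] e by simp
    then have "P (link_of e) = link_verts (link_of e)"
      using trace[of "link_of e"] eE finite_link_verts by (metis card_subset_eq imageI)
    then show ?thesis using t t' unfolding link_verts_def by blast
  qed
  then have "(\<forall>t'\<in>T. e \<in> cut_edges E g {t'} \<longrightarrow> t' \<in> P (link_of e)) \<longleftrightarrow> t \<in> P (link_of e)" using t by blast
  then show ?thesis unfolding edge_colour_def links.colour_at_def by simp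
qed

lemma edge_colour_half_edge:
  assumes "fst h \<in> E" "g h \<in> T"
  shows "edge_colour (fst h) = (if g h \<in> P (link_of (fst h)) then c (link_of (fst h)) else 0)"
  using edge_colour_eq[OF assms(2) half_edge_in_cut[OF assms(1)]] unfolding links.colour_at_def .

lemma edge_colour_le: "e \<in> E \<Longrightarrow> edge_colour e \<le> k"
  unfolding edge_colour_def using trace by simp

lemma obtain_trace_half_edge:
  assumes "l \<in> link_of ` E" "t \<in> P l"
  obtains h where "fst h \<in> E" "g h = t" "link_of (fst h) = l" "edge_colour (fst h) = c l" "t \<in> T"
proof -
  have "t \<in> link_verts l" using trace assms by blast
  then obtain e where e: "t \<in> T" "e \<in> cut_edges E g {t}" "link_of e = l" unfolding link_verts_def by blast
  obtain h where h: "fst h = e" "g h = t" by (rule obtain_half_edge[OF e(2)])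
  have "edge_colour e = c l"
    using edge_colour_eq[OF e(1,2)] e(3) assms(2) unfolding links.colour_at_def by simp
  then show thesis using that[of h] h e in_E_if_in_cut by blast
qed

definition coloured_at :: "'v \<Rightarrow> ('e \<times> bool) set" where
  "coloured_at w = {h. fst h \<in> E \<and> g h = w \<and> edge_colour (fst h) \<noteq> 0}"

lemma coloured_star:
  assumes h: "h \<in> coloured_at w" and w: "w \<notin> T"
  shows "link_of (fst h) = Inl w" "g (flip h) \<in> P (Inl w)" "edge_colour (fst h) = c (Inl w)"
proof -
  have h: "fst h \<in> E" "g h = w" "edge_colour (fst h) \<noteq> 0" using h unfolding coloured_at_def by auto
  show link: "link_of (fst h) = Inl w" using link_of_Inl_iff half_edge_in_cut[OF h(1)] h(1,2) w by blast
  have "g (flip h) \<in> T" using terminal_end[OF h(1)] h(2) w by simp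
  then show "g (flip h) \<in> P (Inl w)" "edge_colour (fst h) = c (Inl w)"
    using edge_colour_half_edge[of "flip h"] h(1,3) link by (auto split: if_splits)
qed

lemma card_coloured_at:
  assumes w: "w \<notin> T" and nonempty: "coloured_at w \<noteq> {}"
  shows "card (coloured_at w) = 2"
proof -
  obtain h\<^sub>0 where h0: "h\<^sub>0 \<in> coloured_at w" using nonempty by blast
  then have link: "Inl w \<in> link_of ` E" and colour: "c (Inl w) \<noteq> 0"
    using coloured_star[OF h0 w] unfolding coloured_at_def by force+
  have "bij_betw (\<lambda>h. g (flip h)) (coloured_at w) (P (Inl w))"
    unfolding bij_betw_def
  proof
    show "inj_on (\<lambda>h. g (flip h)) (coloured_at w)"
    proof (rule inj_onI)
      fix h h' assume hh': "h \<in> coloured_at w" "h' \<in> coloured_at w" "g (flip h) = g (flip h')"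
      then have at: "fst h \<in> E" "g h = w" "fst h' \<in> E" "g h' = w" unfolding coloured_at_def by auto
      then have "opp w (fst h) = opp w (fst h')" using opposite_flip hh'(3) w by metis
      then have "fst h = fst h'" using inj_onD[OF inj_on_opposite[OF w]] half_edge_in_cut at by metis
      then show "h = h'" using half_edge_eqI at by metis
    qed
    have "\<exists>h\<in>coloured_at w. g (flip h) = t" if t: "t \<in> P (Inl w)" for t
    proof -
      obtain h where h: "fst h \<in> E" "g h = t"
          "link_of (fst h) = Inl w" "edge_colour (fst h) = c (Inl w)" "t \<in> T"
        by (rule obtain_trace_half_edge[OF link t])
      then have "fst h \<in> cut_edges E g {w}" using link_of_Inl_iff by blast
      then have "g (flip h) = w" using h(2,5) w unfolding half_edge_in_cut_iff by auto
      then have "flip h \<in> coloured_at w" using h colour unfolding coloured_at_def by simp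
      then show ?thesis using h(2) by (intro bexI[of _ "flip h"]) simp
    qed
    then show "(\<lambda>h. g (flip h)) ` coloured_at w = P (Inl w)" using coloured_star(2)[OF _ w] by blast
  qed
  then have "card (coloured_at w) = card (P (Inl w))" by (rule bij_betw_same_card)
  then show ?thesis using trace[OF link] by simp
qed

definition partner :: "'e \<times> bool \<Rightarrow> 'e \<times> bool" where
  "partner h = the_elem (coloured_at (g h) - {h})"

lemma coloured_at_eq:
  assumes h: "h \<in> coloured_at w" and w: "w \<notin> T"
  shows "coloured_at w = {h, partner h}" "partner h \<noteq> h"
proof -
  have "g h = w" using h unfolding coloured_at_def by simp
  have "card (coloured_at w) = 2" using card_coloured_at[OF w] h by blast
  then have "card (coloured_at w - {h}) = 1" using h by (simp add: card_Diff_singleton)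
  then obtain h' where "coloured_at w - {h} = {h'}" by (auto simp: card_1_singleton_iff)
  then show "coloured_at w = {h, partner h}" "partner h \<noteq> h"
    using h unfolding partner_def \<open>g h = w\<close> by auto
qed

abbreviation colour_class :: "nat \<Rightarrow> 'e set" where "colour_class i \<equiv> {e \<in> E. edge_colour e = i}"

lemma mating_partner:
  assumes "i \<noteq> 0"
  shows "mating (colour_class i) g T partner"
  unfolding mating_def
proof (intro allI impI)
  fix h assume "fst h \<in> colour_class i \<and> g h \<notin> T"
  then have h: "h \<in> coloured_at (g h)" "g h \<notin> T" "edge_colour (fst h) = i"
    using assms unfolding coloured_at_def by auto
  note eq = coloured_at_eq[OF h(1,2)]
  have p: "partner h \<in> coloured_at (g h)" using eq(1) by blast
  then have "edge_colour (fst (partner h)) = i" using coloured_star(3)[OF _ h(2)] h by metis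
  moreover have "partner (partner h) = h" using coloured_at_eq[OF p h(2)] eq by auto
  ultimately show "fst (partner h) \<in> colour_class i \<and> partner h \<noteq> h \<and> partner (partner h) = h \<and>
      g (partner h) = g h"
    using p eq(2) unfolding coloured_at_def by simp
qed

abbreviation link :: "nat \<Rightarrow> 'e \<times> bool \<Rightarrow> 'e \<times> bool \<Rightarrow> bool" where
  "link i \<equiv> linked (colour_class i) g T (T - {v}) partner"

lemma turn:
  assumes "fst h \<in> colour_class i" "fst h' \<in> colour_class i" "g h \<in> T - {v}" "g h' = g h"
  shows "link i h h'"
  using assms unfolding trail_step_def by (intro r_into_equivclp) blast

lemma same_link_linked:
  assumes h: "fst h \<in> colour_class i" and h': "fst h' \<in> colour_class i" and i: "i \<noteq> 0"
    and T: "g h \<in> T" "g h' \<in> T" and same: "link_of (fst h) = link_of (fst h')"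
  shows "link i h h'"
proof (cases "link_of (fst h)")
  case (Inl w)
  have w: "w \<notin> T" using link_of_Inl_iff h Inl by blast
  have flip_at: "flip p \<in> coloured_at w" if "fst p \<in> colour_class i" "g p \<in> T" "link_of (fst p) = Inl w" for p
  proof -
    have "fst p \<in> cut_edges E g {w}" using link_of_Inl_iff that by blast
    then have "g (flip p) = w" using that(2) w unfolding half_edge_in_cut_iff by auto
    then show ?thesis using that(1) i unfolding coloured_at_def by simp
  qed
  have at: "flip h \<in> coloured_at w" "flip h' \<in> coloured_at w"
    using flip_at[OF h T(1)] flip_at[OF h' T(2)] Inl same by simp_all
  then consider (same) "flip h' = flip h" | (partner) "flip h' = partner (flip h)"
    using coloured_at_eq(1)[OF at(1) w] by blast
  then have "link i (flip h) (flip h')"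
  proof cases
    case partner
    moreover have "g (flip h) \<notin> T" using at(1) w unfolding coloured_at_def by auto
    ultimately have "trail_step (colour_class i) g T (T - {v}) partner (flip h) (flip h')"
      using h h' unfolding trail_step_def flip_simps(1) by blast
    then show ?thesis by blast
  qed simp
  moreover have "link i h (flip h)" "link i h' (flip h')" using h h' by (auto intro: linked_flip)
  ultimately show ?thesis by (meson equivclp_sym equivclp_trans)
next
  case (Inr f)
  then have "fst h = fst h'" using same link_of_Inr_iff by metis
  then have "h' = h \<or> h' = flip h" by (rule eq_or_flip_if_same_edge)
  then show ?thesis using linked_flip[OF h] by auto
qed

lemma linked_off_root:
  assumes i: "i \<in> {1..k}" and h: "fst h \<in> colour_class i" "g h \<in> T - {v}"
    and h': "fst h' \<in> colour_class i" "g h' \<in> T - {v}"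
  shows "link i h h'"
proof -
  have "equivclp (hyperadj P {l \<in> link_of ` E. c l = i \<and> v \<notin> P l}) (g h) (g h')"
    using trace_linked[OF i h(2) h'(2)] .
  then show ?thesis using h'
  proof (induction "g h'" arbitrary: h' rule: equivclp_induct)
    case base
    then show ?case using h by (intro turn) auto
  next
    case (step y)
    then obtain l where l: "l \<in> link_of ` E" "c l = i" "v \<notin> P l" "y \<in> P l" "g h' \<in> P l"
      unfolding hyperadj_def by blast
    obtain p where p: "fst p \<in> E" "g p = y" "link_of (fst p) = l" "edge_colour (fst p) = c l" "y \<in> T"
      by (rule obtain_trace_half_edge[OF l(1,4)])
    obtain q where q: "fst q \<in> E" "g q = g h'" "link_of (fst q) = l" "edge_colour (fst q) = c l" "g h' \<in> T"
      by (rule obtain_trace_half_edge[OF l(1,5)])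
    have "y \<noteq> v" using l by blast
    then have "link i h p" using step(3)[of p] p l(2) by auto
    moreover have "link i p q" using p q l(2) i by (intro same_link_linked) auto
    moreover have "link i q h'" using q l(2) step(4,5) by (intro turn) auto
    ultimately show ?case by (meson equivclp_trans)
  qed
qed

lemma obtain_linked_off_root:
  assumes i: "i \<in> {1..k}" and h: "fst h \<in> colour_class i" "g h \<in> T"
  obtains q where "fst q \<in> colour_class i" "g q \<in> T - {v}" "link i h q"
proof (cases "g h = v")
  case False
  then show thesis using that[of h] h by simp
next
  case True
  let ?l = "link_of (fst h)"
  have l: "?l \<in> link_of ` E" using h by blast
  have colour: "g h \<in> P ?l" "c ?l = i" using edge_colour_half_edge[of h] h i by (auto split: if_splits)
  obtain t where t: "t \<in> P ?l" "t \<noteq> v"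
    using trace[OF l] colour(1) True by (metis card_2_iff' )
  obtain q where q: "fst q \<in> E" "g q = t" "link_of (fst q) = ?l" "edge_colour (fst q) = c ?l" "t \<in> T"
    by (rule obtain_trace_half_edge[OF l t(1)])
  have "link i h q" using h q colour(2) i by (intro same_link_linked) auto
  then show thesis using that[of q] q t colour(2) by simp
qed

lemma colour_class_meets:
  assumes i: "i \<in> {1..k}" and s: "s \<in> T - {v}" and "T - {v} \<noteq> {s} \<or> meets (colour_class i) g v"
  shows "meets (colour_class i) g s"
proof (cases "T - {v} = {s}")
  case True
  then obtain h where h: "fst h \<in> colour_class i" "g h = v" using assms(3) unfolding meets_def by blast
  obtain q where "fst q \<in> colour_class i" "g q \<in> T - {v}"
    by (rule obtain_linked_off_root[OF i h(1)]) (use h root in auto)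
  then show ?thesis using True unfolding meets_def by blast
next
  case False
  then obtain t where t: "t \<in> T - {v}" "t \<noteq> s" using s by blast
  have "equivclp (hyperadj P {l \<in> link_of ` E. c l = i \<and> v \<notin> P l}) t s" by (rule trace_linked[OF i t(1) s])
  then obtain y where "hyperadj P {l \<in> link_of ` E. c l = i \<and> v \<notin> P l} y s \<or>
      hyperadj P {l \<in> link_of ` E. c l = i \<and> v \<notin> P l} s y"
    using t(2) by (induction rule: equivclp_induct) auto
  then obtain l where l: "l \<in> link_of ` E" "c l = i" "s \<in> P l" unfolding hyperadj_def by blast
  obtain h where "fst h \<in> E" "g h = s" "edge_colour (fst h) = c l" by (rule obtain_trace_half_edge[OF l(1,3)])
  then show ?thesis using l(2) unfolding meets_def by blast
qed

lemma rooted_connection_colour_class: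
  assumes i: "i \<in> {1..k}"
  shows "rooted_connection (colour_class i) g T v partner"
  unfolding rooted_connection_def
proof (intro conjI allI ballI impI)
  show "mating (colour_class i) g T partner" by (rule mating_partner) (use i in simp)
  fix h h' assume "fst h \<in> colour_class i \<and> fst h' \<in> colour_class i \<and> g h \<in> T \<and> g h' \<in> T"
  then have h: "fst h \<in> colour_class i" "g h \<in> T" and h': "fst h' \<in> colour_class i" "g h' \<in> T" by auto
  obtain q where q: "fst q \<in> colour_class i" "g q \<in> T - {v}" "link i h q"
    by (rule obtain_linked_off_root[OF i h])
  obtain q' where q': "fst q' \<in> colour_class i" "g q' \<in> T - {v}" "link i h' q'"
    by (rule obtain_linked_off_root[OF i h'])
  have "link i q q'" by (rule linked_off_root[OF i q(1,2) q'(1,2)])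
  then show "link i h h'" using q(3) q'(3) by (meson equivclp_sym equivclp_trans)
qed (use colour_class_meets[OF i] in blast)

lemma solution_edge_colour:
  assumes good: "\<And>t. t \<in> T \<Longrightarrow> links.incident t \<inter> good t \<subseteq> link_of ` (cut_edges E g {t} \<inter> G t)"
    and \<phi>: "\<And>e. e \<in> cut_edges E g {v} \<Longrightarrow> \<phi> (link_of e) = \<psi> e"
  shows "solution E g T v k G r \<psi> edge_colour partner"
  unfolding solution_def routing_def
proof (intro conjI ballI)
  show "edge_colour e \<le> k" if "e \<in> E" for e by (rule edge_colour_le[OF that])
  show "rooted_connection (colour_class i) g T v partner" if "i \<in> {1..k}" for i
    by (rule rooted_connection_colour_class[OF that])
  show "edge_colour e = \<psi> e" if "e \<in> cut_edges E g {v}" for e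
    using edge_colour_eq[OF root(1) that] root_colour[of "link_of e"] incident_eq[OF root(1)] \<phi>[OF that] that
    by simp
  fix t assume t: "t \<in> T - {v}"
  let ?B = "{e \<in> cut_edges E g {t} \<inter> G t. edge_colour e = 0}"
  have "{l \<in> links.incident t \<inter> good t. links.colour_at P c l t = 0} \<subseteq> link_of ` ?B"
    using good[of t] edge_colour_eq[of t] t by fastforce
  then have "card {l \<in> links.incident t \<inter> good t. links.colour_at P c l t = 0} \<le> card ?B"
    by (rule surj_card_le[rotated]) (simp add: finite_edges)
  then show "r t \<le> card ?B" using reserved[OF t] by linarith
qed

end

theorem (in star_graph) star_graph_solvable: "solvable E g T v k"
  unfolding solvable_def
proof (intro allI impI)
  fix good :: "'v \<Rightarrow> 'e set" and r :: "'v \<Rightarrow> nat"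
  assume demand: "\<forall>t\<in>T - {v}. admissible k (cut_edges E g {t}) (good t) (r t)"
  define good' where "good' t = link_of ` (cut_edges E g {t} \<inter> good t)" for t
  have "admissible k (links.incident t) (good' t) (r t)" if t: "t \<in> T - {v}" for t
  proof -
    have inj: "inj_on link_of (cut_edges E g {t})" using inj_on_link_of t by blast
    then have "cut_edges E g {t} - link_of -` good' t = cut_edges E g {t} - good t"
      unfolding good'_def inj_on_def by blast
    then have "admissible k (cut_edges E g {t}) (link_of -` good' t) (r t)"
      using demand t unfolding admissible_def by simp
    then show ?thesis using admissible_vimage[OF inj] incident_eq t by simp
  qed
  then have "extends_precolourings k (links.incident v) (\<lambda>\<phi>. \<exists>P c. links.extension good' r \<phi> P c)"
    by (rule links.hypergraph_extends_precolourings[OF root(2)])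
  then have "extends_precolourings k (link_of ` cut_edges E g {v}) (\<lambda>\<phi>. \<exists>P c. links.extension good' r \<phi> P c)"
    unfolding incident_eq[OF root(1)] .
  then show "extends_precolourings k (cut_edges E g {v}) (\<lambda>\<phi>. \<exists>c m. solution E g T v k good r \<phi> c m)"
  proof (rule extends_precolourings_image[OF inj_on_link_of[OF root(1)]])
    fix \<phi> \<phi>' assume \<phi>: "\<And>e. e \<in> cut_edges E g {v} \<Longrightarrow> \<phi>' (link_of e) = \<phi> e"
      and "\<exists>P c. links.extension good' r \<phi>' P c"
    then obtain P c where "links.extension good' r \<phi>' P c" by blast
    then interpret star_extension E g T k v good' r \<phi>' P c by unfold_locales
    have "solution E g T v k good r \<phi> edge_colour partner"
      by (rule solution_edge_colour[OF _ \<phi>]) (auto simp: good'_def)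
    then show "\<exists>c m. solution E g T v k good r \<phi> c m" by blast
  qed
qed

section \<open>Solvability of rooted graphs\<close>

lemma rootedD:
  assumes "rooted E g T v k"
  shows "finite E" "finite T" "v \<in> T" "T - {v} \<noteq> {}" "card (cut_edges E g {v}) = 6 * k + 6"
    and "\<And>X. X \<inter> T \<noteq> {} \<Longrightarrow> T - X \<noteq> {} \<Longrightarrow> 6 * k + 6 \<le> card (cut_edges E g X)"
  using assms unfolding rooted_def by blast+

definition nontrivial_tight :: "'e set \<Rightarrow> ('e \<times> bool \<Rightarrow> 'v) \<Rightarrow> 'v set \<Rightarrow> nat \<Rightarrow> 'v set \<Rightarrow> bool" where
  "nontrivial_tight E g T k X \<longleftrightarrow> X \<inter> T \<noteq> {} \<and> T - X \<noteq> {} \<and> card (cut_edges E g X) = 6 * k + 6 \<and>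
     2 \<le> card (vertex_set E g T \<inter> X) \<and> 2 \<le> card (vertex_set E g T - X)"

lemma nontrivial_tight_Compl: "nontrivial_tight E g T k (- X) \<longleftrightarrow> nontrivial_tight E g T k X"
proof -
  have "- X \<inter> T = T - X" "T - - X = X \<inter> T" "vertex_set E g T \<inter> - X = vertex_set E g T - X"
    "vertex_set E g T - - X = vertex_set E g T \<inter> X" by auto
  then show ?thesis unfolding nontrivial_tight_def by auto
qed

lemma graph_size_contract:
  assumes fin: "finite E" "finite T" and t: "t \<in> T" "t \<notin> X" and two: "2 \<le> card (vertex_set E g T - X)"
  shows "graph_size (contract_edges E g X) (contract_map g X t) (insert t (T \<inter> X)) < graph_size E g T"
proof -
  let ?E = "contract_edges E g X" and ?g = "contract_map g X t" and ?T = "insert t (T \<inter> X)"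
  let ?V = "vertex_set E g T" and ?V' = "vertex_set ?E ?g ?T"
  have finite_V: "finite ?V" using fin by (rule finite_vertex_set)
  have sub: "?V' \<subseteq> insert t (?V \<inter> X)"
  proof
    fix u
    assume "u \<in> ?V'"
    then consider (terminal) "u \<in> ?T" | (half_edge) h where "fst h \<in> E" "u = ?g h"
      using contract_edges_subset[of E g X] unfolding vertex_set_def by fastforce
    then show "u \<in> insert t (?V \<inter> X)"
    proof cases
      case terminal
      then show ?thesis using terminals_subset_vertex_set[of T E g] by blast
    next
      case (half_edge h)
      then show ?thesis using half_edge_in_vertex_set[of h E g T] unfolding contract_map_def by simp
    qed
  qed
  have "card ?V' \<le> card (insert t (?V \<inter> X))" using sub finite_V by (intro card_mono) auto
  also have "\<dots> \<le> card (?V \<inter> X) + 1" by (simp add: card_insert_if finite_V)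
  also have "\<dots> < card (?V \<inter> X) + card (?V - X)" using two by simp
  also have "\<dots> = card ?V" using finite_V by (rule card_Int_Diff[symmetric])
  finally have "card ?V' < card ?V" .
  moreover have "card ?E \<le> card E" by (rule card_mono[OF fin(1) contract_edges_subset])
  moreover have "(\<Sum>w\<in>?V' - ?T. (card (cut_edges ?E ?g {w}))\<^sup>2) = (\<Sum>w\<in>?V' - ?T. (card (cut_edges E g {w}))\<^sup>2)"
    using sub cut_contract_inside[OF t(2), of _ E g] by (intro sum.cong refl) force
  moreover have "\<dots> \<le> (\<Sum>w\<in>?V - T. (card (cut_edges E g {w}))\<^sup>2)"
    by (rule sum_mono2) (use finite_V sub in auto)
  ultimately show ?thesis unfolding graph_size_def by linarith
qed

lemma rooted_contract_inside:
  assumes G: "rooted E g T v k" and "v \<notin> X" "X \<inter> T \<noteq> {}" "card (cut_edges E g X) = 6 * k + 6"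
  shows "rooted (contract_edges E g X) (contract_map g X v) (insert v (T \<inter> X)) v k"
  unfolding rooted_def
proof (intro conjI allI impI)
  show "finite (contract_edges E g X)"
    using rootedD(1)[OF G] contract_edges_subset by (rule finite_subset[rotated])
  show "insert v (T \<inter> X) - {v} \<noteq> {}" using assms(2,3) by blast
  show "card (cut_edges (contract_edges E g X) (contract_map g X v) {v}) = 6 * k + 6"
    unfolding cut_contract_root[OF assms(2)] by (rule assms(4))
  show "6 * k + 6 \<le> card (cut_edges (contract_edges E g X) (contract_map g X v) Z)"
    if "Z \<inter> insert v (T \<inter> X) \<noteq> {}" "insert v (T \<inter> X) - Z \<noteq> {}" for Z
    by (rule card_cut_contract_ge[OF _ rootedD(3)[OF G] assms(2) that]) (rule rootedD(6)[OF G])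
qed (use rootedD[OF G] in simp_all)

lemma rooted_contract_outside:
  assumes G: "rooted E g T v k" and vX: "v \<notin> X" and s: "s \<in> T" "s \<in> X"
  shows "rooted (contract_edges E g (- X)) (contract_map g (- X) s) (insert s (T - X)) v k"
  unfolding rooted_def
proof (intro conjI allI impI)
  have sX: "s \<notin> - X" using s by simp
  have T: "T - X = T \<inter> - X" by blast
  show "finite (contract_edges E g (- X))"
    using rootedD(1)[OF G] contract_edges_subset by (rule finite_subset[rotated])
  show "v \<in> insert s (T - X)" "finite (insert s (T - X))" using rootedD[OF G] vX by simp_all
  show "insert s (T - X) - {v} \<noteq> {}" using s vX by auto
  show "card (cut_edges (contract_edges E g (- X)) (contract_map g (- X) s) {v}) = 6 * k + 6"
    using cut_contract_inside[OF sX, of v E g] vX rootedD(5)[OF G] by simp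
  show "6 * k + 6 \<le> card (cut_edges (contract_edges E g (- X)) (contract_map g (- X) s) Z)"
    if "Z \<inter> insert s (T - X) \<noteq> {}" "insert s (T - X) - Z \<noteq> {}" for Z
    using that unfolding T by (intro card_cut_contract_ge[OF _ s(1) sX] rootedD(6)[OF G])
qed

lemma tight_set_trivial:
  assumes fin: "finite E" "finite T" and none: "\<And>X. \<not> nontrivial_tight E g T k X"
    and X: "X \<inter> T \<noteq> {}" "T - X \<noteq> {}" "X \<subseteq> vertex_set E g T" "card (cut_edges E g X) = 6 * k + 6"
  shows "(\<exists>t. X = {t}) \<or> (\<exists>t. vertex_set E g T - X = {t})"
proof -
  let ?V = "vertex_set E g T"
  have "finite ?V" using fin by (rule finite_vertex_set)
  moreover have "X \<noteq> {}" "?V - X \<noteq> {}" using X(1,2) terminals_subset_vertex_set[of T E g] by auto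
  ultimately have "card X \<noteq> 0" "card (?V - X) \<noteq> 0" using X(3) finite_subset[of X ?V] by auto
  moreover have "?V \<inter> X = X" using X(3) by blast
  then have "\<not> (2 \<le> card X \<and> 2 \<le> card (?V - X))" using none[of X] X unfolding nontrivial_tight_def by simp
  ultimately have "card X = 1 \<or> card (?V - X) = 1" by linarith
  then show ?thesis by (metis card_1_singletonE)
qed


lemma tight_cut_eq_terminal_cut:
  assumes fin: "finite E" "finite T" and none: "\<And>X. \<not> nontrivial_tight E g T k X"
    and X: "X \<inter> T \<noteq> {}" "T - X \<noteq> {}" "card (cut_edges E g X) = 6 * k + 6"
  obtains t where "t \<in> T" "cut_edges E g {t} = cut_edges E g X"
proof -
  let ?V = "vertex_set E g T"
  define Y where "Y = X \<inter> ?V"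
  have TV: "T \<subseteq> ?V" by (rule terminals_subset_vertex_set)
  have cut_Y: "cut_edges E g Y = cut_edges E g X" unfolding Y_def by (rule cut_Int_vertex_set)
  have Y: "Y \<inter> T \<noteq> {}" "T - Y \<noteq> {}" "Y \<subseteq> ?V" using X(1,2) TV unfolding Y_def by auto
  then consider (single) t where "Y = {t}" | (cosingle) t where "?V - Y = {t}"
    using tight_set_trivial[OF fin none Y] cut_Y X(3) by auto
  then show thesis
  proof cases
    case single
    then show thesis using that[of t] Y(1) cut_Y by auto
  next
    case (cosingle t)
    have "- Y \<inter> ?V = {t}" using cosingle by blast
    then have "cut_edges E g {t} = cut_edges E g Y" using cut_Int_vertex_set[of E g "- Y" T] by simp
    moreover have "t \<in> T"
    proof -
      obtain u where "u \<in> T" "u \<notin> Y" using Y(2) by blast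
      then show ?thesis using cosingle TV by auto
    qed
    ultimately show thesis using that cut_Y by simp
  qed
qed

lemma cut_edges_delete: "cut_edges (E - {e}) g X = cut_edges E g X - {e}"
  unfolding cut_edges_def by blast

lemma rooted_delete:
  assumes G: "rooted E g T v k" and none: "\<And>X. \<not> nontrivial_tight E g T k X"
    and e: "\<And>t. t \<in> T \<Longrightarrow> card (cut_edges E g {t}) = 6 * k + 6 \<Longrightarrow> e \<notin> cut_edges E g {t}"
  shows "rooted (E - {e}) g T v k"
proof -
  note G' = rootedD[OF G]
  have "6 * k + 6 \<le> card (cut_edges E g X - {e})" if X: "X \<inter> T \<noteq> {}" "T - X \<noteq> {}" for X
  proof (cases "e \<in> cut_edges E g X")
    case True
    have "card (cut_edges E g X) \<noteq> 6 * k + 6"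
      using tight_cut_eq_terminal_cut[OF G'(1,2) none X] e True by metis
    then show ?thesis using G'(1) G'(6)[OF X] True by simp
  qed (use G'(6)[OF X] in simp)
  then show ?thesis
    unfolding rooted_def cut_edges_delete using G' e[OF G'(3,5)] by simp
qed

lemma graph_size_delete:
  assumes "finite E" "finite T" "e \<in> E"
  shows "graph_size (E - {e}) g T < graph_size E g T"
proof -
  let ?V = "vertex_set E g T" and ?V' = "vertex_set (E - {e}) g T"
  have V: "?V' \<subseteq> ?V" "finite ?V" using finite_vertex_set[OF assms(1,2)] unfolding vertex_set_def by auto
  have "(\<Sum>u\<in>?V' - T. (card (cut_edges (E - {e}) g {u}))\<^sup>2) \<le> (\<Sum>u\<in>?V' - T. (card (cut_edges E g {u}))\<^sup>2)"
    using assms(1) unfolding cut_edges_delete by (intro sum_mono power_mono card_mono) auto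
  also have "\<dots> \<le> (\<Sum>u\<in>?V - T. (card (cut_edges E g {u}))\<^sup>2)" using V by (intro sum_mono2) auto
  finally have "(\<Sum>u\<in>?V' - T. (card (cut_edges (E - {e}) g {u}))\<^sup>2) \<le>
      (\<Sum>u\<in>?V - T. (card (cut_edges E g {u}))\<^sup>2)" .
  moreover have "card ?V' \<le> card ?V" using V by (intro card_mono)
  moreover have "card (E - {e}) < card E" by (rule card_Diff1_less[OF assms(1,3)])
  ultimately show ?thesis unfolding graph_size_def by linarith
qed

lemma (in reduced_graph) obtain_opposite_half_edge:
  assumes "w \<notin> T" "e \<in> cut_edges E g {w}"
  obtains h where "fst h = e" "g h = w" "g (flip h) = opp w e" "opp w e \<noteq> w"
proof -
  have "opp w e \<noteq> w" using opposite_tight_terminal(1)[OF assms] assms(1) by metis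
  then show thesis
    using opposite_cases[OF assms(2)] that[of "(e, False)"] that[of "(e, True)"] unfolding flip_def by auto
qed

lemma (in reduced_graph) solvable_by_detaching:
  fixes v z :: 'v
  assumes K: "K = 6 * k + 6" and G: "rooted E g T v k" and deg: "w \<notin> T" "4 \<le> card (cut_edges E g {w})"
    and z: "z \<notin> VV"
    and IH: "\<And>g'. graph_size E g' T < graph_size E g T \<Longrightarrow> rooted E g' T v k \<Longrightarrow> solvable E g' T v k"
  shows "solvable E g T v k"
proof -
  note G' = rootedD[OF G]
  obtain e f where ef: "e \<in> cut_edges E g {w}" "f \<in> cut_edges E g {w}" "e \<noteq> f" and split: "splittable w e f"
    by (rule splittable_pair_exists[OF deg])
  obtain h\<^sub>1 where h1: "fst h\<^sub>1 = e" "g h\<^sub>1 = w" "g (flip h\<^sub>1) = opp w e" "opp w e \<noteq> w"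
    by (rule obtain_opposite_half_edge[OF deg(1) ef(1)])
  obtain h\<^sub>2 where h2: "fst h\<^sub>2 = f" "g h\<^sub>2 = w" "g (flip h\<^sub>2) = opp w f" "opp w f \<noteq> w"
    by (rule obtain_opposite_half_edge[OF deg(1) ef(2)])
  have "e \<in> E" "f \<in> E" using ef unfolding cut_edges_def by auto
  then interpret detached_pair E g T w z h\<^sub>1 h\<^sub>2
    by unfold_locales (use finite_edges finite_terminals ef h1 h2 deg z in simp_all)
  have "K \<le> card (cut_edges E g' X)" if "X \<inter> T \<noteq> {}" "T - X \<noteq> {}" for X
    using cut_ge split that unfolding splittable_def h1(3)[symmetric] h2(3)[symmetric]
    by (intro card_cut_detached_ge) blast+
  then have "rooted E g' T v k"
    unfolding rooted_def using G' terminal_cut_unchanged[OF G'(3)] K by simp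
  then have "solvable E g' T v k" by (rule IH[OF graph_size_detached[OF deg(2)]])
  then show ?thesis by (rule solvable_detached) (fact G'(3,5))+
qed

lemma solvable_without_nontrivial_tight:
  fixes g :: "'e \<times> bool \<Rightarrow> 'v"
  assumes infinite: "infinite (UNIV :: 'v set)" and G: "rooted E g T v k"
    and none: "\<And>X. \<not> nontrivial_tight E g T k X"
    and IH: "\<And>(E' :: 'e set) g'. graph_size E' g' T < graph_size E g T \<Longrightarrow> rooted E' g' T v k \<Longrightarrow>
      solvable E' g' T v k"
  shows "solvable E g T v k"
proof (cases "\<exists>e\<in>E. \<forall>t\<in>T. card (cut_edges E g {t}) = 6 * k + 6 \<longrightarrow> e \<notin> cut_edges E g {t}")
  case True
  note G' = rootedD[OF G]
  obtain e where e: "e \<in> E" "\<And>t. t \<in> T \<Longrightarrow> card (cut_edges E g {t}) = 6 * k + 6 \<Longrightarrow> e \<notin> cut_edges E g {t}"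
    using True by blast
  have "rooted (E - {e}) g T v k" using e(2) by (rule rooted_delete[OF G none])
  then have "solvable (E - {e}) g T v k" by (rule IH[OF graph_size_delete[OF G'(1,2) e(1)]])
  then show ?thesis
    using G'(1,3,5) e(2)
    by (intro solvable_lift[of "E - {e}" E T g]) (auto simp: identifies_def cut_edges_delete)
next
  case False
  note G' = rootedD[OF G]
  interpret reduced_graph E g T "6 * k + 6"
  proof
    show "(\<exists>t. X = {t}) \<or> (\<exists>t. vertex_set E g T - X = {t})"
      if "X \<inter> T \<noteq> {}" "T - X \<noteq> {}" "X \<subseteq> vertex_set E g T" "card (cut_edges E g X) = 6 * k + 6" for X
      using that by (rule tight_set_trivial[OF G'(1,2) none])
    show "\<exists>t\<in>T. card (cut_edges E g {t}) = 6 * k + 6 \<and> e \<in> cut_edges E g {t}" if "e \<in> E" for e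
      using False that by blast
  qed (use G' in simp_all)
  show ?thesis
  proof (cases "\<exists>w. w \<notin> T \<and> 4 \<le> card (cut_edges E g {w})")
    case True
    then obtain w where w: "w \<notin> T" "4 \<le> card (cut_edges E g {w})" by blast
    obtain z where z: "z \<notin> VV"
      using ex_new_if_finite[OF infinite finite_vertex_set[OF finite_edges finite_terminals]] by blast
    show ?thesis by (rule solvable_by_detaching[OF refl G w z IH])
  next
    case False
    interpret star_graph E g T k v
      by unfold_locales (use G' False in \<open>auto simp: not_le\<close>)
    show ?thesis by (rule star_graph_solvable)
  qed
qed

theorem rooted_solvable:
  fixes g :: "'e \<times> bool \<Rightarrow> 'v"
  assumes infinite: "infinite (UNIV :: 'v set)" and "rooted E g T v k"
  shows "solvable E g T v k"
  using assms(2)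
proof (induction "graph_size E g T" arbitrary: E g T v rule: less_induct)
  case less
  note G = rootedD[OF less.prems]
  show ?case
  proof (cases "\<exists>X. nontrivial_tight E g T k X")
    case True
    then obtain X where X: "nontrivial_tight E g T k X" "v \<notin> X"
      using nontrivial_tight_Compl by (metis Compl_iff)
    have X': "2 \<le> card (vertex_set E g T \<inter> X)" "2 \<le> card (vertex_set E g T - X)"
        "card (cut_edges E g X) = 6 * k + 6" "X \<inter> T \<noteq> {}"
      using X(1) unfolding nontrivial_tight_def by auto
    then obtain s where s: "s \<in> T" "s \<in> X" by blast
    have "solvable (contract_edges E g X) (contract_map g X v) (insert v (T \<inter> X)) v k"
      by (rule less.hyps[OF graph_size_contract rooted_contract_inside])
        (use G less.prems X(2) X' in simp_all)
    moreover have "solvable (contract_edges E g (- X)) (contract_map g (- X) s) (insert s (T - X)) v k"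
    proof (rule less.hyps[OF _ rooted_contract_outside[OF less.prems X(2) s]])
      have "T \<inter> - X = T - X" "vertex_set E g T - - X = vertex_set E g T \<inter> X" by auto
      then show "graph_size (contract_edges E g (- X)) (contract_map g (- X) s) (insert s (T - X)) <
          graph_size E g T"
        using graph_size_contract[OF G(1,2) s(1), of "- X" g] s(2) X'(1) by simp
    qed
    ultimately show ?thesis by (rule solvable_glue[OF G(3) X(2) s])
  next
    case False
    then show ?thesis
      using solvable_without_nontrivial_tight[OF infinite less.prems] less.hyps by blast
  qed
qed

section \<open>From trails to connectors\<close>

definition incidence_map :: "('v, 'e) multigraph \<Rightarrow> ('e \<times> bool \<Rightarrow> 'v) \<Rightarrow> bool" where
  "incidence_map H g \<longleftrightarrow> (\<forall>h. fst h \<in> edges H \<longrightarrow> ends H (fst h) = {g h, g (flip h)})"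

lemma incidence_mapD: "incidence_map H g \<Longrightarrow> fst h \<in> edges H \<Longrightarrow> ends H (fst h) = {g h, g (flip h)}"
  unfolding incidence_map_def by blast

lemma incidence_map_exists:
  assumes "wf_multigraph H"
  shows "\<exists>g. incidence_map H g"
proof -
  have "\<forall>e\<in>edges H. \<exists>u v. ends H e = {u, v}" using assms unfolding wf_multigraph_def by blast
  then obtain a b where "\<And>e. e \<in> edges H \<Longrightarrow> ends H e = {a e, b e}" by metis
  then have "incidence_map H (\<lambda>h. if snd h then a (fst h) else b (fst h))"
    unfolding incidence_map_def flip_def by auto
  then show ?thesis by blast
qed

lemma incidence_map_in_vertices:
  assumes "wf_multigraph H" "incidence_map H g" "fst h \<in> edges H"
  shows "g h \<in> vertices H"
  using assms(1,3) incidence_mapD[OF assms(2,3)]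
  unfolding wf_multigraph_def by (fastforce simp: doubleton_eq_iff)

lemma rtranclp_adjacent: "(adjacent H)\<^sup>*\<^sup>* = equivclp (adjacent H)"
proof -
  have "symp (adjacent H)" unfolding symp_def adjacent_def by (simp add: insert_commute)
  then show ?thesis unfolding equivclp_def by (simp add: symp_symclp_eq)
qed

definition connecting :: "'e set \<Rightarrow> ('e \<times> bool \<Rightarrow> 'v) \<Rightarrow> 'v set \<Rightarrow> ('e \<times> bool \<Rightarrow> 'e \<times> bool) \<Rightarrow> bool" where
  "connecting F g T m \<longleftrightarrow> mating F g T m \<and> (\<forall>t\<in>T. meets F g t) \<and>
     (\<forall>h h'. fst h \<in> F \<and> fst h' \<in> F \<longrightarrow> linked F g T T m h h')"

lemma connectingD:
  assumes "connecting F g T m"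
  shows "mating F g T m" and "\<And>t. t \<in> T \<Longrightarrow> meets F g t"
    and "\<And>h h'. fst h \<in> F \<Longrightarrow> fst h' \<in> F \<Longrightarrow> linked F g T T m h h'"
  using assms unfolding connecting_def by blast+

lemma connecting_component:
  assumes mate: "mating F\<^sub>0 g T m" and T: "T \<noteq> {}" and met: "\<And>t. t \<in> T \<Longrightarrow> meets F\<^sub>0 g t"
    and linked: "\<And>h h'. fst h \<in> F\<^sub>0 \<Longrightarrow> fst h' \<in> F\<^sub>0 \<Longrightarrow> g h \<in> T \<Longrightarrow> g h' \<in> T \<Longrightarrow> linked F\<^sub>0 g T T m h h'"
  shows "\<exists>F\<subseteq>F\<^sub>0. connecting F g T m"
proof -
  let ?link = "linked F\<^sub>0 g T T m"
  obtain h\<^sub>0 where h0: "fst h\<^sub>0 \<in> F\<^sub>0" "g h\<^sub>0 \<in> T" using T met unfolding meets_def by blast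
  define F where "F = {e \<in> F\<^sub>0. ?link h\<^sub>0 (e, False)}"
  have in_F: "fst h \<in> F \<longleftrightarrow> fst h \<in> F\<^sub>0 \<and> ?link h\<^sub>0 h" for h
  proof -
    have "?link h (fst h, False)" if "fst h \<in> F\<^sub>0"
      using linked_flip[OF that, of g T T m] unfolding flip_def by (cases h; cases "snd h") auto
    then show ?thesis unfolding F_def mem_Collect_eq by (meson equivclp_sym equivclp_trans)
  qed
  have trail_step_F: "trail_step F g T T m x y" if xy: "trail_step F\<^sub>0 g T T m x y" and x: "?link h\<^sub>0 x" for x y
  proof -
    have "?link h\<^sub>0 y" using x xy by (blast intro: equivclp_into_equivclp)
    then show ?thesis using x xy in_F unfolding trail_step_def by simp
  qed
  then have linked_F: "linked F g T T m h\<^sub>0 y" if "?link h\<^sub>0 y" for y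
    using that by (rule equivclp_mono_on_class[rotated])
  have "linked F g T T m h h'" if "fst h \<in> F" "fst h' \<in> F" for h h'
    using linked_F[of h] linked_F[of h'] that unfolding in_F by (meson equivclp_sym equivclp_trans)
  moreover have "mating F g T m"
    unfolding mating_def
  proof (intro allI impI)
    fix h
    assume h: "fst h \<in> F \<and> g h \<notin> T"
    then have "fst h \<in> F\<^sub>0" "g h \<notin> T" using in_F by auto
    note m = matingD[OF mate this]
    have "trail_step F\<^sub>0 g T T m h (m h)" using \<open>fst h \<in> F\<^sub>0\<close> m(1) h unfolding trail_step_def by blast
    then have "trail_step F g T T m h (m h)" using h in_F by (intro trail_step_F) simp_all
    then have "fst (m h) \<in> F" unfolding trail_step_def by blast
    then show "fst (m h) \<in> F \<and> m h \<noteq> h \<and> m (m h) = h \<and> g (m h) = g h" using m by blast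
  qed
  moreover have "meets F g t" if t: "t \<in> T" for t
  proof -
    obtain h where "fst h \<in> F\<^sub>0" "g h = t" using met[OF t] unfolding meets_def by blast
    then have "fst h \<in> F" using linked[OF h0(1) _ h0(2), of h] t in_F by simp
    then show ?thesis using \<open>g h = t\<close> unfolding meets_def by blast
  qed
  ultimately have "connecting F g T m" unfolding connecting_def by simp
  moreover have "F \<subseteq> F\<^sub>0" unfolding F_def by blast
  ultimately show ?thesis by blast
qed

text \<open>The new edge keeps the label of the half-edge \<open>h\<^sub>1\<close>, which moves to the far end of \<open>h\<^sub>2\<close>.\<close>

locale mated_pair =
  fixes F :: "'e set" and g :: "'e \<times> bool \<Rightarrow> 'v" and T :: "'v set" and m h\<^sub>1
  assumes connecting: "connecting F g T m" and T: "T \<noteq> {}" and h1: "fst h\<^sub>1 \<in> F" "g h\<^sub>1 \<notin> T"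
begin

definition h\<^sub>2 :: "'e \<times> bool" where "h\<^sub>2 = m h\<^sub>1"

definition F' :: "'e set" where "F' = F - {fst h\<^sub>2}"

definition unsplit :: "'e \<times> bool \<Rightarrow> 'e \<times> bool" where
  "unsplit h = (if h = h\<^sub>1 then flip h\<^sub>2 else h)"

definition split :: "'e \<times> bool \<Rightarrow> 'e \<times> bool" where
  "split h = (if fst h = fst h\<^sub>2 then h\<^sub>1 else if fst h = fst h\<^sub>1 then flip h\<^sub>1 else h)"

definition g' :: "'e \<times> bool \<Rightarrow> 'v" where "g' = g \<circ> unsplit"

definition m' :: "'e \<times> bool \<Rightarrow> 'e \<times> bool" where "m' = split \<circ> m \<circ> unsplit"

lemmas mate = connectingD(1)[OF connecting]

lemma h2: "fst h\<^sub>2 \<in> F" "h\<^sub>2 \<noteq> h\<^sub>1" "m h\<^sub>2 = h\<^sub>1" "g h\<^sub>2 = g h\<^sub>1"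
  using matingD[OF mate h1] unfolding h\<^sub>2_def by auto

lemma distinct_edges: "fst h\<^sub>2 \<noteq> fst h\<^sub>1"
proof
  assume "fst h\<^sub>2 = fst h\<^sub>1"
  then have flip: "h\<^sub>2 = flip h\<^sub>1" using eq_or_flip_if_same_edge[of h\<^sub>1 h\<^sub>2] h2(2) by simp
  obtain t h where h: "t \<in> T" "fst h \<in> F" "g h = t"
    using T connectingD(2)[OF connecting] unfolding meets_def by blast
  have off_T: "g x \<notin> T" "fst (m x) = fst h\<^sub>1" if "fst x = fst h\<^sub>1" for x
    using eq_or_flip_if_same_edge[of h\<^sub>1 x] that h1 h2 flip unfolding h\<^sub>2_def by auto
  have "fst x = fst h\<^sub>1 \<longleftrightarrow> fst y = fst h\<^sub>1" if "trail_step F g T T m x y" for x y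
    using that matingD(3)[OF mate, of x] off_T[of x] off_T[of y] unfolding trail_step_def by auto
  then have "fst h\<^sub>1 = fst h\<^sub>1 \<longleftrightarrow> fst h = fst h\<^sub>1"
    by (rule equivclp_invariant[OF connectingD(3)[OF connecting h1(1) h(2)], where f = "\<lambda>x. fst x = fst h\<^sub>1"])
  then show False using h off_T by blast
qed

lemma split_in_F': "fst h \<in> F \<Longrightarrow> fst (split h) \<in> F'"
  using h1 distinct_edges unfolding split_def F'_def by auto

lemma unsplit_in_F: "fst h \<in> F' \<Longrightarrow> fst (unsplit h) \<in> F"
  using h2 unfolding unsplit_def F'_def by auto

lemma unsplit_neq: "fst h \<in> F' \<Longrightarrow> unsplit h \<noteq> h\<^sub>1" "fst h \<in> F' \<Longrightarrow> unsplit h \<noteq> h\<^sub>2"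
  using distinct_edges unfolding unsplit_def F'_def by (metis flip_simps(1), auto)

lemma split_unsplit: "fst h \<in> F' \<Longrightarrow> split (unsplit h) = h"
  using eq_or_flip_if_same_edge[of h\<^sub>1 h] unfolding unsplit_def split_def F'_def by auto

lemma unsplit_split: "h \<noteq> h\<^sub>1 \<Longrightarrow> h \<noteq> h\<^sub>2 \<Longrightarrow> unsplit (split h) = h"
  using eq_or_flip_if_same_edge[of h\<^sub>1 h] eq_or_flip_if_same_edge[of h\<^sub>2 h] distinct_edges
  unfolding unsplit_def split_def by auto

lemma mate_neq:
  assumes "fst h \<in> F" "g h \<notin> T" "h \<noteq> h\<^sub>1" "h \<noteq> h\<^sub>2"
  shows "m h \<noteq> h\<^sub>1" "m h \<noteq> h\<^sub>2"
  using matingD(3)[OF mate assms(1,2)] assms(3,4) h2(3) unfolding h\<^sub>2_def by auto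

lemma g'_split: "h \<noteq> h\<^sub>1 \<Longrightarrow> h \<noteq> h\<^sub>2 \<Longrightarrow> g' (split h) = g h"
  unfolding g'_def by (simp add: unsplit_split)

lemma mating_split: "mating F' g' T m'"
  unfolding mating_def
proof (intro allI impI)
  fix h :: "'e \<times> bool"
  assume h: "fst h \<in> F' \<and> g' h \<notin> T"
  then have x: "fst (unsplit h) \<in> F" "g (unsplit h) \<notin> T" using unsplit_in_F unfolding g'_def by auto
  note m = matingD[OF mate x]
  have "unsplit (m' h) = m (unsplit h)"
    unfolding m'_def comp_apply using h by (intro unsplit_split mate_neq x unsplit_neq) blast+
  moreover from this have "m' (m' h) = h" using m(3) split_unsplit h unfolding m'_def[of] by simp
  moreover have "fst (m' h) \<in> F'" using split_in_F'[OF m(1)] unfolding m'_def by simp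
  ultimately show "fst (m' h) \<in> F' \<and> m' h \<noteq> h \<and> m' (m' h) = h \<and> g' (m' h) = g' h"
    using m(2,4) unfolding g'_def by auto
qed

lemma linked_split_step:
  assumes "trail_step F g T T m x y"
  shows "linked F' g' T T m' (split x) (split y)"
proof -
  have in_F': "fst (split x) \<in> F'" "fst (split y) \<in> F'"
    using assms split_in_F' unfolding trail_step_def by auto
  have "linked F' g' T T m' h\<^sub>1 (flip h\<^sub>1)"
    using h1(1) distinct_edges by (intro linked_flip) (auto simp: F'_def)
  then have h1_flip: "linked F' g' T T m' h\<^sub>1 (flip h\<^sub>1)" "linked F' g' T T m' (flip h\<^sub>1) h\<^sub>1"
    by (blast intro: equivclp_sym)+
  consider (along) "y = flip x" | (mate) "g x \<notin> T" "y = m x" | (turn) "g x \<in> T" "g y = g x"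
    using assms unfolding trail_step_def by blast
  then show ?thesis
  proof cases
    case along
    then have "split y = split x \<or> split y = flip (split x)" unfolding split_def by simp
    then show ?thesis using linked_flip[OF in_F'(1)] by auto
  next
    case mate
    show ?thesis
    proof (cases "x = h\<^sub>1 \<or> x = h\<^sub>2")
      case True
      then have "x = h\<^sub>1 \<and> y = h\<^sub>2 \<or> x = h\<^sub>2 \<and> y = h\<^sub>1" using mate(2) h2(3) unfolding h\<^sub>2_def by auto
      then show ?thesis using distinct_edges h1_flip unfolding split_def by auto
    next
      case False
      then have "g' (split x) \<notin> T" "split y = m' (split x)"
        using mate g'_split unsplit_split unfolding m'_def by auto
      then show ?thesis using in_F' by (intro r_into_equivclp) (simp add: trail_step_def)
    qed
  next
    case turn
    then have "x \<notin> {h\<^sub>1, h\<^sub>2}" "y \<notin> {h\<^sub>1, h\<^sub>2}" using h1(2) h2(4) by auto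
    then have "g' (split x) \<in> T" "g' (split y) = g' (split x)" using turn g'_split by auto
    then show ?thesis using in_F' by (intro r_into_equivclp) (simp add: trail_step_def)
  qed
qed

lemma connecting_split: "connecting F' g' T m'"
  unfolding connecting_def
proof (intro conjI mating_split ballI allI impI)
  fix t
  assume t: "t \<in> T"
  then obtain h where h: "fst h \<in> F" "g h = t"
    using connectingD(2)[OF connecting] unfolding meets_def by blast
  then have "g' (split h) = t" using t h1(2) h2(4) by (subst g'_split) auto
  then show "meets F' g' t" using split_in_F'[OF h(1)] unfolding meets_def by blast
next
  fix h h' :: "'e \<times> bool"
  assume h: "fst h \<in> F' \<and> fst h' \<in> F'"
  then have "linked F g T T m (unsplit h) (unsplit h')"
    by (intro connectingD(3)[OF connecting] unsplit_in_F) auto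
  then have "linked F' g' T T m' (split (unsplit h)) (split (unsplit h'))"
    by (rule equivclp_image) (rule linked_split_step)
  then show "linked F' g' T T m' h h'" using h by (simp add: split_unsplit)
qed

definition split_graph :: "('v, 'e) multigraph \<Rightarrow> ('v, 'e) multigraph" where
  "split_graph H = \<lparr>vertices = vertices H, edges = insert (fst h\<^sub>1) (edges H - {fst h\<^sub>1, fst h\<^sub>2}),
     ends = (ends H)(fst h\<^sub>1 := {g (flip h\<^sub>1), g (flip h\<^sub>2)})\<rparr>"

lemma edges_split_graph: "edges H = F \<Longrightarrow> edges (split_graph H) = F'"
  using h1 distinct_edges unfolding split_graph_def F'_def by auto

lemma split_step_split_graph:
  assumes "incidence_map H g" "edges H = F"
  shows "split_step H (split_graph H)"
proof -
  have "ends H (fst h\<^sub>1) = {g h\<^sub>1, g (flip h\<^sub>1)}" "ends H (fst h\<^sub>2) = {g h\<^sub>1, g (flip h\<^sub>2)}"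
    using incidence_mapD[OF assms(1), of h\<^sub>1] incidence_mapD[OF assms(1), of h\<^sub>2] h1 h2 assms(2) by auto
  moreover have "fst h\<^sub>1 \<in> edges H" "fst h\<^sub>2 \<in> edges H" "fst h\<^sub>1 \<notin> edges H - {fst h\<^sub>1, fst h\<^sub>2}"
    using h1 h2 assms(2) by auto
  ultimately show ?thesis unfolding split_step_def split_graph_def using distinct_edges by metis
qed

lemma incidence_map_split_graph:
  assumes "incidence_map H g" "edges H = F"
  shows "incidence_map (split_graph H) g'"
  unfolding incidence_map_def edges_split_graph[OF assms(2)]
proof (intro allI impI)
  fix h :: "'e \<times> bool"
  assume h: "fst h \<in> F'"
  show "ends (split_graph H) (fst h) = {g' h, g' (flip h)}"
  proof (cases "fst h = fst h\<^sub>1")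
    case True
    then show ?thesis
      using eq_or_flip_if_same_edge[of h\<^sub>1 h] unfolding split_graph_def g'_def unsplit_def by auto
  next
    case False
    then have "h \<noteq> h\<^sub>1" "flip h \<noteq> h\<^sub>1" by auto
    then show ?thesis
      using False h incidence_mapD[OF assms(1), of h] assms(2)
      unfolding split_graph_def g'_def unsplit_def F'_def by simp
  qed
qed

end

lemma connected_on_terminals:
  assumes H: "incidence_map H g" "T \<subseteq> vertices H" and conn: "connecting (edges H) g T m"
    and at_T: "\<And>h. fst h \<in> edges H \<Longrightarrow> g h \<in> T"
  shows "vertices (discard_isolated T H) = T" and "connected_graph (discard_isolated T H)"
proof -
  have "v \<in> T" if "e \<in> edges H" "v \<in> ends H e" for e v
    using incidence_mapD[OF H(1), of "(e, True)"] at_T[of "(e, True)"] at_T[of "flip (e, True)"] that by auto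
  then show V: "vertices (discard_isolated T H) = T"
    using H(2) unfolding discard_isolated_def isolated_def by auto
  have adjacent: "adjacent (discard_isolated T H) = adjacent H"
    unfolding adjacent_def discard_isolated_def by auto
  have step: "equivclp (adjacent H) (g h) (g h')" if "trail_step (edges H) g T T m h h'" for h h'
  proof (cases "h' = flip h")
    case True
    then have "fst h \<in> edges H" "ends H (fst h) = {g h, g h'}"
      using incidence_mapD[OF H(1), of h] that unfolding trail_step_def by auto
    then have "adjacent H (g h) (g h')" unfolding adjacent_def by blast
    then show ?thesis by blast
  next
    case False
    moreover have "g h \<in> T" using that at_T unfolding trail_step_def by blast
    ultimately show ?thesis using that unfolding trail_step_def by auto
  qed
  show "connected_graph (discard_isolated T H)"
    unfolding connected_graph_def V adjacent rtranclp_adjacent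
  proof (intro ballI)
    fix s t
    assume "s \<in> T" "t \<in> T"
    then obtain h h' where h: "fst h \<in> edges H" "fst h' \<in> edges H" "g h = s" "g h' = t"
      using connectingD(2)[OF conn] unfolding meets_def by metis
    have "linked (edges H) g T T m h h'" using h by (intro connectingD(3)[OF conn])
    then show "equivclp (adjacent H) s t" unfolding h(3,4)[symmetric] using step by (rule equivclp_image)
  qed
qed

lemma connecting_splits_off:
  fixes H :: "('v, 'e) multigraph"
  assumes "finite (edges H)" "incidence_map H g" "T \<subseteq> vertices H" "T \<noteq> {}" "connecting (edges H) g T m"
  shows "\<exists>H'. split_step\<^sup>*\<^sup>* H H' \<and> vertices (discard_isolated T H') = T \<and>
    connected_graph (discard_isolated T H')"
  using assms(1-3,5)
proof (induction "card (edges H)" arbitrary: H g m rule: less_induct)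
  case less
  show ?case
  proof (cases "\<forall>h. fst h \<in> edges H \<longrightarrow> g h \<in> T")
    case True
    then show ?thesis using connected_on_terminals[OF less.prems(2-4)] by blast
  next
    case False
    then obtain h where "fst h \<in> edges H" "g h \<notin> T" by blast
    then interpret mated_pair "edges H" g T m h
      using less.prems(4) assms(4) by unfold_locales
    note edges' = edges_split_graph[OF refl]
    have "\<exists>H'. split_step\<^sup>*\<^sup>* (split_graph H) H' \<and> vertices (discard_isolated T H') = T \<and>
        connected_graph (discard_isolated T H')"
    proof (rule less.hyps)
      show "card (edges (split_graph H)) < card (edges H)"
        unfolding edges' F'_def using less.prems(1) h2(1) by (rule card_Diff1_less)
      show "finite (edges (split_graph H))" unfolding edges' F'_def using less.prems(1) by simp
      show "incidence_map (split_graph H) g'" by (rule incidence_map_split_graph[OF less.prems(2) refl])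
      show "T \<subseteq> vertices (split_graph H)" using less.prems(3) unfolding split_graph_def by simp
      show "connecting (edges (split_graph H)) g' T m'" unfolding edges' by (rule connecting_split)
    qed
    then show ?thesis
      using split_step_split_graph[OF less.prems(2) refl] by (meson converse_rtranclp_into_rtranclp)
  qed
qed

lemma T_connector_if_connecting:
  assumes G: "finite_multigraph G" "incidence_map G g" and T: "T \<subseteq> vertices G" "T \<noteq> {}"
    and F: "F \<subseteq> edges G" "connecting F g T m"
  shows "T_connector G T (G\<lparr>edges := F\<rparr>)"
proof -
  have "finite F" using G(1) F(1) finite_subset unfolding finite_multigraph_def by blast
  moreover have "incidence_map (G\<lparr>edges := F\<rparr>) g" using G(2) F(1) unfolding incidence_map_def by auto
  moreover have "subgraph (G\<lparr>edges := F\<rparr>) G"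
    using G(1) F(1) unfolding subgraph_def finite_multigraph_def wf_multigraph_def by auto
  ultimately show ?thesis
    unfolding T_connector_def using connecting_splits_off[of "G\<lparr>edges := F\<rparr>" g T m] T F(2) by simp
qed

lemma T_connector_edgeless:
  assumes "T \<subseteq> vertices G" and "\<And>s t. s \<in> T \<Longrightarrow> t \<in> T \<Longrightarrow> s = t"
  shows "T_connector G T \<lparr>vertices = T, edges = {}, ends = ends G\<rparr>"
proof -
  let ?H = "\<lparr>vertices = T, edges = {}, ends = ends G\<rparr>"
  have "subgraph ?H G" using assms(1) unfolding subgraph_def wf_multigraph_def by simp
  moreover have "vertices (discard_isolated T ?H) = T" unfolding discard_isolated_def by auto
  moreover have "connected_graph (discard_isolated T ?H)"
    using assms(2) unfolding connected_graph_def discard_isolated_def by auto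
  ultimately show ?thesis unfolding T_connector_def by blast
qed

lemma edge_cut_boundary: "X \<noteq> {} \<Longrightarrow> X \<subset> vertices G \<Longrightarrow> edge_cut G (boundary G X)"
  unfolding edge_cut_def by blast

lemma separates_boundary:
  assumes s: "s \<in> T" "s \<in> X" and t: "t \<in> T" "t \<notin> X" and T: "T \<subseteq> vertices G"
  shows "separates G (boundary G X) T"
proof -
  let ?D = "delete_edges G (boundary G X)"
  define C where "C u = {x \<in> vertices ?D. (adjacent ?D)\<^sup>*\<^sup>* u x}" for u
  have V: "vertices ?D = vertices G" unfolding delete_edges_def by simp
  have same_side: "x \<in> X \<longleftrightarrow> y \<in> X" if "adjacent ?D x y" for x y
  proof -
    have "\<exists>e\<in>edges G - boundary G X. ends G e = {x, y}"
      using that unfolding adjacent_def delete_edges_def by simp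
    then obtain e where e: "e \<in> edges G" "e \<notin> boundary G X" "ends G e = {x, y}" by blast
    then have "ends G e = {y, x}" by (simp add: insert_commute)
    then have "\<not> (y \<in> X \<and> x \<notin> X)" using e unfolding boundary_def by blast
    moreover have "\<not> (x \<in> X \<and> y \<notin> X)" using e unfolding boundary_def by blast
    ultimately show ?thesis by blast
  qed
  have "s \<in> X \<longleftrightarrow> y \<in> X" if "equivclp (adjacent ?D) s y" for y
    using that same_side by (rule equivclp_invariant[where f = "\<lambda>x. x \<in> X"])
  then have t_off: "t \<notin> C s" using s t unfolding C_def rtranclp_adjacent by blast
  have in_C: "C u \<in> components ?D" "u \<in> C u" if "u \<in> T" for u
  proof -
    have "u \<in> vertices ?D" using T that V by blast
    then show "C u \<in> components ?D" "u \<in> C u" unfolding components_def C_def by blast+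
  qed
  have "C s \<noteq> C t" using t_off in_C(2)[OF t(1)] by metis
  then show ?thesis
    unfolding separates_def using in_C[OF s(1)] in_C[OF t(1)] s(1) t(1) by blast
qed

section \<open>Attaching a root\<close>

locale root_extension =
  fixes G :: "('v, 'e) multigraph" and g :: "'e \<times> bool \<Rightarrow> 'v" and T :: "'v set" and t\<^sub>0 :: 'v and k :: nat
  assumes graph: "finite_multigraph G" "incidence_map G g" and T: "T \<subseteq> vertices G" and t0: "t\<^sub>0 \<in> T"
    and cuts: "\<And>C. edge_cut G C \<Longrightarrow> separates G C T \<Longrightarrow> 6 * k + 6 \<le> card C"
begin

definition E :: "('e + nat) set" where "E = edges G <+> {..<6 * k + 6}"

definition root :: "'v + nat" where "root = Inr 0"

definition terminals :: "('v + nat) set" where "terminals = insert root (Inl ` T)"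

definition ends' :: "('e + nat) \<times> bool \<Rightarrow> 'v + nat" where
  "ends' h = (case fst h of Inl e \<Rightarrow> Inl (g (e, snd h)) | Inr _ \<Rightarrow> if snd h then Inl t\<^sub>0 else root)"

lemma ends'_simps [simp]:
  "ends' (Inl e, b) = Inl (g (e, b))" "ends' (Inr j, True) = Inl t\<^sub>0" "ends' (Inr j, False) = root"
  "ends' (apfst Inl h) = Inl (g h)"
  unfolding ends'_def by (cases h; simp)+

lemma in_E_iff [simp]: "Inl e \<in> E \<longleftrightarrow> e \<in> edges G" "Inr j \<in> E \<longleftrightarrow> j < 6 * k + 6"
  unfolding E_def by auto

lemma finite_E: "finite E"
  using graph(1) unfolding E_def finite_multigraph_def by simp

lemma cut_root: "cut_edges E ends' {root} = Inr ` {..<6 * k + 6}"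
proof (intro set_eqI)
  show "x \<in> cut_edges E ends' {root} \<longleftrightarrow> x \<in> Inr ` {..<6 * k + 6}" for x
    by (cases x) (auto simp: cut_edges_def root_def)
qed

lemma Inl_boundary_subset_cut: "Inl ` boundary G {u \<in> vertices G. Inl u \<in> X} \<subseteq> cut_edges E ends' X"
proof
  fix x :: "'e + nat"
  assume "x \<in> Inl ` boundary G {u \<in> vertices G. Inl u \<in> X}"
  then obtain e a b where e: "x = Inl e" "e \<in> edges G" "ends G e = {a, b}" "Inl a \<in> X"
      "b \<notin> {u \<in> vertices G. Inl u \<in> X}"
    unfolding boundary_def by blast
  have "{g (e, True), g (e, False)} = {a, b}"
    using incidence_mapD[OF graph(2), of "(e, True)"] e unfolding flip_def by simp
  moreover have "g (e, True) \<in> vertices G" "g (e, False) \<in> vertices G"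
    using incidence_map_in_vertices[OF _ graph(2), of "(e, _)"] graph(1) e(2)
    unfolding finite_multigraph_def by auto
  ultimately show "x \<in> cut_edges E ends' X"
    using e unfolding cut_edges_def by (auto simp: doubleton_eq_iff)
qed

lemma card_cut_ge:
  assumes X: "X \<inter> terminals \<noteq> {}" "terminals - X \<noteq> {}"
  shows "6 * k + 6 \<le> card (cut_edges E ends' X)"
proof -
  have card_ge: "card A \<le> card (cut_edges E ends' X)"
    if "i ` A \<subseteq> cut_edges E ends' X" "inj i" for A and i :: "'a \<Rightarrow> 'e + nat"
    using card_mono[OF _ that(1)] finite_E that(2) by (simp add: card_image inj_on_subset)
  show ?thesis
  proof (cases "root \<in> X \<longleftrightarrow> Inl t\<^sub>0 \<in> X")
    case False
    then have "Inr ` {..<6 * k + 6} \<subseteq> cut_edges E ends' X" unfolding cut_edges_def by auto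
    then show ?thesis using card_ge[of Inr "{..<6 * k + 6}"] by simp
  next
    case True
    then obtain s t where st: "s \<in> T" "Inl s \<in> X" "t \<in> T" "Inl t \<notin> X"
      using X t0 unfolding terminals_def by blast
    let ?Y = "{u \<in> vertices G. Inl u \<in> X}"
    have "?Y \<noteq> {}" "?Y \<subset> vertices G" using st T by auto
    then have "edge_cut G (boundary G ?Y)" by (rule edge_cut_boundary)
    moreover have "separates G (boundary G ?Y) T"
      by (rule separates_boundary[of s _ _ t]) (use st T in auto)
    ultimately have "6 * k + 6 \<le> card (boundary G ?Y)" by (rule cuts)
    also have "\<dots> \<le> card (cut_edges E ends' X)" using Inl_boundary_subset_cut by (rule card_ge) simp
    finally show ?thesis .
  qed
qed

lemma rooted_E: "rooted E ends' terminals root k"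
proof -
  have "finite terminals"
    using T graph(1) finite_subset unfolding terminals_def finite_multigraph_def by blast
  moreover have "terminals - {root} \<noteq> {}" using t0 unfolding terminals_def root_def by blast
  moreover have "card (cut_edges E ends' {root}) = 6 * k + 6" unfolding cut_root by (simp add: card_image)
  ultimately show ?thesis unfolding rooted_def using finite_E card_cut_ge by (simp add: terminals_def)
qed

lemma routing_with_unused_root:
  obtains c m where "routing E ends' terminals root k c m" "\<forall>e\<in>cut_edges E ends' {root}. c e = 0"
proof -
  let ?B = "cut_edges E ends' {root}"
  have "infinite (UNIV :: ('v + nat) set)" by (simp add: infinite_UNIV_nat)
  then have "solvable E ends' terminals root k" using rooted_E by (rule rooted_solvable)
  then have "extends_precolourings k ?B (\<lambda>\<phi>. \<exists>c m. solution E ends' terminals root k (\<lambda>_. {}) (\<lambda>_. 0) \<phi> c m)"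
    unfolding solvable_def by (simp add: admissible_def)
  then obtain D n where D: "admissible k ?B D n"
    and ext: "\<And>\<phi>. (\<forall>e. \<phi> e \<le> k) \<and> n \<le> card {e \<in> ?B \<inter> D. \<phi> e = 0} \<Longrightarrow>
      \<exists>c m. solution E ends' terminals root k (\<lambda>_. {}) (\<lambda>_. 0) \<phi> c m"
    unfolding extends_precolourings_def by blast
  have "card ?B = card (?B \<inter> D) + card (?B - D)" using finite_E by (intro card_Int_Diff) simp
  then have "n \<le> card (?B \<inter> D)" using D unfolding admissible_def by linarith
  then obtain c m where sol: "solution E ends' terminals root k (\<lambda>_. {}) (\<lambda>_. 0) (\<lambda>_. 0) c m"
    using ext[of "\<lambda>_. 0"] by (auto simp: Int_def)
  show thesis by (rule that[OF solutionD(1)[OF sol]]) (use solutionD(3)[OF sol] in simp)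
qed

lemma terminals_simps [simp]: "terminals - {root} = Inl ` T" "Inl u \<in> terminals \<longleftrightarrow> u \<in> T"
  unfolding terminals_def root_def by auto

abbreviation lower :: "('e + nat) \<times> bool \<Rightarrow> 'e \<times> bool" where "lower \<equiv> apfst projl"

lemma apfst_Inl_lower:
  assumes "fst x \<in> Inl ` F"
  shows "apfst Inl (lower x) = x" "fst (lower x) \<in> F" "ends' x = Inl (g (lower x))"
  using assms by (cases x; auto)+

lemma lower_apfst_Inl [simp]: "lower (apfst Inl h) = h"
  by (cases h) simp

lemma mating_lower:
  assumes mate: "mating (Inl ` F) ends' terminals m"
  shows "mating F g T (lower \<circ> m \<circ> apfst Inl)"
  unfolding mating_def comp_apply
proof (intro allI impI)
  fix h
  assume h: "fst h \<in> F \<and> g h \<notin> T"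
  then have "fst (apfst Inl h) \<in> Inl ` F" "ends' (apfst Inl h) \<notin> terminals" by auto
  note m = matingD[OF mate this]
  note lower = apfst_Inl_lower[OF m(1)]
  have "lower (m (apfst Inl h)) \<noteq> h" using lower(1) m(2) by auto
  moreover have "g (lower (m (apfst Inl h))) = g h" using lower(3) m(4) by simp
  ultimately show "fst (lower (m (apfst Inl h))) \<in> F \<and> lower (m (apfst Inl h)) \<noteq> h \<and>
      lower (m (apfst Inl (lower (m (apfst Inl h))))) = h \<and> g (lower (m (apfst Inl h))) = g h"
    using lower(1,2) m(3) by simp
qed

lemma linked_lower:
  assumes "linked (Inl ` F) ends' terminals (terminals - {root}) m x y"
  shows "linked F g T T (lower \<circ> m \<circ> apfst Inl) (lower x) (lower y)"
  using assms
proof (rule equivclp_image)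
  fix x y :: "('e + nat) \<times> bool"
  assume step: "trail_step (Inl ` F) ends' terminals (terminals - {root}) m x y"
  then have xy: "fst x \<in> Inl ` F" "fst y \<in> Inl ` F" unfolding trail_step_def by auto
  have "lower (flip x) = flip (lower x)" unfolding flip_def by (cases x) simp
  then have "trail_step F g T T (lower \<circ> m \<circ> apfst Inl) (lower x) (lower y)"
    using step apfst_Inl_lower[OF xy(1)] apfst_Inl_lower[OF xy(2)] unfolding trail_step_def by auto
  then show "linked F g T T (lower \<circ> m \<circ> apfst Inl) (lower x) (lower y)" by blast
qed

lemma connecting_if_rooted_connection:
  assumes conn: "rooted_connection (Inl ` F\<^sub>0) ends' terminals root m" and T_not_singleton: "\<And>t. T \<noteq> {t}"
  shows "\<exists>F\<subseteq>F\<^sub>0. connecting F g T (lower \<circ> m \<circ> apfst Inl)"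
proof (rule connecting_component)
  show "mating F\<^sub>0 g T (lower \<circ> m \<circ> apfst Inl)" by (rule mating_lower[OF rooted_connectionD(1)[OF conn]])
  show "linked F\<^sub>0 g T T (lower \<circ> m \<circ> apfst Inl) h h'"
    if "fst h \<in> F\<^sub>0" "fst h' \<in> F\<^sub>0" "g h \<in> T" "g h' \<in> T" for h h'
  proof -
    have "linked (Inl ` F\<^sub>0) ends' terminals (terminals - {root}) m (apfst Inl h) (apfst Inl h')"
      using that by (intro rooted_connectionD(2)[OF conn]) simp_all
    from linked_lower[OF this] show ?thesis by simp
  qed
  show "meets F\<^sub>0 g t" if "t \<in> T" for t
  proof -
    have "terminals - {root} \<noteq> {Inl t}" using T_not_singleton[of t] by auto
    then have "meets (Inl ` F\<^sub>0) ends' (Inl t)" using that by (intro rooted_connectionD(3)[OF conn]) auto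
    then show ?thesis using apfst_Inl_lower(2,3) unfolding meets_def by fastforce
  qed
qed (use t0 in blast)

lemma connecting_colour_classes:
  assumes "\<And>t. T \<noteq> {t}"
  obtains c m where "\<And>i. i < k \<Longrightarrow> \<exists>F\<subseteq>{e \<in> edges G. c e = Suc i}. connecting F g T m"
proof -
  obtain c m where routing: "routing E ends' terminals root k c m"
    and unused: "\<forall>e\<in>cut_edges E ends' {root}. c e = 0" by (rule routing_with_unused_root)
  have "\<exists>F\<subseteq>{e \<in> edges G. c (Inl e) = Suc i}. connecting F g T (lower \<circ> m \<circ> apfst Inl)" if "i < k" for i
  proof -
    have "{x \<in> E. c x = Suc i} = Inl ` {e \<in> edges G. c (Inl e) = Suc i}"
      using unused[unfolded cut_root] unfolding E_def by auto
    moreover have "Suc i \<in> {1..k}" using that by simp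
    ultimately have "rooted_connection (Inl ` {e \<in> edges G. c (Inl e) = Suc i}) ends' terminals root m"
      using routing unfolding routing_def by metis
    then show ?thesis using assms by (rule connecting_if_rooted_connection)
  qed
  then show thesis by (rule that)
qed

end

theorem theorem1p6:
  fixes G :: "('v, 'e) multigraph" and T :: "'v set" and k :: nat
  assumes "k > 0"
    and "finite_multigraph G"
    and "T \<subseteq> vertices G"
    and "\<And>C. edge_cut G C \<Longrightarrow> separates G C T \<Longrightarrow> card C \<ge> 6 * k + 6"
  shows "\<exists>H :: nat \<Rightarrow> ('v, 'e) multigraph.
           (\<forall>i < k. T_connector G T (H i)) \<and>
           (\<forall>i < k. \<forall>j < k. i \<noteq> j \<longrightarrow> edges (H i) \<inter> edges (H j) = {})"
proof (cases "\<forall>s\<in>T. \<forall>t\<in>T. s = t")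
  case True
  then have "T_connector G T \<lparr>vertices = T, edges = {}, ends = ends G\<rparr>"
    by (intro T_connector_edgeless assms(3)) blast
  then show ?thesis by (intro exI[of _ "\<lambda>_. \<lparr>vertices = T, edges = {}, ends = ends G\<rparr>"]) simp
next
  case False
  then obtain t\<^sub>0 where t0: "t\<^sub>0 \<in> T" by blast
  obtain g where g: "incidence_map G g"
    using assms(2) incidence_map_exists unfolding finite_multigraph_def by blast
  interpret root_extension G g T t\<^sub>0 k using assms(2-4) g t0 by unfold_locales
  obtain c m where "\<And>i. i < k \<Longrightarrow> \<exists>F\<subseteq>{e \<in> edges G. c e = Suc i}. connecting F g T m"
    by (rule connecting_colour_classes) (use False in auto)
  then obtain F where F: "\<And>i. i < k \<Longrightarrow> F i \<subseteq> {e \<in> edges G. c e = Suc i} \<and> connecting (F i) g T m"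
    by metis
  have "T_connector G T (G\<lparr>edges := F i\<rparr>)" if "i < k" for i
    using F[OF that] t0 by (intro T_connector_if_connecting[OF assms(2) g assms(3)]) auto
  moreover have "F i \<inter> F j = {}" if "i < k" "j < k" "i \<noteq> j" for i j
    using F[OF that(1)] F[OF that(2)] that(3) by fastforce
  ultimately show ?thesis by (intro exI[of _ "\<lambda>i. G\<lparr>edges := F i\<rparr>"]) simp
qed

end
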